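(* Let $\{X(t),\ t\in\mathbb{R}\}$ be a zero mean non-Gaussian trawl process with Lévy seed process $L$ and trawl $A=\{(\xi,s): 0\le \xi\le g(-s),\ s\le 0\}$ specified by a trawl function $g:[0,\infty)\to[0,\infty)$. Suppose that the cumulant function $\kappa_L$ of the Lévy seed process is analytic in a neighborhood of the origin, and that the trawl function $g$ is continuously differentiable, decreasing and $(-\alpha-1)$-regularly varying at infinity for some $\alpha>0$. Let $X^*(t)=\int_0^t X(u)\,du$, $t\ge 0$, and let $$\tau_{X^*}(q)=\lim_{t\to\infty}\frac{\log \mathbb{E}|X^*(t)|^q}{\log t}$$ be the scaling function of $X^*=\{X^*(t),\ t\ge 0\}$. Let $q^*$ be the smallest even integer greater than $2\alpha$. Then for every real $q\ge q^*$ $$\tau_{X^*}(q)=q-\alpha .$$ In particular, for $q^*\le p<r$, $$\frac{\tau_{X^*}(p)}{p}<\frac{\tau_{X^*}(r)}{r},$$ and hence $X^*$ is intermittent.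
   Context: Cumulants. For a random variable $Y$, the cumulant function is $\kappa_Y(\zeta)=\log\mathbb{E}e^{i\zeta Y}$, $\zeta\in\mathbb{R}$ (for infinitely divisible $Y$, the continuous logarithm vanishing at $0$). Lévy basis. Let $\mathcal{B}_b(\mathbb{R}\times\mathbb{R})$ be the family of Borel subsets of $\mathbb{R}\times\mathbb{R}$ with finite Lebesgue measure, and let $\mathrm{Leb}$ be Lebesgue measure. A homogeneous Lévy basis on $\mathbb{R}\times\mathbb{R}$ is a collection of random variables $\Lambda=\{\Lambda(B): B\in\mathcal{B}_b(\mathbb{R}\times\mathbb{R})\}$ such that: (i) for every sequence $(B_n)$ of disjoint sets in $\mathcal{B}_b(\mathbb{R}\times\mathbb{R})$ the variables $\Lambda(B_n)$ are independent, and $\Lambda(\bigcup_n B_n)=\sum_n\Lambda(B_n)$ a.s. whenever $\bigcup_n B_n\in\mathcal{B}_b(\mathbb{R}\times\mathbb{R})$; (ii) for any $B_1,\dots,B_n\in\mathcal{B}_b(\mathbb{R}\times\mathbb{R})$ the vector $(\Lambda(B_1),\dots,\Lambda(B_n))$ is infinitely divisible; (iii) there is an infinitely divisible law with cumulant function $\kappa$ such that $\log\mathbb{E}e^{i\zeta\Lambda(B)}=\mathrm{Leb}(B)\,\kappa(\zeta)$ for all $B\in\mathcal{B}_b(\mathbb{R}\times\mathbb{R})$, $\zeta\in\mathbb{R}$. A Lévy process $L=\{L(t),\ t\ge0\}$ such that $L(1)$ has cumulant function $\kappa$ is called the Lévy seed of $\Lambda$; $\kappa_L:=\kappa_{L(1)}=\kappa$.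 Trawl process. The trawl function $g:[0,\infty)\to[0,\infty)$ is a measurable nonincreasing function such that the trawl $A=\{(\xi,s):0\le\xi\le g(-s),\ s\le0\}$ satisfies $\mathrm{Leb}(A)=\int_0^\infty g(x)\,dx<\infty$. With $A_t=A+(0,t)=\{(\xi,s):0\le\xi\le g(t-s),\ s\le t\}$, the trawl process is $X(t)=\Lambda(A_t)$, $t\in\mathbb{R}$. It is strictly stationary with $\log\mathbb{E}e^{i\zeta X(t)}=\mathrm{Leb}(A)\kappa_L(\zeta)$. A measurable version of $X$ is used in defining the integral $X^*(t)=\int_0^tX(u)\,du$. "Non-Gaussian" means that the law of $L(1)$ is not Gaussian, degenerate (constant) laws being counted as Gaussian; equivalently the Lévy measure of $L(1)$ is nonzero. "Decreasing" for $g$ means strictly decreasing (so $g$ is invertible onto its range). Regular variation. $g$ is $(-\alpha-1)$-regularly varying at infinity if $g(x)=\ell(x)x^{-\alpha-1}$ with $\ell$ slowly varying at infinity, i.e. $\ell(tx)/\ell(t)\to1$ as $t\to\infty$ for every $x>0$. Scaling function and intermittency. For a process $Y=\{Y(t),\ t\ge0\}$ let $\overline{q}(Y)=\sup\{q>0:\mathbb{E}|Y(t)|^q<\infty\ \ \forall t\}$. The scaling function is defined for $q\in(0,\overline{q}(Y))$ as $\tau_Y(q)=\lim_{t\to\infty}\frac{\log\mathbb{E}|Y(t)|^q}{\log t}$, assuming the limit exists and is finite. The process $Y$ is intermittent if there exist $p,r\in(0,\overline{q}(Y))$ with $p<r$ such that $\tau_Y(p)/p<\tau_Y(r)/r$.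 *)

theory Defs
  imports "HOL-Probability.Probability"
begin

subsection \<open>Cumulant functions and infinite divisibility\<close>

text \<open>The logarithm of the characteristic function is its continuous branch vanishing at the
  origin; \<open>has_cumulant_function_unique\<close> below shows that it is determined by the law.\<close>

definition has_cumulant_function :: "real measure \<Rightarrow> (real \<Rightarrow> complex) \<Rightarrow> bool" where
  "has_cumulant_function \<mu> \<kappa> \<longleftrightarrow>
     continuous_on UNIV \<kappa> \<and> \<kappa> 0 = 0 \<and> (\<forall>\<zeta>. char \<mu> \<zeta> = exp (\<kappa> \<zeta>))"

lemma has_cumulant_function_unique:
  assumes "has_cumulant_function \<mu> \<kappa>" and "has_cumulant_function \<mu> \<kappa>'"
  shows "\<kappa> = \<kappa>'"
proof -
  let ?d = "\<lambda>\<zeta>. \<kappa> \<zeta> - \<kappa>' \<zeta>"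
  have e: "\<exists>n::int. ?d \<zeta> = of_int (2 * n) * of_real pi * \<i>" for \<zeta>
  proof -
    have "exp (\<kappa> \<zeta>) = exp (\<kappa>' \<zeta>)"
      using assms by (metis has_cumulant_function_def)
    then show ?thesis
      unfolding exp_eq by (auto simp: algebra_simps)
  qed
  have "?d constant_on UNIV"
  proof (rule continuous_discrete_range_constant)
    show "connected (UNIV :: real set)" by simp
    show "continuous_on UNIV ?d"
      using assms by (auto simp: has_cumulant_function_def intro!: continuous_intros)
    fix x :: real
    have "2 * pi \<le> norm (?d y - ?d x)" if ne: "?d y \<noteq> ?d x" for y
    proof -
      obtain m n :: int where m: "?d y = of_int (2 * m) * of_real pi * \<i>"
        and n: "?d x = of_int (2 * n) * of_real pi * \<i>"
        using e by meson
      define k where "k = m - n"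
      have d: "?d y - ?d x = of_int (2 * k) * of_real pi * \<i>"
        unfolding m n k_def by (simp add: algebra_simps)
      have "k \<noteq> 0" using ne m n by (auto simp: k_def)
      then have "1 \<le> \<bar>real_of_int k\<bar>" by linarith
      moreover have "norm (?d y - ?d x) = 2 * \<bar>real_of_int k\<bar> * pi"
        unfolding d norm_mult by (simp add: norm_mult)
      ultimately show ?thesis
        by simp
    qed
    then show "\<exists>e>0. \<forall>y. y \<in> UNIV \<and> ?d y \<noteq> ?d x \<longrightarrow> e \<le> norm (?d y - ?d x)"
      by (intro exI[of _ "2 * pi"]) auto
  qed
  then obtain c where c: "\<And>\<zeta>. ?d \<zeta> = c"
    by (auto simp: constant_on_def)
  have "?d 0 = 0" using assms by (simp add: has_cumulant_function_def)
  then have "c = 0" using c[of 0] by simp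
  then show ?thesis using c by auto
qed

text \<open>For a function on the real line, analyticity at the origin means being given near the
  origin by a convergent power series, i.e. by a holomorphic function.\<close>

definition real_analytic_near_0 :: "(real \<Rightarrow> complex) \<Rightarrow> bool" where
  "real_analytic_near_0 f \<longleftrightarrow>
     (\<exists>r>0. \<exists>F. F holomorphic_on ball 0 r \<and> (\<forall>x. \<bar>x\<bar> < r \<longrightarrow> f x = F (of_real x)))"

text \<open>A law is infinitely divisible if for each \<open>m \<ge> 1\<close> it is the law of a sum of \<open>m\<close> independent
  copies of some law \<open>\<nu>\<close>. Random vectors with finite index set \<open>I\<close> have their law on
  \<open>\<Pi>\<^sub>M i\<in>I. borel\<close>.\<close>

definition infinitely_divisible :: "real measure \<Rightarrow> bool" where
  "infinitely_divisible \<mu> \<longleftrightarrow>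
     (\<forall>m\<ge>1. \<exists>\<nu>. prob_space \<nu> \<and> sets \<nu> = sets borel \<and>
        \<mu> = distr (\<Pi>\<^sub>M k\<in>{..<m::nat}. \<nu>) borel (\<lambda>x. \<Sum>k<m. x k))"

definition infinitely_divisible_vec :: "'i set \<Rightarrow> ('i \<Rightarrow> real) measure \<Rightarrow> bool" where
  "infinitely_divisible_vec I \<mu> \<longleftrightarrow>
     (\<forall>m\<ge>1. \<exists>\<nu>. prob_space \<nu> \<and> sets \<nu> = sets (\<Pi>\<^sub>M i\<in>I. borel) \<and>
        \<mu> = distr (\<Pi>\<^sub>M k\<in>{..<m::nat}. \<nu>) (\<Pi>\<^sub>M i\<in>I. borel) (\<lambda>x. \<lambda>i\<in>I. \<Sum>k<m. x k i))"

definition gaussian_law :: "real measure \<Rightarrow> bool" where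
  "gaussian_law \<mu> \<longleftrightarrow>
     (\<exists>m \<sigma>. \<sigma> > 0 \<and> \<mu> = density lborel (\<lambda>x. ennreal (normal_density m \<sigma> x))) \<or>
     (\<exists>m. \<mu> = return borel m)"

subsection \<open>Levy bases and Levy processes\<close>

definition finite_borel_sets :: "(real \<times> real) set set" where
  "finite_borel_sets = {B \<in> sets borel. emeasure lborel B < \<infinity>}"

definition homogeneous_levy_basis ::
    "'a measure \<Rightarrow> (real \<Rightarrow> complex) \<Rightarrow> ((real \<times> real) set \<Rightarrow> 'a \<Rightarrow> real) \<Rightarrow> bool" where
  "homogeneous_levy_basis M \<kappa> \<Lambda> \<longleftrightarrow>
     prob_space M \<and>
     (\<forall>B\<in>finite_borel_sets. \<Lambda> B \<in> borel_measurable M) \<and>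
     (\<forall>B::nat \<Rightarrow> _. range B \<subseteq> finite_borel_sets \<and> disjoint_family B \<longrightarrow>
        prob_space.indep_vars M (\<lambda>_. borel) (\<lambda>n. \<Lambda> (B n)) UNIV \<and>
        ((\<Union>n. B n) \<in> finite_borel_sets \<longrightarrow>
          (AE \<omega> in M. (\<lambda>n. \<Lambda> (B n) \<omega>) sums \<Lambda> (\<Union>n. B n) \<omega>))) \<and>
     (\<forall>(n::nat) B. (\<forall>i<n. B i \<in> finite_borel_sets) \<longrightarrow>
        infinitely_divisible_vec {..<n}
          (distr M (\<Pi>\<^sub>M i\<in>{..<n}. borel) (\<lambda>\<omega>. \<lambda>i\<in>{..<n}. \<Lambda> (B i) \<omega>))) \<and>
     (\<exists>\<mu>. prob_space \<mu> \<and> sets \<mu> = sets borel \<and> infinitely_divisible \<mu> \<and> has_cumulant_function \<mu> \<kappa>) \<and>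
     (\<forall>B\<in>finite_borel_sets.
        has_cumulant_function (distr M borel (\<Lambda> B)) (\<lambda>\<zeta>. of_real (measure lborel B) * \<kappa> \<zeta>))"

text \<open>The process is indexed by \<open>t \<ge> 0\<close>; its values at negative times are irrelevant.\<close>

definition levy_process :: "'b measure \<Rightarrow> (real \<Rightarrow> 'b \<Rightarrow> real) \<Rightarrow> bool" where
  "levy_process N L \<longleftrightarrow>
     prob_space N \<and>
     (\<forall>t\<ge>0. L t \<in> borel_measurable N) \<and>
     (AE \<omega> in N. L 0 \<omega> = 0) \<and>
     (\<forall>(n::nat) t. 0 \<le> t 0 \<and> strict_mono_on {..n} t \<longrightarrow>
        prob_space.indep_vars N (\<lambda>_. borel) (\<lambda>i \<omega>. L (t (Suc i)) \<omega> - L (t i) \<omega>) {..<n}) \<and>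
     (\<forall>s\<ge>0. \<forall>h\<ge>0. distr N borel (\<lambda>\<omega>. L (s + h) \<omega> - L s \<omega>) = distr N borel (L h)) \<and>
     (\<forall>t\<ge>0. \<forall>\<epsilon>>0.
        ((\<lambda>s. measure N {\<omega> \<in> space N. \<epsilon> < \<bar>L s \<omega> - L t \<omega>\<bar>}) \<longlongrightarrow> 0) (at t within {0..})) \<and>
     (AE \<omega> in N. (\<forall>t\<ge>0. continuous (at_right t) (\<lambda>s. L s \<omega>)) \<and>
                 (\<forall>t>0. \<exists>l. ((\<lambda>s. L s \<omega>) \<longlongrightarrow> l) (at_left t)))"

text \<open>\<open>L\<close> is the Levy seed of any homogeneous Levy basis with cumulant function \<open>\<kappa>\<close>; it may live
  on a probability space of its own.\<close>

definition levy_seed :: "'b measure \<Rightarrow> (real \<Rightarrow> complex) \<Rightarrow> (real \<Rightarrow> 'b \<Rightarrow> real) \<Rightarrow> bool" where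
  "levy_seed N \<kappa> L \<longleftrightarrow> levy_process N L \<and> has_cumulant_function (distr N borel (L 1)) \<kappa>"

subsection \<open>Trawl processes\<close>

text \<open>Functions on \<open>[0,\<infinity>)\<close> are represented by functions on the reals of which only the values on
  \<open>{0..}\<close> matter.\<close>

definition trawl :: "(real \<Rightarrow> real) \<Rightarrow> (real \<times> real) set" where
  "trawl g = {(\<xi>, s). 0 \<le> \<xi> \<and> \<xi> \<le> g (- s) \<and> s \<le> 0}"

definition trawl_at :: "(real \<Rightarrow> real) \<Rightarrow> real \<Rightarrow> (real \<times> real) set" where
  "trawl_at g t = (\<lambda>p. p + (0, t)) ` trawl g"

lemma trawl_at_eq: "trawl_at g t = {(\<xi>, s). 0 \<le> \<xi> \<and> \<xi> \<le> g (t - s) \<and> s \<le> t}"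
proof (intro set_eqI iffI)
  fix p assume "p \<in> {(\<xi>, s). 0 \<le> \<xi> \<and> \<xi> \<le> g (t - s) \<and> s \<le> t}"
  then show "p \<in> trawl_at g t"
    unfolding trawl_at_def
    by (intro image_eqI[of _ _ "p - (0, t)"]) (auto simp: trawl_def prod_eq_iff)
qed (auto simp: trawl_at_def trawl_def)

definition trawl_function :: "(real \<Rightarrow> real) \<Rightarrow> bool" where
  "trawl_function g \<longleftrightarrow>
     g \<in> borel_measurable (restrict_space borel {0..}) \<and>
     (\<forall>x\<ge>0. 0 \<le> g x) \<and>
     antimono_on {0..} g \<and>
     emeasure lborel (trawl g) < \<infinity>"

text \<open>\<open>X\<close> is a (jointly) measurable version of \<open>t \<mapsto> \<Lambda> (trawl_at g t)\<close>.\<close>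

definition trawl_process ::
    "'a measure \<Rightarrow> ((real \<times> real) set \<Rightarrow> 'a \<Rightarrow> real) \<Rightarrow> (real \<Rightarrow> real) \<Rightarrow> (real \<Rightarrow> 'a \<Rightarrow> real) \<Rightarrow> bool" where
  "trawl_process M \<Lambda> g X \<longleftrightarrow>
     trawl_function g \<and>
     (\<lambda>(t, \<omega>). X t \<omega>) \<in> borel_measurable (borel \<Otimes>\<^sub>M M) \<and>
     (\<forall>t. AE \<omega> in M. X t \<omega> = \<Lambda> (trawl_at g t) \<omega>)"

definition zero_mean :: "'a measure \<Rightarrow> (real \<Rightarrow> 'a \<Rightarrow> real) \<Rightarrow> bool" where
  "zero_mean M X \<longleftrightarrow> (\<forall>t. integrable M (X t) \<and> (LINT \<omega>|M. X t \<omega>) = 0)"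

definition integrated_process :: "(real \<Rightarrow> 'a \<Rightarrow> real) \<Rightarrow> real \<Rightarrow> 'a \<Rightarrow> real" where
  "integrated_process X t \<omega> = (LBINT u:{0..t}. X u \<omega>)"

subsection \<open>Conditions on the trawl function\<close>

definition slowly_varying :: "(real \<Rightarrow> real) \<Rightarrow> bool" where
  "slowly_varying l \<longleftrightarrow> (\<forall>x>0. ((\<lambda>t. l (t * x) / l t) \<longlongrightarrow> 1) at_top)"

definition regularly_varying :: "real \<Rightarrow> (real \<Rightarrow> real) \<Rightarrow> bool" where
  "regularly_varying \<rho> g \<longleftrightarrow> (\<exists>l. slowly_varying l \<and> (\<forall>x>0. g x = l x * x powr \<rho>))"

text \<open>The derivative at the boundary point \<open>0\<close> is one-sided.\<close>

definition continuously_differentiable_nonneg :: "(real \<Rightarrow> real) \<Rightarrow> bool" where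
  "continuously_differentiable_nonneg g \<longleftrightarrow>
     (\<exists>g'. continuous_on {0..} g' \<and>
       (\<forall>x\<ge>0. (g has_real_derivative g' x) (at x within {0..})))"

subsection \<open>Scaling function and intermittency\<close>

definition moment_range :: "'a measure \<Rightarrow> (real \<Rightarrow> 'a \<Rightarrow> real) \<Rightarrow> ereal" where
  "moment_range M Y =
     Sup (ereal ` {q. q > 0 \<and> (\<forall>t\<ge>0. integrable M (\<lambda>\<omega>. \<bar>Y t \<omega>\<bar> powr q))})"

definition scaling_ratio :: "'a measure \<Rightarrow> (real \<Rightarrow> 'a \<Rightarrow> real) \<Rightarrow> real \<Rightarrow> real \<Rightarrow> real" where
  "scaling_ratio M Y q t = ln (LINT \<omega>|M. \<bar>Y t \<omega>\<bar> powr q) / ln t"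

definition scaling_function :: "'a measure \<Rightarrow> (real \<Rightarrow> 'a \<Rightarrow> real) \<Rightarrow> real \<Rightarrow> real" where
  "scaling_function M Y q = Lim at_top (scaling_ratio M Y q)"

text \<open>\<open>q\<close> lies in the domain of the scaling function and the limit defining it exists and is finite;
  otherwise the value of \<open>scaling_function\<close> is meaningless.\<close>

definition scaling_function_defined :: "'a measure \<Rightarrow> (real \<Rightarrow> 'a \<Rightarrow> real) \<Rightarrow> real \<Rightarrow> bool" where
  "scaling_function_defined M Y q \<longleftrightarrow>
     0 < q \<and> ereal q < moment_range M Y \<and> (\<exists>l. (scaling_ratio M Y q \<longlongrightarrow> l) at_top)"

definition intermittent :: "'a measure \<Rightarrow> (real \<Rightarrow> 'a \<Rightarrow> real) \<Rightarrow> bool" where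
  "intermittent M Y \<longleftrightarrow>
     (\<exists>p r. scaling_function_defined M Y p \<and> scaling_function_defined M Y r \<and> p < r \<and>
        scaling_function M Y p / p < scaling_function M Y r / r)"

definition q_star :: "real \<Rightarrow> nat" where
  "q_star \<alpha> = (LEAST n. even n \<and> 2 * \<alpha> < real n)"

end

theory Submission
  imports Defs "HOL-Complex_Analysis.Complex_Analysis"
begin

text \<open>The moments of \<open>Y t = integrated_process X t\<close> are squeezed between powers of \<open>t\<close>, without
  computing its cumulants.

  Lower bound: the basis on the set \<open>B\<close> of points belonging to all trawls over \<open>[0, t]\<close> contributes
  \<open>t \<Lambda> B\<close>, up to a centred independent remainder, and \<open>Leb B\<close> has order \<open>t powr (- \<alpha>)\<close>. Since the
  seed is not Gaussian, \<open>E \<bar>\<Lambda> B\<bar>^q \<ge> c Leb B\<close> for small \<open>Leb B\<close>: otherwise a central limit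
  argument along \<open>Leb B \<longrightarrow> 0\<close> makes the exponent quadratic.

  Upper bound: splitting \<open>[0, t]\<close> into \<open>N\<close> pieces of length between \<open>1/2\<close> and \<open>1\<close>, convexity reduces
  the claim to sums of \<open>N\<close> values of \<open>X\<close>. These are sums of independent variables over the atoms
  generated by \<open>N\<close> trawls, to which Rosenthal's inequality for even exponents applies; the condition
  \<open>q > 2 \<alpha>\<close> makes the term with \<open>q\<close>-th moments dominate. The bound \<open>E \<Lambda> B^q \<le> C Leb B\<close> follows
  from the analyticity of the exponent by Cauchy's estimates.\<close>

subsection \<open>Moments from an analytic characteristic function\<close>

text \<open>Heuristics for the exponent: at unit spacing, the points hit by at least k of N trawls
  have measure of order N k^(-\<alpha>-1), up to slow variation. Weighting by k^(q-1) and summing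
  over k up to N gives N^(q-\<alpha>). The variance has order N^(1 + max 0 (1-\<alpha>)), and for q
  \<ge> 2 \<alpha> and q \<ge> 2 its power q/2 does not exceed that. Three obstacles shape the
  proof. The slowly varying factor is controlled only up to small powers, so the upper bounds use
  exponents \<gamma> < \<beta> slightly below \<alpha> + 1; the gap between them also absorbs a
  possible logarithm. \<open>X\<close> agrees with the basis only outside null sets that depend on
  time, so the basis is used at fixed times, and time integrals are taken of \<open>X\<close> alone.
  Finally, the moment inequality for independent sums expands a power and so needs an even exponent;
  a real q is placed between two consecutive even integers, both of which must exceed 2
  \<alpha>.\<close>

definition sdiff :: "'a::ab_group_add \<Rightarrow> ('a \<Rightarrow> complex) \<Rightarrow> 'a \<Rightarrow> complex" where
  "sdiff h f z = f (z + h) - f (z - h)"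

text \<open>Only the bounded factor \<open>2 * \<i> * sin (h * x)\<close> enters, so the formula
  presupposes no moment of \<open>M\<close>. Central differences are chosen because for even
  \<open>n\<close> the power of this factor is a constant sign times a nonnegative function, as
  Fatou's lemma requires.\<close>

lemma sdiff_char:
  assumes "real_distribution M"
  shows "(sdiff h ^^ n) (char M) t =
    (CLINT x|M. iexp (t * x) * (2 * \<i> * of_real (sin (h * x))) ^ n)"
proof (induction n arbitrary: t)
  case 0
  then show ?case by (simp add: char_def)
next
  case (Suc n)
  interpret real_distribution M by fact
  have int: "integrable M (\<lambda>x. iexp (s * x) * (2 * \<i> * of_real (sin (h * x))) ^ n)" for s
    by (rule integrable_const_bound[of _ "2 ^ n"])
       (auto simp: norm_mult norm_power power_mult_distrib intro!: power_le_one)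
  have "(sdiff h ^^ Suc n) (char M) t =
     (CLINT x|M. iexp ((t + h) * x) * (2 * \<i> * of_real (sin (h * x))) ^ n
       - iexp ((t - h) * x) * (2 * \<i> * of_real (sin (h * x))) ^ n)"
    using int[of "t + h"] int[of "t - h"] by (simp add: sdiff_def Suc)
  also have "\<dots> = (CLINT x|M. iexp (t * x) * (2 * \<i> * of_real (sin (h * x))) ^ Suc n)"
  proof (rule Bochner_Integration.integral_cong[OF refl])
    fix x :: real
    have "iexp ((t + h) * x) - iexp ((t - h) * x) = iexp (t * x) * (2 * \<i> * of_real (sin (h * x)))"
      unfolding cis_conv_exp[symmetric]
      by (simp add: complex_eq_iff ring_distribs sin_add sin_diff cos_add cos_diff)
    then show "iexp ((t + h) * x) * (2 * \<i> * of_real (sin (h * x))) ^ n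
       - iexp ((t - h) * x) * (2 * \<i> * of_real (sin (h * x))) ^ n =
       iexp (t * x) * (2 * \<i> * of_real (sin (h * x))) ^ Suc n"
      by (metis (no_types, lifting) left_diff_distrib mult.assoc power_Suc)
  qed
  finally show ?case .
qed

text \<open>One difference kills constants. Passing from \<open>char M\<close> to
  \<open>char M - 1\<close> is what later brings the small factor \<open>a\<close> into the moment
  bounds.\<close>

lemma sdiff_minus_const: "(sdiff h ^^ Suc n) (\<lambda>z. f z - c) = (sdiff h ^^ Suc n) f"
  by (simp only: funpow_Suc_right o_apply) (simp add: sdiff_def[abs_def])

lemma sdiff_of_real:
  assumes "\<And>x::real. \<bar>x\<bar> < R \<Longrightarrow> f x = F (of_real x)" "0 \<le> h" "\<bar>x\<bar> < R - n * h"
  shows "(sdiff h ^^ n) f x = (sdiff (of_real h) ^^ n) F (of_real x)"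
  using assms(3)
proof (induction n arbitrary: x)
  case 0
  then show ?case using assms by simp
next
  case (Suc n)
  have "\<bar>x + h\<bar> < R - n * h" "\<bar>x - h\<bar> < R - n * h"
    using Suc.prems \<open>0 \<le> h\<close> by (auto simp: algebra_simps abs_if split: if_splits)
  then have "(sdiff h ^^ n) f (x + h) = (sdiff (of_real h) ^^ n) F (of_real (x + h))"
    "(sdiff h ^^ n) f (x - h) = (sdiff (of_real h) ^^ n) F (of_real (x - h))"
    using Suc.IH by blast+
  then show ?case by (simp add: sdiff_def[where f = "(sdiff _ ^^ _) _"])
qed

text \<open>Each difference gives up radius \<open>\<eta>\<close> and gains the factor
  \<open>4 * h / \<eta>\<close>: on the ball smaller by \<open>\<eta> / 2\<close>, Cauchy's
  inequality bounds the derivative by \<open>2 * b / \<eta>\<close>, and the points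
  \<open>z + h\<close> and \<open>z - h\<close> of that ball are \<open>2 * h\<close> apart. As
  \<open>\<eta>\<close> is chosen independently of \<open>h\<close>, the \<open>n\<close>-th
  difference is of order \<open>h ^ n\<close>.\<close>

lemma sdiff_bound:
  fixes F :: "complex \<Rightarrow> complex" and h :: real
  assumes F: "F holomorphic_on ball 0 R" "\<And>z. z \<in> ball 0 R \<Longrightarrow> norm (F z) \<le> B"
    and h: "0 < h" "2 * h \<le> \<eta>"
  shows "(sdiff (of_real h) ^^ n) F holomorphic_on ball 0 (R - n * \<eta>) \<and>
    (\<forall>z\<in>ball 0 (R - n * \<eta>). norm ((sdiff (of_real h) ^^ n) F z) \<le> (4 * h / \<eta>) ^ n * B)"
proof (induction n)
  case 0
  then show ?case using F by simp
next
  case (Suc n)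
  define G where "G = (sdiff (of_real h) ^^ n) F"
  define S where "S = R - n * \<eta>"
  define b where "b = (4 * h / \<eta>) ^ n * B"
  have G: "G holomorphic_on ball 0 S" "\<And>z. z \<in> ball 0 S \<Longrightarrow> norm (G z) \<le> b"
    using Suc by (auto simp: G_def S_def b_def)
  have \<eta>: "\<eta> > 0" using h by simp
  have S': "R - Suc n * \<eta> = S - \<eta>" by (simp add: S_def algebra_simps)
  have sub: "z + of_real s \<in> ball 0 (S - \<eta> / 2)" if "z \<in> ball 0 (S - \<eta>)" "\<bar>s\<bar> \<le> h" for z :: complex and s
  proof -
    have "norm (z + of_real s) \<le> norm z + norm (of_real s :: complex)" by (rule norm_triangle_ineq)
    then have "norm (z + of_real s) < S - \<eta> / 2" using that h by (simp add: dist_norm)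
    then show ?thesis by simp
  qed
  have subp: "z + of_real h \<in> ball 0 (S - \<eta> / 2)" "z - of_real h \<in> ball 0 (S - \<eta> / 2)"
    if "z \<in> ball 0 (S - \<eta>)" for z :: complex
    using sub[OF that, of h] sub[OF that, of "-h"] h by auto
  have sub2: "ball 0 (S - \<eta> / 2) \<subseteq> ball 0 S" using \<eta> by auto
  have "(\<lambda>z. G (z + of_real h) - G (z - of_real h)) holomorphic_on ball 0 (S - \<eta>)"
    using subp sub2
    by (intro holomorphic_intros holomorphic_on_compose_gen[OF _ G(1), unfolded o_def]) blast+
  moreover have "norm (G (z + of_real h) - G (z - of_real h)) \<le> 4 * h / \<eta> * b"
    if z: "z \<in> ball 0 (S - \<eta>)" for z
  proof -
    have deriv: "norm (deriv G w) \<le> 2 * b / \<eta>" if w: "w \<in> ball 0 (S - \<eta> / 2)" for w :: complex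
    proof -
      have c: "cball w (\<eta> / 2) \<subseteq> ball 0 S"
        using w by (intro cball_subset_ball_iff[THEN iffD2]) (auto simp: dist_norm)
      then have b: "ball w (\<eta> / 2) \<subseteq> ball 0 S" by auto
      have "norm ((deriv ^^ 1) G w) \<le> fact 1 * b / (\<eta> / 2) ^ 1"
      proof (rule Cauchy_inequality)
        show "G holomorphic_on ball w (\<eta> / 2)" by (rule holomorphic_on_subset[OF G(1) b])
        show "continuous_on (cball w (\<eta> / 2)) G"
          by (rule continuous_on_subset[OF holomorphic_on_imp_continuous_on[OF G(1)] c])
        show "norm (G x) \<le> b" if "norm (w - x) = \<eta> / 2" for x
          using that c by (intro G(2)) (auto simp: dist_norm)
      qed (use \<eta> in auto)
      then show ?thesis by (simp add: mult.commute)
    qed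
    have "norm (G (z + of_real h) - G (z - of_real h)) \<le>
        2 * b / \<eta> * norm ((z + of_real h) - (z - of_real h))"
    proof (rule field_differentiable_bound[where S = "ball 0 (S - \<eta> / 2)" and f' = "deriv G"])
      fix w :: complex assume w: "w \<in> ball 0 (S - \<eta> / 2)"
      show "(G has_field_derivative deriv G w) (at w within ball 0 (S - \<eta> / 2))"
        using w sub2 G(1)
        by (blast intro: has_field_derivative_at_within holomorphic_derivI[OF G(1) open_ball])
    qed (use deriv subp[OF z] in auto)
    also have "norm ((z + of_real h) - (z - of_real h)) = 2 * h"
    proof -
      have "(z + of_real h) - (z - of_real h) = of_real (2 * h)" by simp
      then show ?thesis using h by (simp only: norm_of_real) 
    qed
    finally show ?thesis by (simp add: field_simps)
  qed
  ultimately show ?case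
    unfolding S' by (simp add: sdiff_def[abs_def] G_def b_def mult.assoc)
qed

text \<open>The \<open>n\<close>-th symmetric difference at the origin of the characteristic function is the mean of
  \<open>(2 \<i> sin (h x)) ^ n\<close>; Fatou's lemma as \<open>h \<longrightarrow> 0\<close> turns its Cauchy estimate into a moment bound.\<close>

lemma even_moment_bound:
  assumes M: "real_distribution M"
    and G: "G holomorphic_on ball 0 R" "\<And>z. z \<in> ball 0 R \<Longrightarrow> norm (G z) \<le> B"
    and R: "R > 0" and n: "even n" "n > 0"
    and char: "\<And>x. \<bar>x\<bar> < R \<Longrightarrow> char M x = 1 + G (of_real x)"
  shows "integrable M (\<lambda>x. x ^ n)" "(LINT x|M. x ^ n) \<le> (4 * real n / R) ^ n * B"
proof -
  interpret real_distribution M by fact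
  \<comment> \<open>The \<open>n\<close> differences use up half of the radius, so the origin stays
    inside the remaining ball. The factor \<open>4 * h / \<eta>\<close> becomes \<open>2 * h\<close>
    times the \<open>4 * n / R\<close> of the claim, and \<open>(2 * h) ^ n\<close> cancels.\<close>
  define \<eta> where "\<eta> = R / (2 * n)"
  have \<eta>: "\<eta> > 0" using R n by (simp add: \<eta>_def)
  define C where "C = (4 * real n / R) ^ n * B"
  have "norm (G 0) \<le> B" using G(2)[of 0] R by simp
  then have B: "B \<ge> 0" using norm_ge_zero order_trans by blast
  have C: "C \<ge> 0" using B R by (simp add: C_def)
  have bound: "(\<integral>\<^sup>+x. ennreal ((sin (h * x) / h) ^ n) \<partial>M) \<le> ennreal C"
    if h: "0 < h" "2 * h \<le> \<eta>" for h
  proof -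
    have int: "integrable M (\<lambda>x. (sin (h * x) / h) ^ n)"
      by (rule integrable_const_bound[of _ "(1 / h) ^ n"])
         (use h in \<open>auto simp: power_abs intro!: power_mono divide_right_mono\<close>)
    have nh: "n * h < R"
    proof -
      have "n * h \<le> n * \<eta>" using h by (intro mult_left_mono) auto
      also have "\<dots> < R" using R n by (simp add: \<eta>_def)
      finally show ?thesis .
    qed
    obtain n' where n': "n = Suc n'" using n by (cases n) auto
    have "(sdiff h ^^ n) (char M) 0 = (sdiff h ^^ n) (\<lambda>x. char M x - 1) 0"
      unfolding n' sdiff_minus_const ..
    also have "\<dots> = (sdiff (of_real h) ^^ n) G (of_real 0)"
      by (rule sdiff_of_real[where R = R]) (use char h nh in auto)
    finally have eq: "(sdiff h ^^ n) (char M) 0 = (sdiff (of_real h) ^^ n) G 0" by simp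
    have "0 \<in> ball (0::complex) (R - n * \<eta>)" using R n by (simp add: \<eta>_def)
    then have "norm ((sdiff (of_real h) ^^ n) G 0) \<le> (4 * h / \<eta>) ^ n * B"
      using sdiff_bound[OF G h] by blast
    then have 1: "norm (CLINT x|M. (2 * \<i> * of_real (sin (h * x))) ^ n) \<le> (4 * h / \<eta>) ^ n * B"
      unfolding eq[symmetric] sdiff_char[OF M] by simp
    have "(2 * \<i> * of_real (sin (h * x))) ^ n =
        (2 * \<i> * of_real h) ^ n * complex_of_real ((sin (h * x) / h) ^ n)" for x
      using h by (simp add: power_mult_distrib power_divide)
    then have eq2: "norm (CLINT x|M. (2 * \<i> * of_real (sin (h * x))) ^ n) =
        (2 * h) ^ n * norm (LINT x|M. (sin (h * x) / h) ^ n)"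
      using h by (simp add: norm_mult norm_power del: of_real_power of_real_divide)
    then have "(2 * h) ^ n * (LINT x|M. (sin (h * x) / h) ^ n) \<le> (4 * h / \<eta>) ^ n * B"
    proof -
      have "(2 * h) ^ n * (LINT x|M. (sin (h * x) / h) ^ n)
          \<le> (2 * h) ^ n * norm (LINT x|M. (sin (h * x) / h) ^ n)"
        using h by (intro mult_left_mono) auto
      with 1 show ?thesis unfolding eq2 by linarith
    qed
    also have "(4 * h / \<eta>) ^ n * B = (2 * h) ^ n * C"
    proof -
      have "4 * h / \<eta> = (2 * h) * (4 * real n / R)"
        using R n by (simp add: \<eta>_def field_simps)
      then show ?thesis by (simp only: C_def power_mult_distrib mult.assoc)
    qed
    finally have "(LINT x|M. (sin (h * x) / h) ^ n) \<le> C"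
      using h by simp
    then show ?thesis
      using int n by (subst nn_integral_eq_integral) (auto intro!: ennreal_leI zero_le_even_power)
  qed
  define h where "h = (\<lambda>m::nat. \<eta> / (2 * (Suc m)))"
  have h: "0 < h m" "2 * h m \<le> \<eta>" for m
    using \<eta> by (auto simp: h_def field_simps)
  have lim: "(\<lambda>m. ennreal ((sin (h m * x) / h m) ^ n)) \<longlonglongrightarrow> ennreal (x ^ n)" for x
  proof -
    have "((\<lambda>y. sin (y * x)) has_field_derivative cos (0 * x) * x) (at 0)"
      by (auto intro!: derivative_eq_intros)
    then have "((\<lambda>y. sin (y * x) / y) \<longlongrightarrow> x) (at 0)"
      by (simp add: has_field_derivative_iff)
    moreover have "filterlim h (at 0) sequentially"
    proof -
      have "(\<lambda>m. (\<eta> / 2) * (1 / real (Suc m))) \<longlonglongrightarrow> (\<eta> / 2) * 0"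
        by (intro tendsto_mult LIMSEQ_Suc[OF lim_1_over_n] tendsto_const)
      then have "h \<longlonglongrightarrow> 0"
        by (simp add: h_def[abs_def])
      then show ?thesis
        using h(1) by (auto simp: filterlim_at intro!: always_eventually less_imp_neq[THEN not_sym])
    qed
    ultimately have "(\<lambda>m. sin (h m * x) / h m) \<longlonglongrightarrow> x"
      by (rule filterlim_compose)
    then show ?thesis
      by (intro tendsto_ennrealI tendsto_power)
  qed
  have "(\<integral>\<^sup>+x. ennreal (x ^ n) \<partial>M) =
      (\<integral>\<^sup>+x. liminf (\<lambda>m. ennreal ((sin (h m * x) / h m) ^ n)) \<partial>M)"
    by (intro nn_integral_cong lim_imp_Liminf[symmetric] lim) simp
  also have "\<dots> \<le> liminf (\<lambda>m. \<integral>\<^sup>+x. ennreal ((sin (h m * x) / h m) ^ n) \<partial>M)"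
    by (intro nn_integral_liminf) simp
  also have "\<dots> \<le> liminf (\<lambda>m. ennreal C)"
    by (intro Liminf_mono always_eventually allI bound h)
  also have "\<dots> = ennreal C" by (simp add: Liminf_const)
  finally have le: "(\<integral>\<^sup>+x. ennreal (x ^ n) \<partial>M) \<le> ennreal C" .
  show int: "integrable M (\<lambda>x. x ^ n)"
    using le n by (intro integrableI_bounded)
      (auto simp: zero_le_even_power order_le_less_trans[OF _ ennreal_less_top])
  have "ennreal (LINT x|M. x ^ n) \<le> ennreal C"
    using le int n by (subst (asm) nn_integral_eq_integral) (auto intro!: zero_le_even_power)
  then show "(LINT x|M. x ^ n) \<le> (4 * real n / R) ^ n * B"
    using C by (simp add: C_def)
qed

lemma norm_exp_minus_1_le: "norm (exp z - 1) \<le> norm z * exp (norm z)"  for z :: complex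
proof -
  have "norm (exp z - exp 0) \<le> exp (norm z) * norm (z - 0)"
  proof (rule field_differentiable_bound[where S = "cball 0 (norm z)" and f' = exp])
    fix w :: complex assume "w \<in> cball 0 (norm z)"
    then show "norm (exp w) \<le> exp (norm z)"
      using complex_Re_le_cmod[of w] by (auto simp: norm_exp_eq_Re)
  qed (auto intro!: derivative_eq_intros)
  then show ?thesis by (simp add: mult.commute)
qed

text \<open>On the ball of radius \<open>r / 2\<close> the function \<open>F\<close> is bounded by
  some \<open>B\<close>, hence \<open>exp (a * F) - 1\<close> by \<open>a * B * exp (K * B)\<close>.
  The factor \<open>a\<close> passes to the moments, and the constant serves all laws with exponent
  \<open>a * F\<close> and \<open>a \<le> K\<close> at once.\<close>

lemma levy_even_moment_bound:
  assumes F: "F holomorphic_on ball 0 r" and r: "r > 0" and n: "even n" "n > 0" and K: "K \<ge> 0"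
  shows "\<exists>C\<ge>0. \<forall>a M. 0 \<le> a \<longrightarrow> a \<le> K \<longrightarrow> real_distribution M \<longrightarrow>
    (\<forall>x. \<bar>x\<bar> < r \<longrightarrow> char M x = exp (of_real a * F (of_real x))) \<longrightarrow>
    integrable M (\<lambda>x. x ^ n) \<and> (LINT x|M. x ^ n) \<le> C * a"
proof -
  have "compact (cball 0 (r/2) :: complex set)" by simp
  moreover have sub: "cball 0 (r/2) \<subseteq> ball (0::complex) r" using r by auto
  ultimately have "bounded (F ` cball 0 (r/2))"
    by (intro compact_imp_bounded compact_continuous_image
      continuous_on_subset[OF holomorphic_on_imp_continuous_on[OF F]])
  then obtain B where B: "\<And>z. z \<in> cball 0 (r/2) \<Longrightarrow> norm (F z) \<le> B" "B > 0"
    unfolding bounded_pos by blast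
  define C where "C = (4 * real n / (r/2)) ^ n * (B * exp (K * B))"
  show ?thesis
  proof (intro exI[of _ C] conjI allI impI)
    show "C \<ge> 0" using r B(2) by (simp add: C_def)
    fix a M assume a: "0 \<le> a" "a \<le> K" and M: "real_distribution M"
      and char: "\<forall>x. \<bar>x\<bar> < r \<longrightarrow> char M x = exp (of_real a * F (of_real x))"
    define G where "G = (\<lambda>z. exp (of_real a * F z) - 1)"
    have hol: "G holomorphic_on ball 0 (r/2)"
      unfolding G_def using sub by (intro holomorphic_intros holomorphic_on_subset[OF F]) auto
    have bd: "norm (G z) \<le> a * B * exp (K * B)" if z: "z \<in> ball 0 (r/2)" for z
    proof -
      have "norm (G z) \<le> norm (of_real a * F z) * exp (norm (of_real a * F z))"
        unfolding G_def by (rule norm_exp_minus_1_le)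
      also have "\<dots> \<le> (a * B) * exp (K * B)"
        using z a B by (intro mult_mono exp_le_cancel_iff[THEN iffD2])
           (auto simp: norm_mult intro!: mult_mono B(1))
      finally show ?thesis .
    qed
    have ch: "char M x = 1 + G (of_real x)" if "\<bar>x\<bar> < r/2" for x
      using char that r by (simp add: G_def)
    note * = even_moment_bound[OF M hol bd _ n ch]
    show "integrable M (\<lambda>x. x ^ n)" using * r by simp
    show "(LINT x|M. x ^ n) \<le> C * a" using *(2) r by (simp add: C_def mult_ac)
  qed
qed

text \<open>Both sides are the derivative of \<open>char M\<close> at the origin, once from the
  Taylor expansion with a finite second moment, once from the exponent. It turns the zero mean of
  one basis variable into \<open>deriv F 0 = 0\<close>, which in turn centres all of them.\<close>

lemma levy_mean:
  assumes M: "real_distribution M" and F: "F holomorphic_on ball 0 r" "r > 0" "F 0 = 0"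
    and char: "\<And>x. \<bar>x\<bar> < r \<Longrightarrow> char M x = exp (of_real a * F (of_real x))"
    and int: "integrable M (\<lambda>x. x ^ 2)"
  shows "\<i> * of_real (LINT x|M. x) = of_real a * deriv F 0"
proof -
  interpret real_distribution M by fact
  define m where "m = (LINT x|M. x)"
  define v where "v = (LINT x|M. x ^ 2)"
  have int1: "integrable M (\<lambda>x. x ^ k)" if "k \<le> 2" for k
  proof (rule Bochner_Integration.integrable_bound)
    show "integrable M (\<lambda>x. 1 + x ^ 2)" using int by simp
    have "\<bar>x\<bar> ^ k \<le> 1 + x ^ 2" for x :: real
    proof (cases "\<bar>x\<bar> \<le> 1")
      case True
      then show ?thesis by (smt (verit) power_le_one abs_ge_zero zero_le_power2)
    next
      case False
      then show ?thesis using power_increasing[OF that, of "\<bar>x\<bar>"] by simp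
    qed
    then show "AE x in M. norm (x ^ k) \<le> norm (1 + x ^ 2)"
      by (simp add: power_abs)
  qed simp
  have v0: "v \<ge> 0" by (simp add: v_def)
  \<comment> \<open>The quadratic term of the expansion is moved to the error, whose bound
    \<open>t\<^sup>2 * v\<close> it at most doubles.\<close>
  have approx: "norm (char M t - 1 - \<i> * t * m) \<le> 2 * t\<^sup>2 * v" for t
  proof -
    have "cmod (char M t - (\<Sum>k\<le>2. ((\<i> * t)^k / fact k) * expectation (\<lambda>x. x^k))) \<le>
      (2*\<bar>t\<bar>^2 / fact 2) * expectation (\<lambda>x. \<bar>x\<bar>^2)"
      by (rule char_approx1) (rule int1)
    moreover have "(\<Sum>k\<le>2. ((\<i> * t)^k / fact k) * expectation (\<lambda>x. x^k)) =
        1 + \<i> * t * m - t\<^sup>2 * v / 2"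
      using prob_space by (simp add: eval_nat_numeral m_def v_def algebra_simps)
    ultimately have "cmod (char M t - (1 + \<i> * t * m - t\<^sup>2 * v / 2)) \<le> t\<^sup>2 * v"
      by (simp add: v_def fact_numeral)
    moreover have "cmod (of_real (t\<^sup>2 * v / 2)) \<le> t\<^sup>2 * v"
      using v0 by (simp only: norm_of_real) (simp add: abs_mult)
    moreover have eq: "char M t - 1 - \<i> * t * m =
        (char M t - (1 + \<i> * t * m - t\<^sup>2 * v / 2)) - of_real (t\<^sup>2 * v / 2)" by simp
    ultimately show ?thesis unfolding eq
      using norm_triangle_ineq4[of "char M t - (1 + \<i> * t * m - t\<^sup>2 * v / 2)" "of_real (t\<^sup>2 * v / 2)"]
      by linarith
  qed
  define h where "h = (\<lambda>n. 1 / real (Suc n))"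
  have h: "h \<longlonglongrightarrow> 0" unfolding h_def by (rule LIMSEQ_Suc[OF lim_1_over_n])
  have hpos: "h n > 0" for n by (simp add: h_def)
  have "(\<lambda>n. (char M (h n) - 1) / h n - \<i> * m) \<longlonglongrightarrow> 0"
  proof (rule Lim_null_comparison)
    show "\<forall>\<^sub>F n in sequentially. norm ((char M (h n) - 1) / h n - \<i> * m) \<le> 2 * h n * v"
    proof (intro always_eventually allI)
      fix n
      have "(char M (h n) - 1) / h n - \<i> * m = (char M (h n) - 1 - \<i> * h n * m) / h n"
        using hpos[of n] by (simp add: field_simps)
      then have "norm ((char M (h n) - 1) / h n - \<i> * m) \<le> 2 * (h n)\<^sup>2 * v / h n"
        using approx[of "h n"] hpos[of n] by (simp add: norm_divide divide_right_mono)
      then show "norm ((char M (h n) - 1) / h n - \<i> * m) \<le> 2 * h n * v"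
        using hpos[of n] by (simp add: power2_eq_square)
    qed
    show "(\<lambda>n. 2 * h n * v) \<longlonglongrightarrow> 0" using h by (auto intro!: tendsto_eq_intros)
  qed
  then have 1: "(\<lambda>n. (char M (h n) - 1) / h n) \<longlonglongrightarrow> \<i> * m"
    by (simp add: LIM_zero_iff)
  have "(F has_field_derivative deriv F 0) (at 0)"
    using F by (intro holomorphic_derivI[of _ "ball 0 r"]) auto
  then have "((\<lambda>z. exp (of_real a * F z)) has_field_derivative of_real a * deriv F 0) (at 0)"
    using F(3) by (auto intro!: derivative_eq_intros)
  then have "((\<lambda>z. (exp (of_real a * F z) - 1) / z) \<longlongrightarrow> of_real a * deriv F 0) (at 0)"
    using F(3) by (simp add: has_field_derivative_iff)
  moreover have "filterlim (\<lambda>n. of_real (h n)) (at (0::complex)) sequentially"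
    using hpos h tendsto_of_real_iff[of h 0 sequentially, where 'a = complex]
    by (auto simp: filterlim_at intro!: always_eventually less_imp_neq[THEN not_sym])
  ultimately have "(\<lambda>n. (exp (of_real a * F (of_real (h n))) - 1) / of_real (h n)) \<longlonglongrightarrow> of_real a * deriv F 0"
    by (rule filterlim_compose)
  moreover have "\<forall>\<^sub>F n in sequentially. (exp (of_real a * F (of_real (h n))) - 1) / of_real (h n)
      = (char M (h n) - 1) / h n"
    using order_tendstoD(2)[OF h F(2)] 
  proof eventually_elim
    case (elim n)
    then show ?case using char[of "h n"] hpos[of n] by simp
  qed
  ultimately have "(\<lambda>n. (char M (h n) - 1) / h n) \<longlonglongrightarrow> of_real a * deriv F 0"
    by (rule Lim_transform_eventually)
  with 1 show ?thesis unfolding m_def by (rule LIMSEQ_unique)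
qed

subsection \<open>Small-time moments of infinitely divisible laws\<close>

lemma gaussian_law_if_char:
  assumes M: "real_distribution M" and s: "s \<ge> 0"
    and char: "\<And>t. char M t = exp (- of_real (s * t\<^sup>2 / 2))"
  shows "gaussian_law M"
proof (cases "s = 0")
  case True
  have "M = return borel 0"
  proof (rule Levy_uniqueness[OF M])
    show "real_distribution (return borel (0::real))"
      by (auto simp: real_distribution_def real_distribution_axioms_def prob_space_return)
    show "char M = char (return borel 0)"
      using True by (auto simp: fun_eq_iff char char_def[of "return _ _"] integral_return)
  qed
  then show ?thesis by (auto simp: gaussian_law_def)
next
  case False
  define \<sigma> where "\<sigma> = sqrt s"
  have \<sigma>: "\<sigma> > 0" "\<sigma>\<^sup>2 = s" using False s by (auto simp: \<sigma>_def)
  interpret N: real_distribution std_normal_distribution by (rule real_dist_normal_dist)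
  have "distributed std_normal_distribution lborel (\<lambda>x. x) std_normal_density"
    by (auto simp: distributed_def distr_id2)
  then have "distributed std_normal_distribution lborel (\<lambda>x. 0 + \<sigma> * x)
      (normal_density (0 + \<sigma> * 0) (\<bar>\<sigma>\<bar> * 1))"
    by (rule N.normal_density_affine) (use \<sigma> in auto)
  then have eq: "distr std_normal_distribution borel (\<lambda>x. \<sigma> * x) = density lborel (normal_density 0 \<sigma>)"
    using \<sigma> by (simp add: distributed_def cong: distr_cong)
  have "M = distr std_normal_distribution borel (\<lambda>x. \<sigma> * x)"
  proof (rule Levy_uniqueness[OF M])
    show "real_distribution (distr std_normal_distribution borel (\<lambda>x. \<sigma> * x))"
      by (rule N.real_distribution_distr) simp
    show "char M = char (distr std_normal_distribution borel (\<lambda>x. \<sigma> * x))"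
    proof
      fix t
      have "char (distr std_normal_distribution borel (\<lambda>x. \<sigma> * x)) t = char std_normal_distribution (t * \<sigma>)"
        unfolding char_def by (subst integral_distr) (auto simp: mult_ac)
      also have "\<dots> = char M t"
      proof -
        have "exp (- complex_of_real (s * t\<^sup>2 / 2)) = of_real (exp (- (s * t\<^sup>2 / 2)))"
          by (metis exp_of_real of_real_minus)
        moreover have "(t * \<sigma>)\<^sup>2 = s * t\<^sup>2" using \<sigma>(2) by (simp add: power_mult_distrib)
        ultimately show ?thesis unfolding char char_std_normal_distribution by simp
      qed
      finally show "char M t = char (distr std_normal_distribution borel (\<lambda>x. \<sigma> * x)) t" ..
    qed
  qed
  then show ?thesis using eq \<sigma> unfolding gaussian_law_def by auto
qed

text \<open>Below \<open>\<eta>\<close> the first term dominates, above it the second. Second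
  moments of order \<open>a\<close> and fourth moments of order \<open>a * \<eta> ^ 2\<close> thus
  give third absolute moments of order \<open>a * \<eta>\<close>; the limit theorem below takes
  \<open>\<eta> = 1 / Suc n\<close>.\<close>

lemma power_interpolation:
  fixes x \<eta> :: real assumes "\<eta> > 0"
  shows "\<bar>x\<bar> ^ 3 \<le> \<eta> * x\<^sup>2 + x ^ 4 / \<eta>"
proof (cases "\<bar>x\<bar> \<le> \<eta>")
  case True
  then have "\<bar>x\<bar> * x\<^sup>2 \<le> \<eta> * x\<^sup>2" by (intro mult_right_mono) auto
  moreover have "0 \<le> x ^ 4 / \<eta>" using assms by simp
  ultimately show ?thesis by (simp add: power3_eq_cube power2_eq_square mult.assoc)
next
  case False
  then have "\<bar>x\<bar> ^ 3 * \<eta> \<le> \<bar>x\<bar> ^ 3 * \<bar>x\<bar>" by (intro mult_left_mono) auto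
  also have "\<dots> = x ^ 4" by (simp add: eval_nat_numeral)
  finally have "\<bar>x\<bar> ^ 3 \<le> x ^ 4 / \<eta>" using assms by (simp add: field_simps)
  moreover have "0 \<le> \<eta> * x\<^sup>2" using assms by simp
  ultimately show ?thesis by linarith
qed

text \<open>A Lyapunov-type central limit theorem for an infinitely divisible law: since
  \<open>(exp (a \<kappa>) - 1) / a \<longrightarrow> \<kappa>\<close>, fourth moments of order \<open>o(a)\<close> leave only the quadratic term in \<open>\<kappa>\<close>.\<close>

lemma quadratic_exponent_if_small_fourth_moments:
  fixes \<mu> :: "nat \<Rightarrow> real measure" and a :: "nat \<Rightarrow> real"
  assumes \<mu>: "\<And>n. real_distribution (\<mu> n)"
    and a: "\<And>n. a n > 0" "a \<longlonglongrightarrow> 0"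
    and char: "\<And>n t. char (\<mu> n) t = exp (of_real (a n) * \<kappa> t)"
    and int: "\<And>n k. k \<le> 4 \<Longrightarrow> integrable (\<mu> n) (\<lambda>x. x ^ k)"
    and mean: "\<And>n. (LINT x|\<mu> n. x) = 0"
    and snd: "\<And>n. (LINT x|\<mu> n. x ^ 2) \<le> C * a n"
    and fourth: "\<And>n. (LINT x|\<mu> n. x ^ 4) \<le> a n / (real (Suc n))\<^sup>2"
  obtains s where "s \<ge> 0" "\<And>t. \<kappa> t = - of_real (s * t\<^sup>2 / 2)"
proof -
  define v where "v = (\<lambda>n. (LINT x|\<mu> n. x ^ 2) / a n)"
  have third: "(LINT x|\<mu> n. \<bar>x\<bar> ^ 3) \<le> (C + 1) * a n / real (Suc n)" for n
  proof -
    have "(LINT x|\<mu> n. \<bar>x\<bar> ^ 3) \<le> (LINT x|\<mu> n. 1 / real (Suc n) * x\<^sup>2 + x ^ 4 / (1 / real (Suc n)))"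
      using int[of 2 n] int[of 4 n] integrable_abs[OF int[of 3 n]]
      by (intro integral_mono power_interpolation Bochner_Integration.integrable_add
          integrable_mult_right) (auto simp: power_abs)
    also have "\<dots> = (LINT x|\<mu> n. x ^ 2) / real (Suc n) + (LINT x|\<mu> n. x ^ 4) * real (Suc n)"
      using int[of 2 n] int[of 4 n] by simp
    also have "\<dots> \<le> C * a n / real (Suc n) + a n / (real (Suc n))\<^sup>2 * real (Suc n)"
      using snd[of n] fourth[of n] by (intro add_mono divide_right_mono mult_right_mono) auto
    also have "\<dots> = (C + 1) * a n / real (Suc n)"
    proof -
      have "b / c\<^sup>2 * c = b / c" for b c :: real by (simp add: power2_eq_square)
      then show ?thesis by (simp add: distrib_right add_divide_distrib)
    qed
    finally show ?thesis .
  qed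
  \<comment> \<open>The cubic term of the expansion is counted as error: the weight
    \<open>1/3\<close> of the remainder and the weight \<open>1/6\<close> of this term add up to
    less than 1. The error still tends to 0 after division by \<open>a n\<close>.\<close>
  have approx: "norm ((char (\<mu> n) t - 1) / a n + of_real (v n * t\<^sup>2 / 2)) \<le> \<bar>t\<bar> ^ 3 * (C + 1) * (1 / real (Suc n))"
    for n t
  proof -
    interpret real_distribution "\<mu> n" by (rule \<mu>)
    define m2 m3 where "m2 = (LINT x|\<mu> n. x ^ 2)" and "m3 = (LINT x|\<mu> n. x ^ 3)"
    define T where "T = (LINT x|\<mu> n. \<bar>x\<bar> ^ 3)"
    have T0: "T \<ge> 0" by (simp add: T_def)
    have m3: "\<bar>m3\<bar> \<le> T"
      unfolding m3_def T_def using integral_abs_bound[of "\<mu> n" "\<lambda>x. x ^ 3"] by (simp add: power_abs)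
    have "cmod (char (\<mu> n) t - (\<Sum>k\<le>3. ((\<i> * t)^k / fact k) * expectation (\<lambda>x. x^k))) \<le>
      (2*\<bar>t\<bar>^3 / fact 3) * T"
      unfolding T_def by (rule char_approx1) (rule int, simp)
    moreover have "(\<Sum>k\<le>3. ((\<i> * t)^k / fact k) * expectation (\<lambda>x. x^k)) =
        1 - t\<^sup>2 * m2 / 2 - \<i> * of_real (t ^ 3 * m3 / 6)"
      using prob_space mean[of n] by (simp add: eval_nat_numeral m2_def m3_def algebra_simps fact_numeral)
    moreover have "norm (\<i> * of_real (t ^ 3 * m3 / 6)) \<le> \<bar>t\<bar> ^ 3 * T / 6"
      unfolding norm_mult norm_of_real using m3 T0
      by (simp add: abs_mult power_abs mult_left_mono)
    ultimately have "norm ((char (\<mu> n) t - (1 - t\<^sup>2 * m2 / 2 - \<i> * of_real (t ^ 3 * m3 / 6)))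
         - \<i> * of_real (t ^ 3 * m3 / 6)) \<le> (2*\<bar>t\<bar>^3 / fact 3) * T + \<bar>t\<bar> ^ 3 * T / 6"
      by (intro order_trans[OF norm_triangle_ineq4 add_mono]) (simp_all only:)
    also have "\<dots> \<le> \<bar>t\<bar> ^ 3 * T" using T0 by (simp add: fact_numeral)
    also have "\<dots> \<le> \<bar>t\<bar> ^ 3 * ((C + 1) * a n / real (Suc n))"
      using third[of n] by (intro mult_left_mono) (auto simp: T_def)
    finally have "norm (char (\<mu> n) t - 1 + t\<^sup>2 * m2 / 2) \<le> \<bar>t\<bar> ^ 3 * ((C + 1) * a n / real (Suc n))"
      by (simp add: algebra_simps)
    then have "norm (char (\<mu> n) t - 1 + t\<^sup>2 * m2 / 2) / a n \<le> \<bar>t\<bar> ^ 3 * ((C + 1) * a n / real (Suc n)) / a n"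
      using a(1)[of n] by (intro divide_right_mono) auto
    moreover have "(char (\<mu> n) t - 1) / a n + of_real (v n * t\<^sup>2 / 2) = (char (\<mu> n) t - 1 + t\<^sup>2 * m2 / 2) / a n"
      using a(1)[of n] by (simp add: v_def m2_def field_simps)
    ultimately show ?thesis
      using a(1)[of n] by (simp add: norm_divide)
  qed
  have lim1: "(\<lambda>n. (char (\<mu> n) t - 1) / a n + of_real (v n * t\<^sup>2 / 2)) \<longlonglongrightarrow> 0" for t
  proof (rule Lim_null_comparison[OF always_eventually[OF allI[OF approx]]])
    have "(\<lambda>n. \<bar>t\<bar> ^ 3 * (C + 1) * (1 / real (Suc n))) \<longlonglongrightarrow> \<bar>t\<bar> ^ 3 * (C + 1) * 0"
      by (intro tendsto_mult tendsto_const LIMSEQ_Suc[OF lim_1_over_n])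
    then show "(\<lambda>n. \<bar>t\<bar> ^ 3 * (C + 1) * (1 / real (Suc n))) \<longlonglongrightarrow> 0" by simp
  qed
  have lim2: "(\<lambda>n. (char (\<mu> n) t - 1) / a n) \<longlonglongrightarrow> \<kappa> t" for t
  proof -
    have "((\<lambda>z. exp (z * \<kappa> t)) has_field_derivative \<kappa> t) (at 0)"
      by (auto intro!: derivative_eq_intros)
    then have "((\<lambda>z. (exp (z * \<kappa> t) - 1) / z) \<longlongrightarrow> \<kappa> t) (at 0)"
      by (simp add: has_field_derivative_iff)
    moreover have "filterlim (\<lambda>n. complex_of_real (a n)) (at 0) sequentially"
      using a tendsto_of_real_iff[of a 0 sequentially, where 'a = complex]
      by (auto simp: filterlim_at intro!: always_eventually less_imp_neq[THEN not_sym])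
    ultimately show ?thesis
      unfolding char by (rule filterlim_compose)
  qed
  have lim: "(\<lambda>n. complex_of_real (v n * t\<^sup>2 / 2)) \<longlonglongrightarrow> - \<kappa> t" for t
    using tendsto_diff[OF lim1[of t] lim2[of t]] by simp
  \<comment> \<open>Convergence of the normalised variances \<open>v\<close> is not known
    beforehand. It is read off from the limit at \<open>t = 1\<close>, and then determines
    \<open>\<kappa>\<close> everywhere.\<close>
  have "(\<lambda>n. 2 * Re (complex_of_real (v n * 1\<^sup>2 / 2))) \<longlonglongrightarrow> 2 * Re (- \<kappa> 1)"
    by (intro tendsto_intros lim)
  then have v: "v \<longlonglongrightarrow> 2 * Re (- \<kappa> 1)" by simp
  have "v n \<ge> 0" for n using a(1)[of n] by (simp add: v_def)
  then have "2 * Re (- \<kappa> 1) \<ge> 0"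
    by (intro LIMSEQ_le_const[OF v]) auto
  moreover have "\<kappa> t = - of_real (2 * Re (- \<kappa> 1) * t\<^sup>2 / 2)" for t
  proof -
    have "(\<lambda>n. complex_of_real (v n * t\<^sup>2 / 2)) \<longlonglongrightarrow> of_real (2 * Re (- \<kappa> 1) * t\<^sup>2 / 2)"
      by (intro tendsto_intros v) auto
    from LIMSEQ_unique[OF this lim[of t]] show ?thesis by (metis minus_minus)
  qed
  ultimately show ?thesis by (rule that)
qed

locale analytic_levy_exponent =
  fixes \<kappa> :: "real \<Rightarrow> complex" and F :: "complex \<Rightarrow> complex" and r :: real
  assumes F: "F holomorphic_on ball 0 r" and r: "r > 0"
    and \<kappa>_eq: "\<And>x. \<bar>x\<bar> < r \<Longrightarrow> \<kappa> x = F (of_real x)"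
    and \<kappa>_0: "\<kappa> 0 = 0"
begin

text \<open>With \<open>a\<close> as time parameter these are the laws of one convolution semigroup:
  \<open>law 1\<close> will hold for the seed \<open>L 1\<close>, and
  \<open>law (measure lborel B)\<close> for \<open>\<Lambda> B\<close>.\<close>

definition law :: "real \<Rightarrow> real measure \<Rightarrow> bool" where
  "law a M \<longleftrightarrow> real_distribution M \<and> (\<forall>t. char M t = exp (of_real a * \<kappa> t))"

lemma moment_bound:
  assumes n: "even n" "n > 0" and K: "K \<ge> 0"
  obtains C where "C \<ge> 0"
    "\<And>a M. 0 \<le> a \<Longrightarrow> a \<le> K \<Longrightarrow> law a M \<Longrightarrow> integrable M (\<lambda>x. x ^ n)"
    "\<And>a M. 0 \<le> a \<Longrightarrow> a \<le> K \<Longrightarrow> law a M \<Longrightarrow> (LINT x|M. x ^ n) \<le> C * a"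
  using levy_even_moment_bound[OF F r n K] \<kappa>_eq by (fastforce simp: law_def)

lemma integrable_power:
  assumes "law a M" "0 \<le> a"
  shows "integrable M (\<lambda>x. x ^ n)"
proof -
  interpret real_distribution M using assms by (simp add: law_def)
  obtain C where "integrable M (\<lambda>x. x ^ (2 * n + 2))"
    by (rule moment_bound[of "2 * n + 2" a]) (use assms in auto)
  then have *: "integrable M (\<lambda>x. 1 + x ^ (2 * n + 2))" by simp
  have le: "\<bar>x\<bar> ^ n \<le> 1 + x ^ (2 * n + 2)" for x :: real
  proof (cases "\<bar>x\<bar> \<le> 1")
    case True
    then have "\<bar>x\<bar> ^ n \<le> 1" by (simp add: power_le_one)
    moreover have "0 \<le> x ^ (2 * n + 2)" by (rule zero_le_even_power) simp
    ultimately show ?thesis by simp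
  next
    case False
    then have "\<bar>x\<bar> ^ n \<le> \<bar>x\<bar> ^ (2 * n + 2)" by (intro power_increasing) auto
    also have "\<dots> = x ^ (2 * n + 2)" by (rule power_even_abs) simp
    finally show ?thesis by simp
  qed
  show ?thesis
    by (rule Bochner_Integration.integrable_bound[OF *])
       (use le in \<open>auto simp: power_abs intro!: AE_I2 order_trans[OF le]\<close>)
qed

lemma mean:
  assumes "law a M" "0 \<le> a"
  shows "\<i> * of_real (LINT x|M. x) = of_real a * deriv F 0"
  using assms F r \<kappa>_0 \<kappa>_eq[of 0] \<kappa>_eq
  by (intro levy_mean[of M F r]) (auto simp: law_def intro: integrable_power)

lemma fourth_moment_lower_bound:
  assumes \<mu>: "law 1 \<mu>" "\<not> gaussian_law \<mu>" and F': "deriv F 0 = 0"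
  obtains c d where "c > 0" "d > 0" "\<And>a M. 0 < a \<Longrightarrow> a < d \<Longrightarrow> law a M \<Longrightarrow> c * a \<le> (LINT x|M. x ^ 4)"
proof -
  have "\<exists>c>0. \<exists>d>0. \<forall>a M. 0 < a \<longrightarrow> a < d \<longrightarrow> law a M \<longrightarrow> c * a \<le> (LINT x|M. x ^ 4)"
  proof (rule ccontr)
    assume neg: "\<not> ?thesis"
    \<comment> \<open>This is the failure of the bound for \<open>c = 1 / (Suc n)\<^sup>2\<close>
      and \<open>d = 1 / Suc n\<close>. The square leaves room for the factor \<open>Suc n\<close>
      that is lost in interpolating third moments.\<close>
    have "\<exists>a M. 0 < a \<and> a < 1 / real (Suc n) \<and> law a M \<and>
        (LINT x|M. x ^ 4) \<le> a / (real (Suc n))\<^sup>2" for n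
    proof -
      have "\<exists>a M. 0 < a \<and> a < 1 / real (Suc n) \<and> law a M \<and>
          \<not> 1 / (real (Suc n))\<^sup>2 * a \<le> (LINT x|M. x ^ 4)"
        using neg[unfolded not_ex not_all de_Morgan_conj not_imp, rule_format, of "1 / (real (Suc n))\<^sup>2"]
        by (auto dest!: spec[where x = "1 / real (Suc n)"])
      then show ?thesis by (fastforce simp: field_simps)
    qed
    then obtain a M where a: "\<And>n. 0 < a n" "\<And>n. a n < 1 / real (Suc n)" and M: "\<And>n. law (a n) (M n)"
      and le: "\<And>n. (LINT x|M n. x ^ 4) \<le> a n / (real (Suc n))\<^sup>2"
      by metis
    have a1: "a n \<le> 1" for n
    proof -
      have "1 / real (Suc n) \<le> 1" by simp
      then show ?thesis using a(2)[of n] by linarith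
    qed
    obtain C where C: "\<And>a M. 0 \<le> a \<Longrightarrow> a \<le> 1 \<Longrightarrow> law a M \<Longrightarrow> (LINT x|M. x ^ 2) \<le> C * a"
      by (rule moment_bound[of 2 1]) auto
    have alim: "a \<longlonglongrightarrow> 0"
      by (rule tendsto_sandwich[OF _ _ tendsto_const LIMSEQ_Suc[OF lim_1_over_n]])
         (use a in \<open>auto intro!: always_eventually less_imp_le\<close>)
    have mean0: "(LINT x|M n. x) = 0" for n
      using mean[OF M less_imp_le[OF a(1)], of n] F' by simp
    obtain s where s: "s \<ge> 0" "\<And>t. \<kappa> t = - of_real (s * t\<^sup>2 / 2)"
    proof (rule quadratic_exponent_if_small_fourth_moments[OF _ a(1) alim _ _ mean0 _ le])
      show "real_distribution (M n)" for n using M[of n] by (simp add: law_def)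
      show "char (M n) t = exp (of_real (a n) * \<kappa> t)" for n t using M[of n] by (simp add: law_def)
      show "integrable (M n) (\<lambda>x. x ^ k)" for n k using integrable_power[OF M less_imp_le[OF a(1)]] .
      show "(LINT x|M n. x ^ 2) \<le> C * a n" for n using C[OF less_imp_le[OF a(1)] a1 M] .
    qed blast
    have "gaussian_law \<mu>"
      using \<mu>(1) s by (intro gaussian_law_if_char[of _ s]) (auto simp: law_def)
    then show False using \<mu>(2) by simp
  qed
  then show ?thesis using that by blast
qed

text \<open>Interpolation from the fourth moment. Where \<open>x\<^sup>2\<close> lies outside the
  range from \<open>e\<close> to \<open>1 / e\<close>, \<open>x ^ 4\<close> is at most
  \<open>e * (x\<^sup>2 + x ^ 6)\<close>, whose mean is \<open>O(a)\<close> and is absorbed for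
  small \<open>e\<close>. Inside that range, \<open>x ^ 4\<close> and
  \<open>\<bar>x\<bar> powr q\<close> are comparable, for any \<open>q > 0\<close>.\<close>

lemma absolute_moment_lower_bound:
  assumes \<mu>: "law 1 \<mu>" "\<not> gaussian_law \<mu>" and F': "deriv F 0 = 0" and q: "q > 0"
  obtains c d where "c > 0" "d > 0"
    "\<And>a M. 0 < a \<Longrightarrow> a < d \<Longrightarrow> law a M \<Longrightarrow> integrable M (\<lambda>x. \<bar>x\<bar> powr q) \<Longrightarrow>
      c * a \<le> (LINT x|M. \<bar>x\<bar> powr q)"
proof -
  obtain c d where c: "c > 0" "d > 0" "\<And>a M. 0 < a \<Longrightarrow> a < d \<Longrightarrow> law a M \<Longrightarrow> c * a \<le> (LINT x|M. x ^ 4)"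
    by (rule fourth_moment_lower_bound[OF \<mu> F']) blast
  obtain C where C: "C \<ge> 0" "\<And>a M. 0 \<le> a \<Longrightarrow> a \<le> d \<Longrightarrow> law a M \<Longrightarrow> (LINT x|M. x ^ 2) \<le> C * a"
    by (rule moment_bound[of 2 d]) (use c in auto)
  obtain C' where C': "C' \<ge> 0" "\<And>a M. 0 \<le> a \<Longrightarrow> a \<le> d \<Longrightarrow> law a M \<Longrightarrow> (LINT x|M. x ^ 6) \<le> C' * a"
    by (rule moment_bound[of 6 d]) (use c in auto)
  \<comment> \<open>Chosen so that the second and sixth moments together cost at most half of
    \<open>c * a\<close>; the summand 1 keeps the denominator positive.\<close>
  define e where "e = c / (2 * (C + C' + 1))"
  have e: "e > 0" "e * (C + C') \<le> c / 2" using c C C' by (auto simp: e_def field_simps)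
  define B where "B = 1 / e\<^sup>2 * (1 / e powr (q / 2))"
  have B: "B > 0" using e by (simp add: B_def)
  have pw: "x ^ 4 \<le> e * (x\<^sup>2 + x ^ 6) + B * \<bar>x\<bar> powr q" for x :: real
  proof -
    have nn: "0 \<le> e * x\<^sup>2" "0 \<le> e * x ^ 6" "0 \<le> B * \<bar>x\<bar> powr q" using e B by auto
    have x46: "x ^ 4 = x\<^sup>2 * x\<^sup>2" "x ^ 6 = x\<^sup>2 * x ^ 4" by (simp_all add: eval_nat_numeral)
    consider "x\<^sup>2 \<le> e" | "x\<^sup>2 \<ge> 1 / e" | "e < x\<^sup>2" "x\<^sup>2 < 1 / e" by linarith
    then show ?thesis
    proof cases
      case 1
      then have "x ^ 4 \<le> e * x\<^sup>2" unfolding x46 by (intro mult_right_mono) auto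
      then show ?thesis using nn by (simp add: ring_distribs)
    next
      case 2
      then have "1 \<le> e * x\<^sup>2" using e by (simp add: field_simps)
      then have "1 * x ^ 4 \<le> e * x\<^sup>2 * x ^ 4" by (intro mult_right_mono) auto
      then have "x ^ 4 \<le> e * x ^ 6" unfolding x46(2) by (simp only: mult.assoc mult_1)
      then show ?thesis using nn by (simp add: ring_distribs)
    next
      case 3
      have "x ^ 4 \<le> (1 / e) * (1 / e)" unfolding x46 using 3 e by (intro mult_mono) auto
      moreover have "e powr (q / 2) \<le> \<bar>x\<bar> powr q"
      proof -
        have "\<bar>x\<bar> powr q = (x\<^sup>2) powr (q / 2)"
          using powr_powr[of "\<bar>x\<bar>" 2 "q / 2"] by (simp add: powr_numeral)
        then show ?thesis using 3 e q by (simp add: powr_mono2)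
      qed
      then have "1 \<le> 1 / e powr (q / 2) * \<bar>x\<bar> powr q" using e by (simp add: field_simps)
      then have "1 / e\<^sup>2 * 1 \<le> 1 / e\<^sup>2 * (1 / e powr (q / 2) * \<bar>x\<bar> powr q)"
        using e by (intro mult_left_mono) auto
      ultimately have "x ^ 4 \<le> B * \<bar>x\<bar> powr q"
        by (simp add: B_def power2_eq_square mult.assoc)
      then show ?thesis using nn by (simp add: ring_distribs)
    qed
  qed
  show ?thesis
  proof (rule that[of "c / (2 * B)" d])
    fix a M assume a: "0 < a" "a < d" and M: "law a M" and int: "integrable M (\<lambda>x. \<bar>x\<bar> powr q)"
    note ip = integrable_power[OF M less_imp_le[OF a(1)]]
    have "c * a \<le> (LINT x|M. x ^ 4)" by (rule c(3)[OF a M])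
    also have "\<dots> \<le> (LINT x|M. e * (x\<^sup>2 + x ^ 6) + B * \<bar>x\<bar> powr q)"
      using ip int by (intro integral_mono pw) auto
    also have "\<dots> = e * ((LINT x|M. x ^ 2) + (LINT x|M. x ^ 6)) + B * (LINT x|M. \<bar>x\<bar> powr q)"
      using ip int by simp
    also have "e * ((LINT x|M. x ^ 2) + (LINT x|M. x ^ 6)) \<le> e * (C * a + C' * a)"
      using C(2)[of a M] C'(2)[of a M] a M e by (intro mult_left_mono add_mono) auto
    also have "e * (C * a + C' * a) = (e * (C + C')) * a" by (simp add: algebra_simps)
    also have "\<dots> \<le> c / 2 * a" using e a by (intro mult_right_mono) auto
    finally have "c / 2 * a \<le> B * (LINT x|M. \<bar>x\<bar> powr q)" by (simp add: algebra_simps)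
    then show "c / (2 * B) * a \<le> (LINT x|M. \<bar>x\<bar> powr q)" using B by (simp add: field_simps)
  qed (use c B in auto)
qed

end

subsection \<open>Moment inequalities\<close>

text \<open>The supporting line at \<open>v\<close> of a convex function. The sign of
  \<open>v\<close> is removed by the reflection \<open>y = sgn v * x\<close>; on the far side
  \<open>y \<le> 0\<close> the line is already at most \<open>(1 - q) * w powr q\<close>, hence
  nonpositive.\<close>

lemma abs_powr_tangent:
  fixes x v q :: real
  assumes q: "q \<ge> 1"
  shows "\<bar>v\<bar> powr q + q * sgn v * \<bar>v\<bar> powr (q - 1) * (x - v) \<le> \<bar>x\<bar> powr q"
proof (cases "v = 0")
  case True
  then show ?thesis by simp
next
  case False
  define w y where "w = \<bar>v\<bar>" and "y = sgn v * x"
  have w: "w > 0" using False by (simp add: w_def)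
  have sgn: "sgn v * (x - v) = y - w"
    by (simp add: y_def w_def right_diff_distrib abs_sgn mult.commute)
  have y: "\<bar>y\<bar> = \<bar>x\<bar>" using False by (simp add: y_def abs_mult)
  have ww: "w powr q = w powr (q - 1) * w"
    using w powr_add[of w "q - 1" 1] by simp
  have "w powr q + q * w powr (q - 1) * (y - w) \<le> \<bar>y\<bar> powr q"
  proof (cases "y > 0")
    case True
    have "(q * w powr (q - 1)) * (y - w) \<le> y powr q - w powr q"
    proof (rule convex_on_imp_above_tangent)
      show "convex_on {0<..} (\<lambda>x. x powr q)" using q by (rule powr_convex)
      show "((\<lambda>x. x powr q) has_real_derivative q * w powr (q - 1)) (at w within {0<..})"
        using w by (auto intro!: derivative_eq_intros)
    qed (use w True in \<open>auto simp: interior_open\<close>)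
    then show ?thesis using True by simp
  next
    case False
    have "w powr q + q * w powr (q - 1) * (y - w) \<le> w powr q + q * w powr (q - 1) * (0 - w)"
      using False q by (intro add_left_mono mult_left_mono) auto
    also have "\<dots> = w powr q * (1 - q)" by (simp add: ww algebra_simps)
    also have "\<dots> \<le> 0" using q by (intro mult_nonneg_nonpos) auto
    finally show ?thesis by (rule order_trans) simp
  qed
  then show ?thesis
    unfolding y w_def[symmetric] by (simp add: sgn[symmetric] mult_ac)
qed

text \<open>Split at \<open>\<bar>x\<bar> = T\<close>: below \<open>T\<close> the power is compared
  with the lower even power, above it with the higher one.\<close>

lemma abs_powr_interpolation:
  fixes x q T :: real and k :: nat
  assumes T: "T > 0" and q: "real (2 * k) \<le> q" "q \<le> real (2 * k + 2)"
  shows "\<bar>x\<bar> powr q \<le> T powr (q - real (2 * k)) * x ^ (2 * k) + T powr (q - real (2 * k + 2)) * x ^ (2 * k + 2)"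
proof (cases "x = 0")
  case True
  then show ?thesis using T by (simp add: zero_le_mult_iff)
next
  case False
  have pw: "\<bar>x\<bar> powr q = \<bar>x\<bar> powr (q - real n) * x ^ n" if "even n" for n
  proof -
    have "\<bar>x\<bar> powr q = \<bar>x\<bar> powr (q - real n) * \<bar>x\<bar> powr real n"
      using False by (simp flip: powr_add)
    then show ?thesis using False that by (simp add: powr_realpow power_even_abs)
  qed
  have nn: "0 \<le> x ^ (2 * k)" "0 \<le> x ^ (2 * k + 2)" by (rule zero_le_even_power, simp)+
  show ?thesis
  proof (cases "\<bar>x\<bar> \<le> T")
    case True
    have "\<bar>x\<bar> powr (q - real (2 * k)) * x ^ (2 * k) \<le> T powr (q - real (2 * k)) * x ^ (2 * k)"
      using True q nn by (intro mult_right_mono powr_mono2) auto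
    then show ?thesis
      unfolding pw[of "2 * k", simplified] using nn(2) by (intro order_trans[OF _ add_increasing2]) auto
  next
    case F: False
    have "\<bar>x\<bar> powr (q - real (2 * k + 2)) * x ^ (2 * k + 2) \<le> T powr (q - real (2 * k + 2)) * x ^ (2 * k + 2)"
      using F T q nn by (intro mult_right_mono powr_mono2') auto
    then show ?thesis
      using nn(1) pw[of "2 * k + 2"] by (intro order_trans[OF _ add_increasing]) auto
  qed
qed

text \<open>Jensen's inequality for the uniform law on \<open>{0..d}\<close>: the tangent at the
  mean \<open>m\<close> is integrated, and its linear term vanishes.\<close>

lemma set_integral_power_mean:
  fixes f :: "real \<Rightarrow> real"
  assumes d: "d > 0" and q: "q \<ge> 1"
    and f: "set_integrable lborel {0..d} f" "set_integrable lborel {0..d} (\<lambda>u. \<bar>f u\<bar> powr q)"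
  shows "\<bar>LBINT u:{0..d}. f u\<bar> powr q \<le> d powr (q - 1) * (LBINT u:{0..d}. \<bar>f u\<bar> powr q)"
proof -
  define I where "I = (LBINT u:{0..d}. f u)"
  define m where "m = I / d"
  have c: "set_integrable lborel {0..d} (\<lambda>u. c)" for c :: real
    by (intro borel_integrable_atLeastAtMost' continuous_on_const)
  have ci: "(LBINT u:{0..d}. c) = d * c" for c :: real
    using d by (simp add: set_lebesgue_integral_def)
  have "d * \<bar>m\<bar> powr q = (LBINT u:{0..d}. \<bar>m\<bar> powr q + q * sgn m * \<bar>m\<bar> powr (q - 1) * (f u - m))"
    using f c d by (simp add: set_integral_add set_integral_diff ci I_def[symmetric] m_def)
  also have "\<dots> \<le> (LBINT u:{0..d}. \<bar>f u\<bar> powr q)"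
    using f c by (intro set_integral_mono abs_powr_tangent q set_integral_add set_integrable_mult_right set_integral_diff)
  finally have "d powr (q - 1) * (d * \<bar>m\<bar> powr q) \<le> d powr (q - 1) * (LBINT u:{0..d}. \<bar>f u\<bar> powr q)"
    by (intro mult_left_mono) auto
  moreover have "d powr (q - 1) * (d * \<bar>m\<bar> powr q) = \<bar>I\<bar> powr q"
  proof -
    have "d powr (q - 1) * d = d powr q" using d powr_add[of d "q - 1" 1] by simp
    then have "d powr (q - 1) * (d * \<bar>m\<bar> powr q) = (d * \<bar>m\<bar>) powr q"
      using d by (simp add: powr_mult flip: mult.assoc)
    then show ?thesis using d by (simp add: m_def)
  qed
  ultimately show ?thesis by (simp add: I_def)
qed

lemma abs_power_le_sum:
  fixes z :: real assumes "j \<le> k" "k \<le> n"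
  shows "\<bar>z\<bar> ^ k \<le> \<bar>z\<bar> ^ j + \<bar>z\<bar> ^ n"
proof (cases "\<bar>z\<bar> \<le> 1")
  case True
  then have "\<bar>z\<bar> ^ k \<le> \<bar>z\<bar> ^ j" using assms by (intro power_decreasing) auto
  then show ?thesis by (simp add: add_increasing2)
next
  case False
  then have "\<bar>z\<bar> ^ k \<le> \<bar>z\<bar> ^ n" using assms by (intro power_increasing) auto
  then show ?thesis by (simp add: add_increasing)
qed

section \<open>Rosenthal's inequality for even exponents\<close>

context prob_space
begin

text \<open>A truncated exponential generating function of the moments, evaluated at
  \<open>1 / K\<close>. The absolute value stands outside the expectation, so that the term of order
  one vanishes for a centred variable.\<close>

definition moment_gf :: "nat \<Rightarrow> real \<Rightarrow> ('a \<Rightarrow> real) \<Rightarrow> real" where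
  "moment_gf n K Z = (\<Sum>k\<le>n. \<bar>expectation (\<lambda>x. Z x ^ k)\<bar> / (fact k * K ^ k))"

text \<open>By the binomial theorem and independence, the factorials turn the moments of the sum
  into a Cauchy product. Truncation keeps the triangle \<open>i + j \<le> n\<close>; completing it
  to the square only adds nonnegative terms and gives the product.\<close>

lemma moment_gf_add:
  assumes indep: "indep_var borel Y borel Z" and K: "K > 0"
    and Y: "\<And>k. k \<le> n \<Longrightarrow> integrable M (\<lambda>x. Y x ^ k)"
    and Z: "\<And>k. k \<le> n \<Longrightarrow> integrable M (\<lambda>x. Z x ^ k)"
  shows "\<And>k. k \<le> n \<Longrightarrow> integrable M (\<lambda>x. (Y x + Z x) ^ k)"
    "moment_gf n K (\<lambda>x. Y x + Z x) \<le> moment_gf n K Y * moment_gf n K Z"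
proof -
  let ?E = expectation
  have prod: "integrable M (\<lambda>x. Y x ^ i * Z x ^ j)"
    "?E (\<lambda>x. Y x ^ i * Z x ^ j) = ?E (\<lambda>x. Y x ^ i) * ?E (\<lambda>x. Z x ^ j)" if "i \<le> n" "j \<le> n" for i j
  proof -
    have "indep_var borel (\<lambda>x. Y x ^ i) borel (\<lambda>x. Z x ^ j)"
      using indep_var_compose[OF indep, of "\<lambda>y. y ^ i" borel "\<lambda>y. y ^ j" borel] by (simp add: o_def)
    then show "integrable M (\<lambda>x. Y x ^ i * Z x ^ j)"
      "?E (\<lambda>x. Y x ^ i * Z x ^ j) = ?E (\<lambda>x. Y x ^ i) * ?E (\<lambda>x. Z x ^ j)"
      using Y[OF that(1)] Z[OF that(2)] by (auto intro: indep_var_integrable indep_var_lebesgue_integral)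
  qed
  have int: "integrable M (\<lambda>x. \<Sum>i\<le>k. real (k choose i) * Y x ^ i * Z x ^ (k - i))" if "k \<le> n" for k
    using that prod(1) by (intro Bochner_Integration.integrable_sum) (simp add: mult.assoc)
  then show "\<And>k. k \<le> n \<Longrightarrow> integrable M (\<lambda>x. (Y x + Z x) ^ k)"
    by (simp add: binomial_ring)
  define y where "y = (\<lambda>i. \<bar>?E (\<lambda>x. Y x ^ i)\<bar> / (fact i * K ^ i))"
  define z where "z = (\<lambda>i. \<bar>?E (\<lambda>x. Z x ^ i)\<bar> / (fact i * K ^ i))"
  have yz: "y i \<ge> 0" "z i \<ge> 0" for i using K by (simp_all add: y_def z_def)
  have "\<bar>?E (\<lambda>x. (Y x + Z x) ^ k)\<bar> / (fact k * K ^ k) \<le> (\<Sum>i\<le>k. y i * z (k - i))" if k: "k \<le> n" for k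
  proof -
    have "?E (\<lambda>x. (Y x + Z x) ^ k) = (\<Sum>i\<le>k. real (k choose i) * (?E (\<lambda>x. Y x ^ i) * ?E (\<lambda>x. Z x ^ (k - i))))"
      using k prod by (simp add: binomial_ring Bochner_Integration.integral_sum mult.assoc)
    then have "\<bar>?E (\<lambda>x. (Y x + Z x) ^ k)\<bar> \<le>
        (\<Sum>i\<le>k. real (k choose i) * (\<bar>?E (\<lambda>x. Y x ^ i)\<bar> * \<bar>?E (\<lambda>x. Z x ^ (k - i))\<bar>))"
      by (auto intro!: order_trans[OF sum_abs] sum_mono simp: abs_mult)
    then have "\<bar>?E (\<lambda>x. (Y x + Z x) ^ k)\<bar> / (fact k * K ^ k) \<le>
        (\<Sum>i\<le>k. real (k choose i) * (\<bar>?E (\<lambda>x. Y x ^ i)\<bar> * \<bar>?E (\<lambda>x. Z x ^ (k - i))\<bar>)) / (fact k * K ^ k)"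
      using K by (intro divide_right_mono) auto
    also have "\<dots> = (\<Sum>i\<le>k. y i * z (k - i))"
      unfolding sum_divide_distrib
    proof (rule sum.cong[OF refl])
      fix i assume "i \<in> {..k}"
      then have i: "i \<le> k" by simp
      have b: "real (k choose i) / fact k = 1 / (fact i * fact (k - i))"
        using binomial_fact[OF i, where 'a = real] by simp
      have K: "K ^ k = K ^ i * K ^ (k - i)" using i by (simp flip: power_add)
      have "real (k choose i) * e / (fact k * K ^ k) = real (k choose i) / fact k * (e / K ^ k)" for e
        by simp
      then show "real (k choose i) * (\<bar>?E (\<lambda>x. Y x ^ i)\<bar> * \<bar>?E (\<lambda>x. Z x ^ (k - i))\<bar>) / (fact k * K ^ k)
          = y i * z (k - i)"
        unfolding b K by (simp add: y_def z_def)
    qed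
    finally show ?thesis .
  qed
  then have "moment_gf n K (\<lambda>x. Y x + Z x) \<le> (\<Sum>k\<le>n. \<Sum>i\<le>k. y i * z (k - i))"
    unfolding moment_gf_def by (intro sum_mono) simp
  also have "\<dots> = (\<Sum>(i,j)\<in>{(i,j). i + j \<le> n}. y i * z j)"
    by (rule sum.triangle_reindex_eq[symmetric])
  also have "\<dots> \<le> (\<Sum>(i,j)\<in>{..n} \<times> {..n}. y i * z j)"
    using yz by (intro sum_mono2) auto
  also have "\<dots> = moment_gf n K Y * moment_gf n K Z"
    by (simp add: moment_gf_def y_def z_def sum_product sum.cartesian_product)
  finally show "moment_gf n K (\<lambda>x. Y x + Z x) \<le> moment_gf n K Y * moment_gf n K Z" .
qed

lemma integrable_power_le:
  assumes Y: "Y \<in> borel_measurable M" and int: "integrable M (\<lambda>x. (Y x :: real) ^ n)" and n: "even n" and k: "k \<le> n"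
  shows "integrable M (\<lambda>x. Y x ^ k)"
proof (rule Bochner_Integration.integrable_bound)
  show "integrable M (\<lambda>x. 1 + Y x ^ n)" using int by simp
  have "\<bar>Y x\<bar> ^ k \<le> 1 + Y x ^ n" for x
    using abs_power_le_sum[of 0 k n "Y x"] k n by (simp add: power_even_abs)
  then show "AE x in M. norm (Y x ^ k) \<le> norm (1 + Y x ^ n)"
    using n by (auto simp: power_abs intro!: AE_I2 order_trans[OF _ abs_ge_self])
qed (use Y in simp)

text \<open>The term of order 0 is 1, that of order 1 vanishes, and each of the others is at most
  the second plus the \<open>n\<close>-th normalised moment. The exponential form turns the product
  over independent summands into a sum of their moments.\<close>

lemma moment_gf_le:
  assumes Y: "Y \<in> borel_measurable M" and int: "integrable M (\<lambda>x. Y x ^ n)" and n: "even n" "n \<ge> 2"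
    and mean: "expectation Y = 0" and K: "K > 0"
  shows "moment_gf n K Y \<le> exp (real n * (expectation (\<lambda>x. Y x ^ 2) / K ^ 2 + expectation (\<lambda>x. Y x ^ n) / K ^ n))"
proof -
  define s where "s = expectation (\<lambda>x. Y x ^ 2) / K ^ 2 + expectation (\<lambda>x. Y x ^ n) / K ^ n"
  have ik: "integrable M (\<lambda>x. Y x ^ k)" if "k \<le> n" for k
    using integrable_power_le[OF Y int n(1) that] .
  have s0: "s \<ge> 0" using K n unfolding s_def
    by (intro add_nonneg_nonneg divide_nonneg_nonneg integral_nonneg zero_le_even_power) auto
  have le: "\<bar>expectation (\<lambda>x. Y x ^ k)\<bar> / (fact k * K ^ k) \<le> s" if k: "2 \<le> k" "k \<le> n" for k
  proof -
    have "\<bar>expectation (\<lambda>x. Y x ^ k)\<bar> / (fact k * K ^ k) \<le> \<bar>expectation (\<lambda>x. Y x ^ k)\<bar> / (1 * K ^ k)"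
      using K by (intro divide_left_mono mult_right_mono) (auto intro: fact_ge_1)
    also have "\<bar>expectation (\<lambda>x. Y x ^ k)\<bar> \<le> expectation (\<lambda>x. \<bar>Y x ^ k\<bar>)"
      by (rule integral_abs_bound)
    also have "expectation (\<lambda>x. \<bar>Y x ^ k\<bar>) / (1 * K ^ k) = expectation (\<lambda>x. \<bar>Y x / K\<bar> ^ k)"
      using K by (simp add: power_abs power_divide)
    also have "\<dots> \<le> expectation (\<lambda>x. \<bar>Y x / K\<bar> ^ 2 + \<bar>Y x / K\<bar> ^ n)"
      using K k ik by (intro integral_mono abs_power_le_sum)
        (auto simp: power_divide simp flip: power_abs simp del: power2_abs)
    also have "\<dots> = s"
      using K n ik[of 2] int by (simp add: s_def power_divide power_even_abs)
    finally show ?thesis using K by (simp add: divide_right_mono)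
  qed
  have split: "{..n} = {0, 1} \<union> {2..n}" using n by auto
  have "moment_gf n K Y = 1 + (\<Sum>k\<in>{2..n}. \<bar>expectation (\<lambda>x. Y x ^ k)\<bar> / (fact k * K ^ k))"
    unfolding moment_gf_def split using mean prob_space by (subst sum.union_disjoint) auto
  also have "\<dots> \<le> 1 + (\<Sum>k\<in>{2..n}. s)"
    using le by (intro add_left_mono sum_mono) auto
  also have "\<dots> \<le> 1 + real n * s"
    using s0 n by (simp add: mult_right_mono)
  also have "\<dots> \<le> exp (real n * s)" by (rule exp_ge_add_one_self)
  finally show ?thesis by (simp add: s_def)
qed

text \<open>With \<open>K\<close> as unit of length, the sum \<open>moment_gf\<close> of the normalised moments up to order \<open>n\<close> is
  submultiplicative over independent summands.\<close>

lemma rosenthal_even: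
  assumes I: "finite I" and indep: "indep_vars (\<lambda>_. borel) Y I"
    and n: "even n" "n \<ge> 2" and K: "K > 0"
    and int: "\<And>i. i \<in> I \<Longrightarrow> integrable M (\<lambda>x. Y i x ^ n)"
    and mean: "\<And>i. i \<in> I \<Longrightarrow> expectation (Y i) = 0"
    and snd: "(\<Sum>i\<in>I. expectation (\<lambda>x. Y i x ^ 2)) \<le> C * K ^ 2"
    and nth: "(\<Sum>i\<in>I. expectation (\<lambda>x. Y i x ^ n)) \<le> C * K ^ n"
  shows "integrable M (\<lambda>x. (\<Sum>i\<in>I. Y i x) ^ n)"
    "expectation (\<lambda>x. (\<Sum>i\<in>I. Y i x) ^ n) \<le> fact n * exp (2 * real n * C) * K ^ n"
proof -
  have rv: "Y i \<in> borel_measurable M" if "i \<in> I" for i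
    using indep that by (simp add: indep_vars_def2)
  have *: "(\<forall>k\<le>n. integrable M (\<lambda>x. (\<Sum>i\<in>J. Y i x) ^ k)) \<and>
     moment_gf n K (\<lambda>x. \<Sum>i\<in>J. Y i x) \<le> (\<Prod>i\<in>J. moment_gf n K (Y i))" if "J \<subseteq> I" for J
    using finite_subset[OF that I] that
  proof (induction J rule: finite_induct)
    case empty
    have "moment_gf n K (\<lambda>x. 0) = (\<Sum>k\<le>n. if k = 0 then 1 else 0)"
      unfolding moment_gf_def using prob_space by (intro sum.cong) (auto simp: power_0_left)
    then show ?case by (simp add: power_0_left)
  next
    case (insert j J)
    have ind: "indep_var borel (Y j) borel (\<lambda>x. \<Sum>i\<in>J. Y i x)"
      using insert by (intro indep_vars_sum indep_vars_subset[OF indep]) auto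
    have intj: "integrable M (\<lambda>x. Y j x ^ k)" if "k \<le> n" for k
      using insert.prems by (intro integrable_power_le[OF rv int n(1) that]) auto
    have IH: "\<And>k. k \<le> n \<Longrightarrow> integrable M (\<lambda>x. (\<Sum>i\<in>J. Y i x) ^ k)"
      "moment_gf n K (\<lambda>x. \<Sum>i\<in>J. Y i x) \<le> (\<Prod>i\<in>J. moment_gf n K (Y i))"
      using insert by auto
    note add = moment_gf_add[OF ind K intj IH(1)]
    have "moment_gf n K (\<lambda>x. Y j x + (\<Sum>i\<in>J. Y i x)) \<le> moment_gf n K (Y j) * (\<Prod>i\<in>J. moment_gf n K (Y i))"
      using K by (intro order_trans[OF add(2)] mult_left_mono IH)
        (auto simp: moment_gf_def intro!: sum_nonneg)
    then show ?case using add(1) insert.hyps by simp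
  qed
  show "integrable M (\<lambda>x. (\<Sum>i\<in>I. Y i x) ^ n)" using * by auto
  let ?S = "\<lambda>x. \<Sum>i\<in>I. Y i x"
  have "expectation (\<lambda>x. ?S x ^ n) / (fact n * K ^ n) \<le> \<bar>expectation (\<lambda>x. ?S x ^ n)\<bar> / (fact n * K ^ n)"
    using K by (intro divide_right_mono) auto
  also have "\<dots> \<le> moment_gf n K ?S"
    unfolding moment_gf_def using K
    by (intro member_le_sum[where f = "\<lambda>k. \<bar>expectation (\<lambda>x. ?S x ^ k)\<bar> / (fact k * K ^ k)"]) auto
  also have "\<dots> \<le> (\<Prod>i\<in>I. moment_gf n K (Y i))" using * by auto
  also have "\<dots> \<le> (\<Prod>i\<in>I. exp (real n * (expectation (\<lambda>x. Y i x ^ 2) / K ^ 2 + expectation (\<lambda>x. Y i x ^ n) / K ^ n)))"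
    using K rv int mean n by (intro prod_mono conjI moment_gf_le) (auto simp: moment_gf_def intro!: sum_nonneg)
  also have "\<dots> = exp (real n * ((\<Sum>i\<in>I. expectation (\<lambda>x. Y i x ^ 2)) / K ^ 2 + (\<Sum>i\<in>I. expectation (\<lambda>x. Y i x ^ n)) / K ^ n))"
    using I by (simp add: exp_sum[symmetric] sum_distrib_left[symmetric] sum.distrib sum_divide_distrib)
  also have "\<dots> \<le> exp (real n * (C + C))"
    unfolding exp_le_cancel_iff using snd nth K
    by (intro mult_left_mono add_mono) (auto simp: field_simps)
  finally show "expectation (\<lambda>x. (\<Sum>i\<in>I. Y i x) ^ n) \<le> fact n * exp (2 * real n * C) * K ^ n"
    using K by (simp add: divide_le_eq mult_ac)
qed

end

subsection \<open>Bounds for regularly varying functions\<close>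

text \<open>A substitute for Potter's bounds: the bound on one dyadic block is carried to all later
  ones by iterating the doubling inequality. In the applications the bound on the first block comes
  from monotonicity.\<close>

lemma doubling_bound:
  fixes f :: "real \<Rightarrow> real"
  assumes T: "T > 0" and B: "\<And>x. T \<le> x \<Longrightarrow> x \<le> 2 * T \<Longrightarrow> f x \<le> B" "B > 0"
    and dbl: "\<And>x. T \<le> x \<Longrightarrow> f (2 * x) \<le> 2 powr \<rho> * f x"
  obtains C where "C > 0" "\<And>x. T \<le> x \<Longrightarrow> f x \<le> C * x powr \<rho>"
proof -
  \<comment> \<open>A lower bound of \<open>x powr \<rho>\<close> on the first block. The minimum
    covers both signs of \<open>\<rho>\<close>, which is negative for an upper bound of a decaying
    \<open>g\<close> and positive when \<open>1 / g\<close> is bounded above.\<close>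
  define m where "m = min (T powr \<rho>) ((2 * T) powr \<rho>)"
  have m: "m > 0" using T by (simp add: m_def)
  have mx: "m \<le> x powr \<rho>" if "T \<le> x" "x \<le> 2 * T" for x
  proof (cases "\<rho> \<ge> 0")
    case True
    then have "T powr \<rho> \<le> x powr \<rho>" using that T by (intro powr_mono2) auto
    then show ?thesis by (simp add: m_def)
  next
    case False
    then have "(2 * T) powr \<rho> \<le> x powr \<rho>" using that T by (intro powr_mono2') auto
    then show ?thesis by (simp add: m_def)
  qed
  have *: "\<forall>x. T \<le> x \<and> x \<le> 2 ^ n * (2 * T) \<longrightarrow> f x \<le> B / m * x powr \<rho>" for n
  proof (induction n)
    case 0
    show ?case
    proof (intro allI impI)
      fix x assume x: "T \<le> x \<and> x \<le> 2 ^ 0 * (2 * T)"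
      have "f x \<le> B / m * m" using B x m by simp
      also have "\<dots> \<le> B / m * x powr \<rho>" using x B m by (intro mult_left_mono mx) auto
      finally show "f x \<le> B / m * x powr \<rho>" .
    qed
  next
    case (Suc n)
    show ?case
    proof (intro allI impI)
      fix x assume x: "T \<le> x \<and> x \<le> 2 ^ Suc n * (2 * T)"
      show "f x \<le> B / m * x powr \<rho>"
      proof (cases "x \<le> 2 ^ n * (2 * T)")
        case True
        then show ?thesis using Suc x by simp
      next
        case False
        have "1 * (2 * T) \<le> 2 ^ n * (2 * T)" using T by (intro mult_right_mono) auto
        then have x2: "T \<le> x / 2" "x / 2 \<le> 2 ^ n * (2 * T)" using False x by auto
        have "f x \<le> 2 powr \<rho> * f (x / 2)" using dbl[OF x2(1)] by simp
        also have "\<dots> \<le> 2 powr \<rho> * (B / m * (x / 2) powr \<rho>)"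
          using Suc x2 by (intro mult_left_mono) auto
        also have "\<dots> = B / m * (2 * (x / 2)) powr \<rho>"
          using x T by (subst powr_mult) auto
        finally show ?thesis by simp
      qed
    qed
  qed
  show ?thesis
  proof (rule that[of "B / m"])
    fix x assume x: "T \<le> x"
    obtain n where "x / (2 * T) < 2 ^ n" using real_arch_pow[of 2 "x / (2 * T)"] by auto
    then have "x \<le> 2 ^ n * (2 * T)" using T by (simp add: field_simps)
    then show "f x \<le> B / m * x powr \<rho>" using * x by blast
  qed (use B m in simp)
qed

lemma regularly_varying_doubling:
  assumes g: "regularly_varying \<rho> g" "\<And>x. x \<ge> 0 \<Longrightarrow> g x > 0"
  shows "((\<lambda>t. g (2 * t) / g t) \<longlongrightarrow> 2 powr \<rho>) at_top"
proof -
  obtain l where l: "slowly_varying l" "\<And>x. x > 0 \<Longrightarrow> g x = l x * x powr \<rho>"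
    using g by (auto simp: regularly_varying_def)
  have "((\<lambda>t. l (t * 2) / l t) \<longlongrightarrow> 1) at_top" using l by (auto simp: slowly_varying_def)
  then have "((\<lambda>t. l (t * 2) / l t * 2 powr \<rho>) \<longlongrightarrow> 1 * 2 powr \<rho>) at_top"
    by (intro tendsto_mult tendsto_const)
  then have "((\<lambda>t. l (t * 2) / l t * 2 powr \<rho>) \<longlongrightarrow> 2 powr \<rho>) at_top" by simp
  then show ?thesis
  proof (rule Lim_transform_eventually)
    show "\<forall>\<^sub>F t in at_top. l (t * 2) / l t * 2 powr \<rho> = g (2 * t) / g t"
      using eventually_gt_at_top[of 0]
      by eventually_elim (simp add: l(2) powr_mult mult.commute)
  qed
qed

text \<open>The ratio \<open>g (2 * t) / g t\<close> tends to \<open>2 powr \<rho>\<close>, which is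
  below \<open>2 powr \<sigma>\<close>. So the doubling inequality holds eventually, and the slowly
  varying factor is traded for a slightly larger exponent.\<close>

lemma regularly_varying_upper_bound:
  assumes g: "regularly_varying \<rho> g" "\<And>x. x \<ge> 0 \<Longrightarrow> g x > 0" "antimono_on {0..} g"
    and \<sigma>: "\<rho> < \<sigma>" "\<sigma> \<le> 0"
  obtains C where "C > 0" "\<And>x. 0 \<le> x \<Longrightarrow> g x \<le> C * (1 + x) powr \<sigma>"
proof -
  have "2 powr \<rho> < 2 powr \<sigma>" using \<sigma> by (intro powr_less_mono) auto
  from order_tendstoD(2)[OF regularly_varying_doubling[OF g(1,2)] this]
  obtain T0 where T0: "\<And>t. t \<ge> T0 \<Longrightarrow> g (2 * t) / g t < 2 powr \<sigma>"
    by (auto simp: eventually_at_top_linorder)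
  define T where "T = max T0 1"
  have T: "T \<ge> 1" "T \<ge> T0" by (auto simp: T_def)
  have mono: "g y \<le> g x" if "0 \<le> x" "x \<le> y" for x y
    using g(3) that by (auto simp: monotone_on_def)
  obtain C where C: "C > 0" "\<And>x. T \<le> x \<Longrightarrow> g x \<le> C * x powr \<sigma>"
  proof (rule doubling_bound[of T g "g 0" \<sigma>])
    fix x assume x: "T \<le> x"
    then have "g (2 * x) / g x < 2 powr \<sigma>" using T T0 by auto
    then show "g (2 * x) \<le> 2 powr \<sigma> * g x"
      using g(2)[of x] x T by (simp add: field_simps)
  next
    fix x assume "T \<le> x"
    then show "g x \<le> g 0" using T by (intro mono) auto
  qed (use T g(2)[of 0] in auto)
  \<comment> \<open>The first entry serves \<open>x \<ge> T \<ge> 1\<close>, where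
    \<open>1 + x \<le> 2 * x\<close>; the second serves \<open>x < T\<close>, where
    \<open>g x \<le> g 0\<close>. The shift by 1 keeps the bound valid at the origin.\<close>
  define C' where "C' = max (C * (1/2) powr \<sigma>) (g 0 / (1 + T) powr \<sigma>)"
  have "g x \<le> C' * (1 + x) powr \<sigma>" if x: "0 \<le> x" for x
  proof (cases "T \<le> x")
    case True
    have "g x \<le> C * x powr \<sigma>" using C True by simp
    also have "\<dots> \<le> C * ((1/2) * (1 + x)) powr \<sigma>"
      using C True T \<sigma> by (intro mult_left_mono powr_mono2') auto
    also have "\<dots> = (C * (1/2) powr \<sigma>) * (1 + x) powr \<sigma>"
      using x by (subst powr_mult) auto
    also have "\<dots> \<le> C' * (1 + x) powr \<sigma>" by (intro mult_right_mono) (auto simp: C'_def)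
    finally show ?thesis .
  next
    case False
    have "g x \<le> g 0" using x by (intro mono) auto
    also have "g 0 = (g 0 / (1 + T) powr \<sigma>) * (1 + T) powr \<sigma>" using T by simp
    also have "\<dots> \<le> C' * (1 + x) powr \<sigma>"
      using False x \<sigma> g(2)[of 0] T by (intro mult_mono powr_mono2') (auto simp: C'_def le_max_iff_disj)
    finally show ?thesis .
  qed
  moreover have "C' > 0" using C by (simp add: C'_def less_max_iff_disj)
  ultimately show ?thesis using that by blast
qed

text \<open>The doubling argument is applied to \<open>1 / g\<close>, whose ratio is eventually
  below \<open>2 powr (- \<sigma>)\<close>.\<close>

lemma regularly_varying_lower_bound:
  assumes g: "regularly_varying \<rho> g" "\<And>x. x \<ge> 0 \<Longrightarrow> g x > 0" "antimono_on {0..} g"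
    and \<sigma>: "\<sigma> < \<rho>"
  obtains c T where "c > 0" "\<And>x. T \<le> x \<Longrightarrow> c * x powr \<sigma> \<le> g x"
proof -
  have "2 powr \<sigma> < 2 powr \<rho>" using \<sigma> by (intro powr_less_mono) auto
  from order_tendstoD(1)[OF regularly_varying_doubling[OF g(1,2)] this]
  obtain T0 where T0: "\<And>t. t \<ge> T0 \<Longrightarrow> 2 powr \<sigma> < g (2 * t) / g t"
    by (auto simp: eventually_at_top_linorder)
  define T where "T = max T0 1"
  have T: "T \<ge> 1" "T \<ge> T0" by (auto simp: T_def)
  have mono: "g y \<le> g x" if "0 \<le> x" "x \<le> y" for x y
    using g(3) that by (auto simp: monotone_on_def)
  obtain C where C: "C > 0" "\<And>x. T \<le> x \<Longrightarrow> 1 / g x \<le> C * x powr (- \<sigma>)"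
  proof (rule doubling_bound[of T "\<lambda>x. 1 / g x" "1 / g (2 * T)" "- \<sigma>"])
    fix x assume x: "T \<le> x"
    have pos: "g x > 0" "g (2 * x) > 0" using g(2) x T by auto
    have "2 powr \<sigma> < g (2 * x) / g x" using x T T0 by auto
    then have "2 powr \<sigma> * g x \<le> g (2 * x)" using pos by (simp add: field_simps)
    then show "1 / g (2 * x) \<le> 2 powr (- \<sigma>) * (1 / g x)"
      using pos by (simp add: powr_minus field_simps)
  next
    fix x assume "T \<le> x" "x \<le> 2 * T"
    then show "1 / g x \<le> 1 / g (2 * T)"
      using T g(2)[of "2 * T"] g(2)[of x] by (intro divide_left_mono mono) auto
  qed (use T g(2)[of "2 * T"] in auto)
  have "1 / C * x powr \<sigma> \<le> g x" if x: "T \<le> x" for x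
    using C(2)[OF x] C(1) g(2)[of x] x T by (simp add: powr_minus field_simps)
  then show ?thesis using that[of "1 / C" T] C T by auto
qed

subsection \<open>Levy bases\<close>

lemma finite_borel_sets_eq: "finite_borel_sets = fmeasurable lborel"
  by (auto simp: finite_borel_sets_def fmeasurable_def)

lemma (in prob_space) indep_vars_reindex:
  assumes indep: "indep_vars (\<lambda>_. N) Y A" and h: "inj_on h I" "h ` I \<subseteq> A"
  shows "indep_vars (\<lambda>_. N) (\<lambda>i. Y (h i)) I"
proof -
  have "indep_vars (\<lambda>j. PiM {h j} (\<lambda>_. N)) (\<lambda>j \<omega>. restrict (\<lambda>i. Y i \<omega>) {h j}) I"
    using h by (intro indep_vars_restrict[OF indep]) (auto simp: disjoint_family_on_def inj_on_def)
  then have "indep_vars (\<lambda>_. N) (\<lambda>j \<omega>. (\<lambda>f. f (h j)) (restrict (\<lambda>i. Y i \<omega>) {h j})) I"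
    by (rule indep_vars_compose2) simp
  then show ?thesis by simp
qed

locale analytic_levy_basis = analytic_levy_exponent \<kappa> F r
  for \<kappa> :: "real \<Rightarrow> complex" and F :: "complex \<Rightarrow> complex" and r :: real +
  fixes M :: "'a measure" and \<Lambda> :: "(real \<times> real) set \<Rightarrow> 'a \<Rightarrow> real"
  assumes basis: "homogeneous_levy_basis M \<kappa> \<Lambda>"
begin

sublocale prob_space M
  using basis by (simp add: homogeneous_levy_basis_def)

lemma basis_measurable [measurable]: "B \<in> fmeasurable lborel \<Longrightarrow> \<Lambda> B \<in> borel_measurable M"
  using basis by (simp add: homogeneous_levy_basis_def finite_borel_sets_eq)

lemma law_basis:
  assumes B: "B \<in> fmeasurable lborel"
  shows "law (measure lborel B) (distr M borel (\<Lambda> B))"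
proof -
  have "has_cumulant_function (distr M borel (\<Lambda> B)) (\<lambda>\<zeta>. of_real (measure lborel B) * \<kappa> \<zeta>)"
    using basis B by (simp add: homogeneous_levy_basis_def finite_borel_sets_eq)
  then show ?thesis
    using B by (auto simp: law_def has_cumulant_function_def intro: real_distribution_distr)
qed

lemma basis_sequence:
  fixes B :: "nat \<Rightarrow> (real \<times> real) set"
  assumes "range B \<subseteq> fmeasurable lborel" "disjoint_family B"
  shows "indep_vars (\<lambda>_. borel) (\<lambda>n. \<Lambda> (B n)) UNIV"
    "(\<Union>n. B n) \<in> fmeasurable lborel \<Longrightarrow> AE \<omega> in M. (\<lambda>n. \<Lambda> (B n) \<omega>) sums \<Lambda> (\<Union>n. B n) \<omega>"
  using basis assms unfolding homogeneous_levy_basis_def finite_borel_sets_eq by blast+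

text \<open>Countable additivity along a sequence of empty sets: a constant series converges only if
  its term is 0.\<close>

lemma basis_empty: "AE \<omega> in M. \<Lambda> {} \<omega> = 0"
proof -
  have "AE \<omega> in M. (\<lambda>n::nat. \<Lambda> {} \<omega>) sums \<Lambda> {} \<omega>"
    using basis_sequence(2)[of "\<lambda>_. {}"] by (simp add: disjoint_family_on_def)
  then show ?thesis
    by eventually_elim (auto dest!: sums_summable summable_LIMSEQ_zero simp: LIMSEQ_const_iff)
qed

text \<open>The axioms speak of sequences, so the index set is enumerated and the family padded with
  empty sets, which contribute 0 almost surely.\<close>

lemma basis_finite_family:
  assumes I: "finite I" and P: "\<And>i. i \<in> I \<Longrightarrow> P i \<in> fmeasurable lborel" "disjoint_family_on P I"
  shows "indep_vars (\<lambda>_. borel) (\<lambda>i. \<Lambda> (P i)) I"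
    "AE \<omega> in M. \<Lambda> (\<Union>i\<in>I. P i) \<omega> = (\<Sum>i\<in>I. \<Lambda> (P i) \<omega>)"
proof -
  obtain h where h: "bij_betw h I {..<card I}"
    using I ex_bij_betw_finite_nat[of I] by (auto simp: atLeast0LessThan)
  define e where "e = inv_into I h"
  have e: "e (h i) = i" if "i \<in> I" for i
    using that h by (simp add: e_def bij_betw_inv_into_left)
  have he: "h (e n) = n" "e n \<in> I" if "n < card I" for n
    using that h bij_betw_inv_into_right[OF h, of n] bij_betw_inv_into[OF h]
    by (auto simp: e_def bij_betw_def)
  have hI: "h i < card I" if "i \<in> I" for i using h that by (auto simp: bij_betw_def)
  define B where "B = (\<lambda>n. if n < card I then P (e n) else {})"
  have B: "range B \<subseteq> fmeasurable lborel"
    using P(1) he by (auto simp: B_def)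
  have disj: "disjoint_family B"
    unfolding disjoint_family_on_def
  proof (intro ballI impI)
    fix m n :: nat assume "m \<noteq> n"
    then show "B m \<inter> B n = {}"
      using he[of m] he[of n] disjoint_family_onD[OF P(2), of "e m" "e n"]
      by (cases "e m = e n") (auto simp: B_def)
  qed
  have un: "(\<Union>n. B n) = (\<Union>i\<in>I. P i)"
    using he hI e by (fastforce simp: B_def split: if_splits)
  have "(\<Union>i\<in>I. P i) \<in> fmeasurable lborel"
    using I P(1) by (auto intro!: fmeasurable.finite_UN)
  then have "AE \<omega> in M. (\<lambda>n. \<Lambda> (B n) \<omega>) sums \<Lambda> (\<Union>i\<in>I. P i) \<omega>"
    using basis_sequence(2)[OF B disj] by (simp add: un)
  with basis_empty show "AE \<omega> in M. \<Lambda> (\<Union>i\<in>I. P i) \<omega> = (\<Sum>i\<in>I. \<Lambda> (P i) \<omega>)"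
  proof eventually_elim
    case (elim \<omega>)
    have "(\<lambda>n. \<Lambda> (B n) \<omega>) sums (\<Sum>n<card I. \<Lambda> (B n) \<omega>)"
      using elim(1) by (intro sums_finite) (auto simp: B_def)
    with elim(2) have "\<Lambda> (\<Union>i\<in>I. P i) \<omega> = (\<Sum>n<card I. \<Lambda> (B n) \<omega>)"
      by (rule sums_unique2)
    also have "\<dots> = (\<Sum>i\<in>I. \<Lambda> (B (h i)) \<omega>)"
      by (rule sum.reindex_bij_betw[OF h, symmetric])
    also have "\<dots> = (\<Sum>i\<in>I. \<Lambda> (P i) \<omega>)"
      using hI e by (intro sum.cong) (auto simp: B_def)
    finally show ?case .
  qed
  have "indep_vars (\<lambda>_. borel) (\<lambda>i. \<Lambda> (B (h i))) I"
    using h by (intro indep_vars_reindex[OF basis_sequence(1)[OF B disj]]) (auto simp: bij_betw_def)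
  then show "indep_vars (\<lambda>_. borel) (\<lambda>i. \<Lambda> (P i)) I"
    using hI e by (subst indep_vars_cong[where Y = "\<lambda>i. \<Lambda> (B (h i))" and J = I]) (auto simp: B_def)
qed

lemma basis_integrable_power:
  assumes "B \<in> fmeasurable lborel"
  shows "integrable M (\<lambda>\<omega>. \<Lambda> B \<omega> ^ n)"
proof -
  have "integrable (distr M borel (\<Lambda> B)) (\<lambda>x. x ^ n)"
    by (intro integrable_power[OF law_basis[OF assms]]) simp
  then show ?thesis using assms by (subst (asm) integrable_distr_eq) auto
qed

lemma basis_expectation:
  assumes "B \<in> fmeasurable lborel" "f \<in> borel_measurable borel"
  shows "(LINT x|distr M borel (\<Lambda> B). f x :: real) = expectation (\<lambda>\<omega>. f (\<Lambda> B \<omega>))"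
  using assms by (subst integral_distr) auto

lemma basis_mean:
  assumes "B \<in> fmeasurable lborel"
  shows "\<i> * of_real (expectation (\<Lambda> B)) = of_real (measure lborel B) * deriv F 0"
  using mean[OF law_basis[OF assms]] basis_expectation[OF assms, of "\<lambda>x. x"] by simp

lemma basis_moment_bound:
  assumes n: "even n" "n > 0" and K: "K \<ge> 0"
  obtains C where "C \<ge> 0" "\<And>B. B \<in> fmeasurable lborel \<Longrightarrow> measure lborel B \<le> K \<Longrightarrow>
    expectation (\<lambda>\<omega>. \<Lambda> B \<omega> ^ n) \<le> C * measure lborel B"
proof -
  obtain C where C: "C \<ge> 0" "\<And>a \<mu>. 0 \<le> a \<Longrightarrow> a \<le> K \<Longrightarrow> law a \<mu> \<Longrightarrow> (LINT x|\<mu>. x ^ n) \<le> C * a"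
    using moment_bound[OF n K] by metis
  show ?thesis
    by (rule that[OF C(1)]) (use C(2)[OF _ _ law_basis] basis_expectation[of _ "\<lambda>x. x ^ n"] in auto)
qed

end

subsection \<open>Geometry of trawls\<close>

text \<open>For decreasing \<open>g\<close>, the intersection of the trawls at times \<open>u \<le> v\<close> is \<open>trawl_tail g v (v - u)\<close>.\<close>

definition trawl_tail :: "(real \<Rightarrow> real) \<Rightarrow> real \<Rightarrow> real \<Rightarrow> (real \<times> real) set" where
  "trawl_tail g t x = {(\<xi>, s). 0 \<le> \<xi> \<and> \<xi> \<le> g (t - s) \<and> s \<le> t - x}"

lemma trawl_at_tail: "trawl_at g t = trawl_tail g t 0"
  by (auto simp: trawl_at_eq trawl_tail_def)

lemma nn_integral_powr_tail:
  assumes \<beta>: "\<beta> > 1" and x: "x \<ge> 0" and C: "C \<ge> 0"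
  shows "(\<integral>\<^sup>+s. ennreal (C * (1 + (t - s)) powr (- \<beta>)) * indicator {..t - x} s \<partial>lborel)
    = ennreal (C / (\<beta> - 1) * (1 + x) powr (1 - \<beta>))"
proof -
  have "(\<integral>\<^sup>+s. ennreal (C * (1 + (t - s)) powr (- \<beta>)) * indicator {..t - x} s \<partial>lborel) =
     (\<integral>\<^sup>+s. ennreal (C * (1 + s) powr (- \<beta>)) * indicator {x..} s \<partial>lborel)"
    by (subst nn_integral_real_affine[where c = "-1" and t = t])
       (auto intro!: nn_integral_cong simp: indicator_def)
  also have "\<dots> = ennreal (0 - C / (1 - \<beta>) * (1 + x) powr (1 - \<beta>))"
  proof (rule nn_integral_FTC_atLeast)
    show "DERIV (\<lambda>s. C / (1 - \<beta>) * (1 + s) powr (1 - \<beta>)) s :> C * (1 + s) powr (- \<beta>)" if "x \<le> s" for s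
      using that x \<beta> by (auto intro!: derivative_eq_intros)
    have "((\<lambda>s. (1 + s) powr (1 - \<beta>)) \<longlongrightarrow> 0) at_top"
      using \<beta> by (intro tendsto_neg_powr filterlim_tendsto_add_at_top[OF tendsto_const filterlim_ident]) auto
    from tendsto_mult_left[OF this, of "C / (1 - \<beta>)"]
    show "((\<lambda>s. C / (1 - \<beta>) * (1 + s) powr (1 - \<beta>)) \<longlongrightarrow> 0) at_top" by simp
  qed (use C in auto)
  also have "0 - C / (1 - \<beta>) * (1 + x) powr (1 - \<beta>) = C / (\<beta> - 1) * (1 + x) powr (1 - \<beta>)"
    using \<beta> by (simp add: field_simps)
  finally show ?thesis .
qed

text \<open>Slow variation is hidden here: of regular variation only a pure power bound is kept. The
  locale is instantiated anew for every loss in the exponent, with \<open>\<beta>\<close> slightly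
  below \<open>\<alpha> + 1\<close> and a constant depending on it.\<close>

locale power_trawl =
  fixes g :: "real \<Rightarrow> real" and C\<^sub>g \<beta> :: real
  assumes g_cont: "continuous_on {0..} g" and g_mono: "antimono_on {0..} g"
    and g_nonneg: "\<And>x. 0 \<le> x \<Longrightarrow> 0 \<le> g x"
    and \<beta>: "\<beta> > 1" and g_le: "\<And>x. 0 \<le> x \<Longrightarrow> g x \<le> C\<^sub>g * (1 + x) powr (- \<beta>)"
begin

lemma g_antimono: "0 \<le> x \<Longrightarrow> x \<le> y \<Longrightarrow> g y \<le> g x"
  using g_mono by (auto simp: monotone_on_def)

lemma Cg_nonneg: "C\<^sub>g \<ge> 0"
  using g_le[of 0] g_nonneg[of 0] by simp

lemma trawl_tail_borel:
  assumes "x \<ge> 0"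
  shows "trawl_tail g t x \<in> sets borel"
proof -
  \<comment> \<open>The maximum with 0 extends \<open>g\<close> continuously to the whole line; on
    the tail its argument is nonnegative, so the set does not change.\<close>
  have "continuous_on UNIV (\<lambda>p::real\<times>real. g (max 0 (t - snd p)))"
    by (rule continuous_on_compose2[OF g_cont]) (auto intro!: continuous_intros)
  then have "closed {p::real\<times>real. fst p \<le> g (max 0 (t - snd p))}"
    by (intro closed_Collect_le continuous_intros)
  moreover have "closed {p::real\<times>real. 0 \<le> fst p}" "closed {p::real\<times>real. snd p \<le> t - x}"
    by (intro closed_Collect_le continuous_intros)+
  ultimately have "closed ({p::real\<times>real. fst p \<le> g (max 0 (t - snd p))} \<inter> {p. 0 \<le> fst p} \<inter> {p. snd p \<le> t - x})"
    by (intro closed_Int)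
  also have "({p::real\<times>real. fst p \<le> g (max 0 (t - snd p))} \<inter> {p. 0 \<le> fst p} \<inter> {p. snd p \<le> t - x}) = trawl_tail g t x"
    using assms by (auto simp: trawl_tail_def max_def)
  finally show ?thesis by (rule borel_closed)
qed

lemma emeasure_trawl_tail:
  assumes x: "x \<ge> 0"
  shows "emeasure lborel (trawl_tail g t x) \<le> ennreal (C\<^sub>g / (\<beta> - 1) * (1 + x) powr (1 - \<beta>))"
proof -
  have "emeasure lborel (trawl_tail g t x) = emeasure (lborel \<Otimes>\<^sub>M lborel) (trawl_tail g t x)"
    by (simp add: lborel_prod)
  also have "\<dots> = (\<integral>\<^sup>+s. emeasure lborel ((\<lambda>\<xi>. (\<xi>, s)) -` trawl_tail g t x) \<partial>lborel)"
  proof (rule lborel_pair.emeasure_pair_measure_alt2)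
    show "trawl_tail g t x \<in> sets (lborel \<Otimes>\<^sub>M lborel)"
      using trawl_tail_borel[OF x] by (subst lborel_prod) simp
  qed
  also have "\<dots> \<le> (\<integral>\<^sup>+s. ennreal (C\<^sub>g * (1 + (t - s)) powr (- \<beta>)) * indicator {..t - x} s \<partial>lborel)"
  proof (intro nn_integral_mono)
    fix s
    show "emeasure lborel ((\<lambda>\<xi>. (\<xi>, s)) -` trawl_tail g t x) \<le>
        ennreal (C\<^sub>g * (1 + (t - s)) powr (- \<beta>)) * indicator {..t - x} s"
    proof (cases "s \<le> t - x")
      case True
      then have "(\<lambda>\<xi>. (\<xi>, s)) -` trawl_tail g t x = {0..g (t - s)}"
        by (auto simp: trawl_tail_def)
      moreover have "0 \<le> g (t - s)" "g (t - s) \<le> C\<^sub>g * (1 + (t - s)) powr (- \<beta>)"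
        using True x by (auto intro!: g_nonneg g_le)
      ultimately show ?thesis using True by (auto intro!: ennreal_leI)
    next
      case False
      then have "(\<lambda>\<xi>. (\<xi>, s)) -` trawl_tail g t x = {}" by (auto simp: trawl_tail_def)
      then show ?thesis by simp
    qed
  qed
  also have "\<dots> = ennreal (C\<^sub>g / (\<beta> - 1) * (1 + x) powr (1 - \<beta>))"
    by (rule nn_integral_powr_tail[OF \<beta> x Cg_nonneg])
  finally show ?thesis .
qed

lemma trawl_tail_fmeasurable: "x \<ge> 0 \<Longrightarrow> trawl_tail g t x \<in> fmeasurable lborel"
  using trawl_tail_borel emeasure_trawl_tail
  by (auto intro!: fmeasurableI order_le_less_trans[OF emeasure_trawl_tail])

lemma measure_trawl_tail:
  "x \<ge> 0 \<Longrightarrow> measure lborel (trawl_tail g t x) \<le> C\<^sub>g / (\<beta> - 1) * (1 + x) powr (1 - \<beta>)"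
  using emeasure_trawl_tail[of x t] Cg_nonneg \<beta> unfolding measure_def
  by (intro enn2real_leI) auto

lemma trawl_at_fmeasurable: "trawl_at g t \<in> fmeasurable lborel"
  by (simp add: trawl_at_tail trawl_tail_fmeasurable)

lemma rectangle_measure:
  assumes "a \<le> b" "0 \<le> c"
  shows "{0..c} \<times> {a..b::real} \<in> fmeasurable lborel" "measure lborel ({0..c} \<times> {a..b::real}) = c * (b - a)"
proof -
  have "emeasure lborel ({0..c} \<times> {a..b::real}) = ennreal (c * (b - a))"
    using assms unfolding lborel_prod[symmetric]
    by (subst lborel.emeasure_pair_measure_Times) (auto simp: ennreal_mult')
  then show "{0..c} \<times> {a..b::real} \<in> fmeasurable lborel" "measure lborel ({0..c} \<times> {a..b::real}) = c * (b - a)"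
    using assms by (auto intro!: fmeasurableI simp: measure_def borel_Times)
qed

section \<open>Atoms generated by finitely many trawls\<close>

definition hits :: "(nat \<Rightarrow> real) \<Rightarrow> nat \<Rightarrow> real \<times> real \<Rightarrow> nat set" where
  "hits u N p = {j. j < N \<and> p \<in> trawl_at g (u j)}"

text \<open>A point hit at least \<open>k\<close> times is either hit by the first trawl, hence also by trawl \<open>k - 1\<close>, or it
  is born within \<open>d\<close> before its first hit and is then low enough to survive for a time \<open>(k - 1) d\<close>.\<close>

lemma hits_cover:
  assumes d: "d > 0" and k: "k \<ge> 1" and u: "u = (\<lambda>j. v + real j * d)"
    and p: "card (hits u N p) \<ge> k"
  shows "p \<in> trawl_tail g (u (k - 1)) (real (k - 1) * d) \<union>
    (\<Union>j<N. {0..g (real (k - 1) * d)} \<times> {u j - d..u j})"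
proof -
  obtain \<xi> s where ps: "p = (\<xi>, s)" by (cases p)
  define H where "H = hits u N p"
  have fin: "finite H" by (simp add: H_def hits_def)
  have ne: "H \<noteq> {}" using p k by (auto simp: H_def)
  define j where "j = Min H"
  define l where "l = Max H"
  have j: "j \<in> H" and l: "l \<in> H" using fin ne by (auto simp: j_def l_def)
  have "H \<subseteq> {j..l}" using fin by (auto simp: j_def l_def)
  then have "card H \<le> card {j..l}" by (intro card_mono) auto
  then have lj: "j + (k - 1) \<le> l" using p k by (simp add: H_def)
  have mono: "u a \<le> u b" if "a \<le> b" for a b using that d by (simp add: u mult_right_mono)
  have s: "0 \<le> \<xi>" "\<xi> \<le> g (u j - s)" "s \<le> u j" "\<xi> \<le> g (u l - s)" "j < N"
    using j l by (auto simp: H_def hits_def ps trawl_at_eq)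
  show ?thesis
  proof (cases "j = 0")
    case True
    have "g (u l - s) \<le> g (u (k - 1) - s)"
      using s(3) mono[of "k - 1" l] mono[of j "k - 1"] lj True by (intro g_antimono) auto
    then show ?thesis using s True by (auto simp: ps trawl_tail_def u)
  next
    case False
    \<comment> \<open>Since \<open>g\<close> decreases, a point stays in the moving trawl from its
      birth time \<open>s\<close> until it dies. Had it been born by \<open>u (j - 1)\<close>, it
      would have been hit then, against the minimality of \<open>j\<close>.\<close>
    have "u (j - 1) < s"
    proof (rule ccontr)
      assume "\<not> u (j - 1) < s"
      then have "g (u j - s) \<le> g (u (j - 1) - s)"
        using mono[of "j - 1" j] by (intro g_antimono) auto
      then have "j - 1 \<in> H"
        using s \<open>\<not> u (j - 1) < s\<close> by (auto simp: H_def hits_def ps trawl_at_eq)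
      then have "j \<le> j - 1" using fin by (auto simp: j_def)
      then show False using False by simp
    qed
    moreover have "u (j - 1) = u j - d" using False by (simp add: u of_nat_diff algebra_simps)
    moreover have "g (u l - s) \<le> g (real (k - 1) * d)"
    proof (rule g_antimono)
      have "real (k - 1) * d \<le> real (l - j) * d" using lj d by (intro mult_right_mono) auto
      also have "\<dots> = u l - u j" using lj by (simp add: u of_nat_diff algebra_simps)
      finally show "real (k - 1) * d \<le> u l - s" using s(3) by simp
    qed (use d in simp)
    ultimately show ?thesis using s by (auto simp: ps intro!: bexI[of _ j])
  qed
qed

definition atom :: "(nat \<Rightarrow> real) \<Rightarrow> nat \<Rightarrow> nat set \<Rightarrow> (real \<times> real) set" where
  "atom u N J = {p. hits u N p = J}"

text \<open>The empty index set is left out because its atom is the complement of all the trawls,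
  which has infinite measure and so is no argument for the basis.\<close>

definition atoms :: "nat \<Rightarrow> nat set set" where
  "atoms N = Pow {..<N} - {{}}"

lemma atoms: "finite (atoms N)" "J \<in> atoms N \<Longrightarrow> finite J" "J \<in> atoms N \<Longrightarrow> J \<noteq> {}"
    "J \<in> atoms N \<Longrightarrow> card J \<le> N" "J \<in> atoms N \<Longrightarrow> J \<subseteq> {..<N}"
  using card_mono[of "{..<N}" J] by (auto simp: atoms_def finite_subset)

lemma atom_fmeasurable:
  assumes J: "J \<in> atoms N"
  shows "atom u N J \<in> fmeasurable lborel"
proof -
  obtain j where j: "j \<in> J" using atoms(3)[OF J] by auto
  have "atom u N J = (\<Inter>i\<in>J. trawl_at g (u i)) - (\<Union>i\<in>{..<N} - J. trawl_at g (u i))"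
    using J by (auto simp: atom_def hits_def atoms_def)
  moreover have "(\<Inter>i\<in>J. trawl_at g (u i)) \<in> sets lborel"
    using j atoms(2)[OF J] by (intro sets.finite_INT fmeasurableD[OF trawl_at_fmeasurable]) auto
  moreover have "(\<Union>i\<in>{..<N} - J. trawl_at g (u i)) \<in> sets lborel"
    by (intro sets.finite_UN fmeasurableD[OF trawl_at_fmeasurable]) auto
  ultimately have "atom u N J \<in> sets lborel" by simp
  moreover have "atom u N J \<subseteq> trawl_at g (u j)" using j by (auto simp: atom_def hits_def)
  ultimately show ?thesis
    by (rule fmeasurableI2[OF trawl_at_fmeasurable, rotated])
qed

lemma atom_measure_le:
  assumes J: "J \<in> atoms N"
  shows "measure lborel (atom u N J) \<le> C\<^sub>g / (\<beta> - 1)"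
proof -
  obtain j where j: "j \<in> J" using atoms(3)[OF J] by auto
  have "atom u N J \<subseteq> trawl_at g (u j)" using j by (auto simp: atom_def hits_def)
  then have "measure lborel (atom u N J) \<le> measure lborel (trawl_at g (u j))"
    by (intro measure_mono_fmeasurable trawl_at_fmeasurable fmeasurableD[OF atom_fmeasurable[OF J]])
  also have "\<dots> \<le> C\<^sub>g / (\<beta> - 1)" using measure_trawl_tail[of 0 "u j"] by (simp add: trawl_at_tail)
  finally show ?thesis .
qed

lemma atom_disjoint: "disjoint_family_on (atom u N) S"
  by (auto simp: disjoint_family_on_def atom_def)

lemma trawl_at_atoms:
  assumes "j < N" shows "trawl_at g (u j) = (\<Union>J\<in>{J\<in>atoms N. j \<in> J}. atom u N J)"
  using assms by (auto simp: atoms_def atom_def hits_def)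

text \<open>The atoms are disjoint, so the sum is the measure of the set of points hit at least
  \<open>k\<close> times. In the cover by \<open>hits_cover\<close>, the first term bounds the trawl
  tail and the second the \<open>N\<close> rectangles.\<close>

lemma sum_atoms_ge:
  assumes d: "d > 0" and k: "k \<ge> 1" and u: "u = (\<lambda>j. v + real j * d)"
  shows "(\<Sum>J\<in>{J\<in>atoms N. card J \<ge> k}. measure lborel (atom u N J)) \<le>
    C\<^sub>g / (\<beta> - 1) * (1 + real (k - 1) * d) powr (1 - \<beta>) + real N * d * C\<^sub>g * (1 + real (k - 1) * d) powr (- \<beta>)"
proof -
  let ?x = "real (k - 1) * d"
  have x: "?x \<ge> 0" using d by simp
  let ?S = "trawl_tail g (u (k - 1)) ?x"
  let ?R = "\<lambda>j. {0..g ?x} \<times> {u j - d..u j}"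
  have R: "?R j \<in> fmeasurable lborel" "measure lborel (?R j) = g ?x * d" for j
    using rectangle_measure[of "u j - d" "u j" "g ?x"] d g_nonneg[OF x] by auto
  have UR: "(\<Union>j<N. ?R j) \<in> fmeasurable lborel" by (intro fmeasurable.finite_UN R) auto
  have "(\<Sum>J\<in>{J\<in>atoms N. card J \<ge> k}. measure lborel (atom u N J)) =
      measure lborel (\<Union>J\<in>{J\<in>atoms N. card J \<ge> k}. atom u N J)"
    using fmeasurableD[OF atom_fmeasurable] fmeasurableD2[OF atom_fmeasurable]
    by (intro measure_finite_Union[symmetric] atom_disjoint) (auto simp: atoms(1))
  also have "\<dots> \<le> measure lborel (?S \<union> (\<Union>j<N. ?R j))"
  proof (rule measure_mono_fmeasurable)
    show "(\<Union>J\<in>{J\<in>atoms N. card J \<ge> k}. atom u N J) \<subseteq> ?S \<union> (\<Union>j<N. ?R j)"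
    proof safe
      fix J a b assume J: "J \<in> atoms N" "k \<le> card J" and ab: "(a, b) \<in> atom u N J"
        and not: "(a, b) \<notin> (\<Union>j<N. ?R j)"
      have "card (hits u N (a, b)) \<ge> k" using J ab by (auto simp: atom_def)
      from hits_cover[OF d k u this] show "(a, b) \<in> ?S" using not by blast
    qed
    show "?S \<union> (\<Union>j<N. ?R j) \<in> fmeasurable lborel"
      by (intro fmeasurable.Un trawl_tail_fmeasurable x UR)
    show "(\<Union>J\<in>{J\<in>atoms N. card J \<ge> k}. atom u N J) \<in> sets lborel"
      by (intro sets.finite_UN fmeasurableD[OF atom_fmeasurable]) (auto simp: atoms(1))
  qed
  also have "\<dots> \<le> measure lborel ?S + measure lborel (\<Union>j<N. ?R j)"
    by (intro measure_Un_le fmeasurableD trawl_tail_fmeasurable x UR)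
  also have "measure lborel (\<Union>j<N. ?R j) \<le> (\<Sum>j<N. measure lborel (?R j))"
    by (intro measure_UNION_le fmeasurableD R) auto
  also have "(\<Sum>j<N. measure lborel (?R j)) = real N * d * g ?x" by (simp only: R(2)) simp
  also have "\<dots> \<le> real N * d * (C\<^sub>g * (1 + ?x) powr (- \<beta>))"
    using d g_le[OF x] by (intro mult_left_mono) auto
  also have "measure lborel ?S \<le> C\<^sub>g / (\<beta> - 1) * (1 + ?x) powr (1 - \<beta>)"
    by (rule measure_trawl_tail[OF x])
  finally show ?thesis by (simp add: mult.assoc)
qed

text \<open>For such \<open>d\<close>, \<open>1 + (k - 1) * d\<close> lies between
  \<open>k / 2\<close> and \<open>k\<close>, hence below \<open>N\<close>. So the boundary term, of
  order \<open>k powr (1 - \<beta>)\<close>, is within the order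
  \<open>N * k powr (- \<beta>)\<close> of the rectangles.\<close>

lemma sum_atoms_ge':
  assumes d: "1 / 2 \<le> d" "d \<le> 1" and k: "1 \<le> k" "k \<le> N" and u: "u = (\<lambda>j. v + real j * d)"
  shows "(\<Sum>J\<in>{J\<in>atoms N. card J \<ge> k}. measure lborel (atom u N J)) \<le>
    (C\<^sub>g / (\<beta> - 1) + C\<^sub>g) * 2 powr \<beta> * (real N * real k powr (- \<beta>))"
proof -
  define y where "y = 1 + real (k - 1) * d"
  have y: "real k / 2 \<le> y"
  proof -
    have "real (k - 1) * (1/2) \<le> real (k - 1) * d" using d by (intro mult_left_mono) auto
    then show ?thesis using k by (simp add: y_def of_nat_diff)
  qed
  have "real (k - 1) * d \<le> real (k - 1) * 1" using d by (intro mult_left_mono) auto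
  then have yN: "y \<le> real N" using k by (simp add: y_def of_nat_diff)
  have y0: "y > 0" using y k by simp
  have c: "C\<^sub>g / (\<beta> - 1) \<ge> 0" using Cg_nonneg \<beta> by simp
  have y1: "y powr (1 - \<beta>) \<le> real N * y powr (- \<beta>)"
    using y0 yN powr_add[of y 1 "- \<beta>"] by (simp add: mult_right_mono)
  have "(\<Sum>J\<in>{J\<in>atoms N. card J \<ge> k}. measure lborel (atom u N J)) \<le>
     C\<^sub>g / (\<beta> - 1) * y powr (1 - \<beta>) + real N * d * C\<^sub>g * y powr (- \<beta>)"
    unfolding y_def using d k by (intro sum_atoms_ge[OF _ _ u]) auto
  also have "\<dots> \<le> C\<^sub>g / (\<beta> - 1) * (real N * y powr (- \<beta>)) + real N * 1 * C\<^sub>g * y powr (- \<beta>)"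
    using d c Cg_nonneg by (intro add_mono mult_left_mono[OF y1] mult_right_mono mult_left_mono) auto
  also have "\<dots> = (C\<^sub>g / (\<beta> - 1) + C\<^sub>g) * (real N * y powr (- \<beta>))"
    by (simp add: algebra_simps)
  also have "\<dots> \<le> (C\<^sub>g / (\<beta> - 1) + C\<^sub>g) * (real N * (real k / 2) powr (- \<beta>))"
    using c Cg_nonneg y k \<beta> by (intro mult_left_mono powr_mono2') auto
  also have "(real k / 2) powr (- \<beta>) = 2 powr \<beta> * real k powr (- \<beta>)"
    by (simp add: powr_divide powr_minus field_simps)
  finally show ?thesis by (simp add: mult_ac)
qed

end

text \<open>Telescoping: the increments of \<open>k ^ m\<close> are at most
  \<open>m * k ^ (m - 1)\<close>. For \<open>m = 0\<close> the sum vanishes while the left side is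
  1.\<close>

lemma power_le_sum_powers: "real c ^ m \<le> (\<Sum>k=1..c. real m * real k ^ (m - 1)) + (if m = 0 then 1 else 0)"
proof (induction c)
  case 0
  then show ?case by (simp add: power_0_left)
next
  case (Suc c)
  have "(real c + 1) ^ m \<le> real c ^ m + real m * (real c + 1) ^ (m - 1)" for m
  proof (induction m)
    case (Suc m)
    have "(real c + 1) ^ Suc m \<le> (real c + 1) * (real c ^ m + real m * (real c + 1) ^ (m - 1))"
      using Suc by (simp add: mult_left_mono)
    also have "\<dots> = real c ^ Suc m + real c ^ m + real m * (real c + 1) ^ m"
      by (cases m) (simp_all add: algebra_simps)
    also have "\<dots> \<le> real c ^ Suc m + (real c + 1) ^ m + real m * (real c + 1) ^ m"
      by (intro add_mono power_mono) auto
    finally show ?case by (simp add: algebra_simps)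
  qed simp
  from this[of m] Suc show ?case by (simp add: add.commute)
qed

context power_trawl
begin

text \<open>Summation by layers reduces the weighted sum to \<open>N\<close> times the sum of
  \<open>k powr (m - 1 - \<beta>)\<close>. This power is split into
  \<open>k powr (m - \<gamma>)\<close>, bounded by its largest value, and \<open>k powr s\<close>,
  summable because \<open>\<gamma> < \<beta>\<close>. The gap thus also covers the borderline case
  that would give a logarithm.\<close>

lemma weighted_atoms:
  assumes m: "m \<ge> 1" and \<gamma>: "\<gamma> < \<beta>"
  obtains C where "C \<ge> 0" "\<And>N d v. N \<ge> 1 \<Longrightarrow> 1 / 2 \<le> d \<Longrightarrow> d \<le> 1 \<Longrightarrow>
    (\<Sum>J\<in>atoms N. real (card J) ^ m * measure lborel (atom (\<lambda>j. v + real j * d) N J))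
      \<le> C * real N powr (1 + max 0 (real m - \<gamma>))"
proof -
  define D where "D = (C\<^sub>g / (\<beta> - 1) + C\<^sub>g) * 2 powr \<beta>"
  have D: "D \<ge> 0" using Cg_nonneg \<beta> by (simp add: D_def)
  define s where "s = - 1 - (\<beta> - \<gamma>)"
  have sm: "summable (\<lambda>k. real k powr s)" using \<gamma> by (simp add: summable_real_powr_iff s_def)
  define Z where "Z = (\<Sum>k. real k powr s)"
  have Z: "(\<Sum>k=1..N. real k powr s) \<le> Z" for N
    unfolding Z_def by (intro sum_le_suminf[OF sm]) auto
  have Z0: "Z \<ge> 0" using Z[of 0] by simp
  show ?thesis
  proof (rule that[of "real m * D * Z"])
    show "0 \<le> real m * D * Z" using D Z0 by simp
    fix N :: nat and d v :: real
    assume N: "N \<ge> 1" and d: "1 / 2 \<le> d" "d \<le> 1"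
    define u where "u = (\<lambda>j. v + real j * d)"
    define E where "E = real N powr max 0 (real m - \<gamma>)"
    let ?\<mu> = "\<lambda>J. measure lborel (atom u N J)"
    have "(\<Sum>J\<in>atoms N. real (card J) ^ m * ?\<mu> J)
        \<le> (\<Sum>J\<in>atoms N. \<Sum>k=1..N. if k \<le> card J then real m * real k ^ (m - 1) * ?\<mu> J else 0)"
    proof (intro sum_mono)
      fix J assume J: "J \<in> atoms N"
      have "real (card J) ^ m * ?\<mu> J \<le> (\<Sum>k=1..card J. real m * real k ^ (m - 1)) * ?\<mu> J"
        using power_le_sum_powers[of "card J" m] m by (intro mult_right_mono) auto
      also have "\<dots> = (\<Sum>k=1..card J. real m * real k ^ (m - 1) * ?\<mu> J)"
        by (simp add: sum_distrib_right)
      also have "\<dots> = (\<Sum>k=1..N. if k \<le> card J then real m * real k ^ (m - 1) * ?\<mu> J else 0)"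
        using atoms(4)[OF J] by (intro sum.mono_neutral_cong_left) auto
      finally show "real (card J) ^ m * ?\<mu> J \<le>
        (\<Sum>k=1..N. if k \<le> card J then real m * real k ^ (m - 1) * ?\<mu> J else 0)" .
    qed
    also have "\<dots> = (\<Sum>k=1..N. \<Sum>J\<in>atoms N. if k \<le> card J then real m * real k ^ (m - 1) * ?\<mu> J else 0)"
      by (rule sum.swap)
    also have "\<dots> = (\<Sum>k=1..N. real m * real k ^ (m - 1) * (\<Sum>J\<in>{J\<in>atoms N. card J \<ge> k}. ?\<mu> J))"
      by (intro sum.cong refl) (auto simp: sum_distrib_left sum.inter_filter[OF atoms(1)] intro!: sum.cong)
    also have "\<dots> \<le> (\<Sum>k=1..N. real m * D * real N * E * real k powr s)"
    proof (intro sum_mono)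
      fix k assume k: "k \<in> {1..N}"
      have kp: "real k powr (real m - 1) = real k ^ (m - 1)"
        using k m by (simp add: of_nat_diff flip: powr_realpow)
      have "real m * real k ^ (m - 1) * (\<Sum>J\<in>{J\<in>atoms N. card J \<ge> k}. ?\<mu> J) \<le>
          real m * real k powr (real m - 1) * (D * (real N * real k powr (- \<beta>)))"
        unfolding D_def kp using k d by (intro mult_left_mono sum_atoms_ge'[OF d _ _ u_def]) auto
      also have "real m * real k powr (real m - 1) * (D * (real N * real k powr (- \<beta>))) =
          real m * D * real N * (real k powr (real m - 1) * real k powr (- \<beta>))" by simp
      also have "real k powr (real m - 1) * real k powr (- \<beta>) = real k powr (real m - \<gamma>) * real k powr s"
        unfolding powr_add[symmetric] by (simp add: s_def algebra_simps)
      also have "real m * D * real N * (real k powr (real m - \<gamma>) * real k powr s)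
          \<le> real m * D * real N * (E * real k powr s)"
      proof (intro mult_left_mono mult_right_mono)
        have "real k powr (real m - \<gamma>) \<le> real k powr max 0 (real m - \<gamma>)"
          using k by (intro powr_mono) auto
        also have "\<dots> \<le> E" unfolding E_def using k by (intro powr_mono2) auto
        finally show "real k powr (real m - \<gamma>) \<le> E" .
      qed (use D in auto)
      finally show "real m * real k ^ (m - 1) * (\<Sum>J\<in>{J\<in>atoms N. card J \<ge> k}. ?\<mu> J) \<le>
        real m * D * real N * E * real k powr s" by (simp only: mult.assoc)
    qed
    also have "\<dots> = real m * D * real N * E * (\<Sum>k=1..N. real k powr s)"
      by (simp add: sum_distrib_left)
    also have "\<dots> \<le> real m * D * real N * E * Z"
      using D by (intro mult_left_mono Z) (auto simp: E_def)
    also have "\<dots> = real m * D * Z * (real N powr 1 * E)" by simp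
    also have "real N powr 1 * E = real N powr (1 + max 0 (real m - \<gamma>))"
      by (simp only: E_def powr_add)
    finally show "(\<Sum>J\<in>atoms N. real (card J) ^ m * measure lborel (atom (\<lambda>j. v + real j * d) N J))
      \<le> real m * D * Z * real N powr (1 + max 0 (real m - \<gamma>))" by (simp add: u_def)
  qed
qed

end

section \<open>Moments of sums of trawl values\<close>

locale analytic_levy_trawl = analytic_levy_basis \<kappa> F r M \<Lambda> + power_trawl g C\<^sub>g \<beta>
  for \<kappa> F r and M :: "'a measure" and \<Lambda> g C\<^sub>g \<beta> +
  assumes F': "deriv F 0 = 0"
begin

lemma basis_mean_zero: "B \<in> fmeasurable lborel \<Longrightarrow> expectation (\<Lambda> B) = 0"
  using basis_mean[of B] F' by simp

lemma trawl_sum_atoms: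
  "AE \<omega> in M. (\<Sum>j<N. \<Lambda> (trawl_at g (u j)) \<omega>) = (\<Sum>J\<in>atoms N. real (card J) * \<Lambda> (atom u N J) \<omega>)"
proof -
  have "AE \<omega> in M. \<forall>j\<in>{..<N}. \<Lambda> (trawl_at g (u j)) \<omega> = (\<Sum>J\<in>{J\<in>atoms N. j \<in> J}. \<Lambda> (atom u N J) \<omega>)"
  proof (rule AE_finite_allI)
    fix j assume "j \<in> {..<N}"
    then show "AE \<omega> in M. \<Lambda> (trawl_at g (u j)) \<omega> = (\<Sum>J\<in>{J\<in>atoms N. j \<in> J}. \<Lambda> (atom u N J) \<omega>)"
      by (subst trawl_at_atoms[of j N], simp) (intro basis_finite_family atom_disjoint, auto simp: atoms(1) atom_fmeasurable)
  qed simp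
  then show ?thesis
  proof eventually_elim
    case (elim \<omega>)
    let ?f = "\<lambda>J. \<Lambda> (atom u N J) \<omega>"
    have "(\<Sum>j<N. \<Lambda> (trawl_at g (u j)) \<omega>) = (\<Sum>j<N. \<Sum>J\<in>atoms N. if j \<in> J then ?f J else 0)"
      using elim by (intro sum.cong) (auto simp: sum.inter_filter atoms(1))
    also have "\<dots> = (\<Sum>J\<in>atoms N. \<Sum>j<N. if j \<in> J then ?f J else 0)" by (rule sum.swap)
    also have "\<dots> = (\<Sum>J\<in>atoms N. real (card J) * ?f J)"
    proof (rule sum.cong[OF refl])
      fix J assume "J \<in> atoms N"
      then have "{..<N} \<inter> J = J" using atoms(5) by blast
      then show "(\<Sum>j<N. if j \<in> J then ?f J else 0) = real (card J) * ?f J"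
        by (simp add: sum.If_cases)
    qed
    finally show ?case .
  qed
qed

text \<open>Rosenthal's inequality with unit of length \<open>K = N powr (e / n)\<close>, chosen so
  that \<open>K ^ n\<close> is the order of the sum of the \<open>n\<close>-th moments. The
  hypothesis \<open>n\<gamma>\<close> says that the sum of the variances is then of order at most
  \<open>K ^ 2\<close>.\<close>

lemma trawl_sum_moment_bound:
  assumes n: "even n" "n \<ge> 2" and \<gamma>: "\<gamma> < \<beta>" "\<gamma> \<le> real n"
    and n\<gamma>: "1 + max 0 (2 - \<gamma>) \<le> 2 * (real n - \<gamma> + 1) / real n"
  obtains C where "C \<ge> 0" "\<And>N d v. N \<ge> 1 \<Longrightarrow> 1 / 2 \<le> d \<Longrightarrow> d \<le> 1 \<Longrightarrow>
    (\<integral>\<^sup>+\<omega>. ennreal ((\<Sum>j<N. \<Lambda> (trawl_at g (v + real j * d)) \<omega>) ^ n) \<partial>M) \<le> ennreal (C * real N powr (real n - \<gamma> + 1))"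
proof -
  define e where "e = real n - \<gamma> + 1"
  let ?K = "C\<^sub>g / (\<beta> - 1)"
  have K0: "?K \<ge> 0" using Cg_nonneg \<beta> by simp
  obtain C2 where C2: "C2 \<ge> 0" "\<And>B. B \<in> fmeasurable lborel \<Longrightarrow> measure lborel B \<le> ?K \<Longrightarrow>
      expectation (\<lambda>\<omega>. \<Lambda> B \<omega> ^ 2) \<le> C2 * measure lborel B"
    using basis_moment_bound[of 2 ?K] K0 by auto
  obtain Cn where Cn: "Cn \<ge> 0" "\<And>B. B \<in> fmeasurable lborel \<Longrightarrow> measure lborel B \<le> ?K \<Longrightarrow>
      expectation (\<lambda>\<omega>. \<Lambda> B \<omega> ^ n) \<le> Cn * measure lborel B"
    using basis_moment_bound[of n ?K] K0 n by auto
  obtain W2 where W2: "W2 \<ge> 0" "\<And>N d v. N \<ge> 1 \<Longrightarrow> 1 / 2 \<le> d \<Longrightarrow> d \<le> 1 \<Longrightarrow>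
    (\<Sum>J\<in>atoms N. real (card J) ^ 2 * measure lborel (atom (\<lambda>j. v + real j * d) N J))
      \<le> W2 * real N powr (1 + max 0 (real 2 - \<gamma>))"
    using weighted_atoms[of 2 \<gamma>] \<gamma> by auto
  obtain Wn where Wn: "Wn \<ge> 0" "\<And>N d v. N \<ge> 1 \<Longrightarrow> 1 / 2 \<le> d \<Longrightarrow> d \<le> 1 \<Longrightarrow>
    (\<Sum>J\<in>atoms N. real (card J) ^ n * measure lborel (atom (\<lambda>j. v + real j * d) N J))
      \<le> Wn * real N powr (1 + max 0 (real n - \<gamma>))"
    using weighted_atoms[of n \<gamma>] \<gamma> n by auto
  define C where "C = C2 * W2 + Cn * Wn"
  have C: "C \<ge> 0" "C2 * W2 \<le> C" "Cn * Wn \<le> C" using C2 Cn W2 Wn by (auto simp: C_def)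
  show ?thesis
  proof (rule that[of "fact n * exp (2 * real n * C)"])
    fix N :: nat and d v :: real
    assume N: "N \<ge> 1" and d: "1 / 2 \<le> d" "d \<le> 1"
    define u where "u = (\<lambda>j. v + real j * d)"
    define K where "K = real N powr (e / real n)"
    have K: "K > 0" "K ^ n = real N powr e" "K ^ 2 = real N powr (2 * e / real n)"
      using N n by (simp_all add: K_def powr_powr mult.commute flip: powr_realpow)
    define Y where "Y = (\<lambda>J \<omega>. real (card J) * \<Lambda> (atom u N J) \<omega>)"
    have af: "J \<in> atoms N \<Longrightarrow> atom u N J \<in> fmeasurable lborel" for J by (rule atom_fmeasurable)
    have "indep_vars (\<lambda>_. borel) (\<lambda>J. \<Lambda> (atom u N J)) (atoms N)"
      by (intro basis_finite_family atoms af atom_disjoint)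
    then have indep: "indep_vars (\<lambda>_. borel) Y (atoms N)"
      unfolding Y_def by (rule indep_vars_compose2) simp
    have int: "integrable M (\<lambda>\<omega>. Y J \<omega> ^ k)" if "J \<in> atoms N" for J k
      using basis_integrable_power[OF af[OF that]] by (simp add: Y_def power_mult_distrib)
    have mean: "expectation (Y J) = 0" if "J \<in> atoms N" for J
      using basis_mean_zero[OF af[OF that]] by (simp add: Y_def[abs_def])
    have mom: "(\<Sum>J\<in>atoms N. expectation (\<lambda>\<omega>. Y J \<omega> ^ k)) \<le>
        D * (\<Sum>J\<in>atoms N. real (card J) ^ k * measure lborel (atom u N J))"
      if "\<And>B. B \<in> fmeasurable lborel \<Longrightarrow> measure lborel B \<le> ?K \<Longrightarrow>
        expectation (\<lambda>\<omega>. \<Lambda> B \<omega> ^ k) \<le> D * measure lborel B" for k D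
      unfolding sum_distrib_left
    proof (intro sum_mono)
      fix J assume J: "J \<in> atoms N"
      have "expectation (\<lambda>\<omega>. Y J \<omega> ^ k) = real (card J) ^ k * expectation (\<lambda>\<omega>. \<Lambda> (atom u N J) \<omega> ^ k)"
        by (simp add: Y_def power_mult_distrib)
      also have "\<dots> \<le> real (card J) ^ k * (D * measure lborel (atom u N J))"
        by (intro mult_left_mono that af J atom_measure_le) auto
      finally show "expectation (\<lambda>\<omega>. Y J \<omega> ^ k) \<le> D * (real (card J) ^ k * measure lborel (atom u N J))"
        by (simp add: mult_ac)
    qed
    have snd: "(\<Sum>J\<in>atoms N. expectation (\<lambda>\<omega>. Y J \<omega> ^ 2)) \<le> C * K ^ 2"
    proof -
      have "(\<Sum>J\<in>atoms N. expectation (\<lambda>\<omega>. Y J \<omega> ^ 2)) \<le>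
          C2 * (W2 * real N powr (1 + max 0 (real 2 - \<gamma>)))"
        using W2(2)[OF N d, of v] C2(1) by (intro order_trans[OF mom[OF C2(2)]] mult_left_mono) (auto simp: u_def)
      also have "\<dots> = (C2 * W2) * real N powr (1 + max 0 (2 - \<gamma>))" by simp
      also have "\<dots> \<le> C * K ^ 2"
        unfolding K(3) using C N n\<gamma> by (intro mult_mono powr_mono) (auto simp: e_def)
      finally show ?thesis .
    qed
    have nth: "(\<Sum>J\<in>atoms N. expectation (\<lambda>\<omega>. Y J \<omega> ^ n)) \<le> C * K ^ n"
    proof -
      have "(\<Sum>J\<in>atoms N. expectation (\<lambda>\<omega>. Y J \<omega> ^ n)) \<le>
          Cn * (Wn * real N powr (1 + max 0 (real n - \<gamma>)))"
        using Wn(2)[OF N d, of v] Cn(1) by (intro order_trans[OF mom[OF Cn(2)]] mult_left_mono) (auto simp: u_def)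
      also have "\<dots> = (Cn * Wn) * real N powr e" using \<gamma> by (simp add: e_def max_def algebra_simps)
      also have "\<dots> \<le> C * K ^ n"
        unfolding K(2) using C by (intro mult_right_mono) auto
      finally show ?thesis .
    qed
    note ros = rosenthal_even[OF atoms(1) indep n K(1) int mean snd nth]
    have "(\<integral>\<^sup>+\<omega>. ennreal ((\<Sum>j<N. \<Lambda> (trawl_at g (u j)) \<omega>) ^ n) \<partial>M) =
       (\<integral>\<^sup>+\<omega>. ennreal ((\<Sum>J\<in>atoms N. Y J \<omega>) ^ n) \<partial>M)"
      using trawl_sum_atoms[of u N] by (intro nn_integral_cong_AE) (auto simp: Y_def)
    also have "\<dots> = ennreal (expectation (\<lambda>\<omega>. (\<Sum>J\<in>atoms N. Y J \<omega>) ^ n))"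
      using ros(1) n by (intro nn_integral_eq_integral AE_I2 zero_le_even_power) auto
    also have "\<dots> \<le> ennreal (fact n * exp (2 * real n * C) * real N powr e)"
      using ros(2) unfolding K(2) by (rule ennreal_leI)
    finally show "(\<integral>\<^sup>+\<omega>. ennreal ((\<Sum>j<N. \<Lambda> (trawl_at g (v + real j * d)) \<omega>) ^ n) \<partial>M) \<le>
      ennreal (fact n * exp (2 * real n * C) * real N powr (real n - \<gamma> + 1))"
      by (simp add: u_def e_def)
  qed simp
qed

end

subsection \<open>Moments of the integrated process\<close>

lemma set_integral_singleton: "(LBINT u:{a..a::real}. f u :: real) = 0"
  unfolding set_lebesgue_integral_def
proof (rule integral_eq_zero_AE)
  show "AE u in lborel. indicator {a..a} u *\<^sub>R f u = 0"
    using AE_lborel_singleton[of a]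
  proof eventually_elim
    case (elim u)
    then show ?case by (cases "u \<in> {a..a}") auto
  qed
qed

lemma abs_powr_le_even_power:
  fixes x p :: real
  assumes "0 \<le> p" "p \<le> real k"
  shows "\<bar>x\<bar> powr p \<le> 1 + x ^ (2 * k)"
proof (cases "\<bar>x\<bar> \<le> 1")
  case True
  then have "\<bar>x\<bar> powr p \<le> 1" using assms by (simp add: powr_le1)
  moreover have "0 \<le> x ^ (2 * k)" by (rule zero_le_even_power) simp
  ultimately show ?thesis by linarith
next
  case False
  then have "\<bar>x\<bar> powr p \<le> \<bar>x\<bar> powr real (2 * k)" using assms by (intro powr_mono) auto
  also have "\<dots> = x ^ (2 * k)" using False by (subst powr_realpow) (auto simp: power_even_abs)
  finally show ?thesis by simp
qed

lemma set_integral_split_sum: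
  fixes f :: "real \<Rightarrow> real"
  assumes d: "d \<ge> 0" and f: "set_integrable lborel {0..real N * d} f"
  shows "(\<And>j. j < N \<Longrightarrow> set_integrable lborel {0..d} (\<lambda>u. f (u + real j * d)))"
    "(LBINT u:{0..real N * d}. f u) = (\<Sum>j<N. LBINT u:{0..d}. f (u + real j * d))"
proof -
  have shift: "set_integrable lborel {0..d} (\<lambda>u. f (u + a)) \<longleftrightarrow> set_integrable lborel {a..a + d} f"
    "(LBINT u:{0..d}. f (u + a)) = (LBINT u:{a..a + d}. f u)" for a
  proof -
    have eq: "indicator {a..a + d} (a + 1 * x) *\<^sub>R f (a + 1 * x) = indicator {0..d} x *\<^sub>R f (x + a)" for x
      by (simp add: indicator_def add.commute)
    show "set_integrable lborel {0..d} (\<lambda>u. f (u + a)) \<longleftrightarrow> set_integrable lborel {a..a + d} f"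
      using lborel_integrable_real_affine_iff[of 1 "\<lambda>x. indicator {a..a + d} x *\<^sub>R f x" a]
      by (simp only: eq set_integrable_def)
    show "(LBINT u:{0..d}. f (u + a)) = (LBINT u:{a..a + d}. f u)"
      using lborel_integral_real_affine[of 1 "\<lambda>x. indicator {a..a + d} x *\<^sub>R f x" a]
      by (simp only: eq set_lebesgue_integral_def) simp
  qed
  have sub: "{real j * d..real j * d + d} \<subseteq> {0..real N * d}" if "j < N" for j
  proof -
    have "real j * d + d = real (Suc j) * d" by (simp add: algebra_simps)
    also have "\<dots> \<le> real N * d" using that d by (intro mult_right_mono) auto
    finally show ?thesis using d by auto
  qed
  have int: "set_integrable lborel {real j * d..real j * d + d} f" if "j < N" for j
    by (rule set_integrable_subset[OF f _ sub[OF that]]) simp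
  then show "\<And>j. j < N \<Longrightarrow> set_integrable lborel {0..d} (\<lambda>u. f (u + real j * d))"
    by (simp add: shift)
  have "(LBINT u:{0..real n * d}. f u) = (\<Sum>j<n. LBINT u:{0..d}. f (u + real j * d))" if "n \<le> N" for n
    using that
  proof (induction n)
    case 0
    show ?case using set_integral_singleton[of 0 f] by simp
  next
    case (Suc n)
    have S: "real (Suc n) * d = real n * d + d" by (simp add: algebra_simps)
    have le: "real n * d + d \<le> real N * d"
      using sub[of n] Suc.prems d by auto
    have i: "set_integrable lborel {0..real n * d + d} f"
      using le by (intro set_integrable_subset[OF f]) auto
    then have i2: "set_integrable lborel {0..real n * d} f"
      using d by (intro set_integrable_subset[OF i]) auto
    have "integral {0..real n * d} f + integral {real n * d..real n * d + d} f = integral {0..real n * d + d} f"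
      using d by (intro Henstock_Kurzweil_Integration.integral_combine set_borel_integral_eq_integral(1)[OF i]) auto
    then have "(LBINT u:{0..real n * d}. f u) + (LBINT u:{real n * d..real n * d + d}. f u) = (LBINT u:{0..real n * d + d}. f u)"
      using i i2 int[of n] Suc.prems by (simp add: set_borel_integral_eq_integral(2))
    then show ?case unfolding S using Suc by (simp add: shift)
  qed
  then show "(LBINT u:{0..real N * d}. f u) = (\<Sum>j<N. LBINT u:{0..d}. f (u + real j * d))" by simp
qed

text \<open>Stated with the nonnegative integral, so that no integrability of \<open>f ^ n\<close>
  along a path is presupposed: when the right side is infinite, the claim is trivial.\<close>

lemma set_integral_even_power_mean:
  fixes f :: "real \<Rightarrow> real"
  assumes d: "d > 0" and n: "even n" "n \<ge> 1" and f: "set_integrable lborel {0..d} f"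
  shows "ennreal ((LBINT u:{0..d}. f u) ^ n) \<le>
    ennreal (d ^ (n - 1)) * (\<integral>\<^sup>+u. ennreal (f u ^ n) * indicator {0..d} u \<partial>lborel)"
proof (cases "(\<integral>\<^sup>+u. ennreal (f u ^ n) * indicator {0..d} u \<partial>lborel) = \<infinity>")
  case True
  then show ?thesis using d by (simp add: ennreal_mult_top)
next
  case False
  have pw: "\<bar>x\<bar> powr real n = x ^ n" for x :: real
    using n by (cases "x = 0") (auto simp: powr_realpow power_even_abs)
  have m: "(\<lambda>u. indicator {0..d} u *\<^sub>R f u) \<in> borel_measurable lborel"
    using f by (auto simp: set_integrable_def)
  have eq: "indicator {0..d} u *\<^sub>R f u ^ n = (indicator {0..d} u *\<^sub>R f u) ^ n" for u
    using n by (auto simp: indicator_def power_0_left)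
  have e2: "ennreal (norm (indicator {0..d} u *\<^sub>R f u ^ n)) = ennreal (f u ^ n) * indicator {0..d} u" for u
    using n by (auto simp: indicator_def zero_le_even_power)
  have fn: "set_integrable lborel {0..d} (\<lambda>u. f u ^ n)"
    unfolding set_integrable_def
  proof (rule integrableI_bounded)
    show "(\<lambda>x. indicat_real {0..d} x *\<^sub>R f x ^ n) \<in> borel_measurable lborel"
      unfolding eq using m by (rule borel_measurable_power)
    show "(\<integral>\<^sup>+ x. ennreal (norm (indicat_real {0..d} x *\<^sub>R f x ^ n)) \<partial>lborel) < \<infinity>"
      using False unfolding e2 by (simp add: less_top)
  qed
  have "\<bar>LBINT u:{0..d}. f u\<bar> powr real n \<le> d powr (real n - 1) * (LBINT u:{0..d}. \<bar>f u\<bar> powr real n)"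
    using n fn by (intro set_integral_power_mean d f) (simp_all add: pw)
  also have "d powr (real n - 1) = d ^ (n - 1)" using d n by (simp add: of_nat_diff flip: powr_realpow)
  finally have le: "(LBINT u:{0..d}. f u) ^ n \<le> d ^ (n - 1) * (LBINT u:{0..d}. f u ^ n)" by (simp add: pw)
  have "(\<integral>\<^sup>+u. ennreal (f u ^ n) * indicator {0..d} u \<partial>lborel) =
      (\<integral>\<^sup>+u. ennreal (indicator {0..d} u *\<^sub>R f u ^ n) \<partial>lborel)"
    by (intro nn_integral_cong) (auto simp: indicator_def)
  also have "\<dots> = ennreal (LBINT u:{0..d}. f u ^ n)"
    unfolding set_lebesgue_integral_def using fn n
    by (intro nn_integral_eq_integral) (auto simp: set_integrable_def indicator_def zero_le_even_power intro!: AE_I2)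
  finally show ?thesis
    using ennreal_leI[OF le] d by (simp add: ennreal_mult')
qed

text \<open>\<open>X t\<close> and \<open>\<Lambda> (trawl_at g t)\<close> agree outside a null set
  that depends on \<open>t\<close>. Hence paths are integrated for \<open>X\<close> only, and the
  basis is substituted at finitely many fixed times, inside an expectation.\<close>

locale integrated_trawl = analytic_levy_trawl \<kappa> F r M \<Lambda> g C\<^sub>g \<beta>
  for \<kappa> F r and M :: "'a measure" and \<Lambda> g C\<^sub>g \<beta> +
  fixes X :: "real \<Rightarrow> 'a \<Rightarrow> real"
  assumes X_joint: "(\<lambda>(t, \<omega>). X t \<omega>) \<in> borel_measurable (borel \<Otimes>\<^sub>M M)"
    and X_eq: "\<And>t. AE \<omega> in M. X t \<omega> = \<Lambda> (trawl_at g t) \<omega>"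
begin

sublocale LM: pair_sigma_finite lborel M ..

lemma X_measurable [measurable (raw)]:
  assumes f: "f \<in> borel_measurable N" and h: "h \<in> measurable N M"
  shows "(\<lambda>p. X (f p) (h p)) \<in> borel_measurable N"
  using measurable_compose[OF measurable_Pair[OF f h] X_joint] by simp

lemma basis_integrable_abs_powr:
  assumes B: "B \<in> fmeasurable lborel" and p: "p \<ge> 0"
  shows "integrable M (\<lambda>\<omega>. \<bar>\<Lambda> B \<omega>\<bar> powr p)"
proof -
  obtain k :: nat where k: "p \<le> real k" using real_arch_simple by blast
  note le = abs_powr_le_even_power[OF p k]
  have m: "\<Lambda> B \<in> borel_measurable M" using B by measurable
  show ?thesis
  proof (rule Bochner_Integration.integrable_bound)
    show "integrable M (\<lambda>\<omega>. 1 + \<Lambda> B \<omega> ^ (2 * k))" using basis_integrable_power[OF B] by simp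
    show "AE \<omega> in M. norm (\<bar>\<Lambda> B \<omega>\<bar> powr p) \<le> norm (1 + \<Lambda> B \<omega> ^ (2 * k))"
      using le by (intro AE_I2) (auto intro: order_trans[OF le])
  qed (use m in measurable)
qed

lemma X_moment_bound:
  assumes n: "even n" "n > 0"
  obtains C where "C \<ge> 0" "\<And>t. (\<integral>\<^sup>+\<omega>. ennreal (X t \<omega> ^ n) \<partial>M) \<le> ennreal C"
proof -
  let ?K = "C\<^sub>g / (\<beta> - 1)"
  have K: "?K \<ge> 0" using Cg_nonneg \<beta> by simp
  obtain C where C: "C \<ge> 0" "\<And>B. B \<in> fmeasurable lborel \<Longrightarrow> measure lborel B \<le> ?K \<Longrightarrow>
    expectation (\<lambda>\<omega>. \<Lambda> B \<omega> ^ n) \<le> C * measure lborel B"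
    by (rule basis_moment_bound[OF n K]) blast
  show ?thesis
  proof (rule that[of "C * ?K"])
    fix t
    let ?A = "trawl_at g t"
    have le: "measure lborel ?A \<le> ?K" using measure_trawl_tail[of 0 t] by (simp add: trawl_at_tail)
    have "(\<integral>\<^sup>+\<omega>. ennreal (X t \<omega> ^ n) \<partial>M) = (\<integral>\<^sup>+\<omega>. ennreal (\<Lambda> ?A \<omega> ^ n) \<partial>M)"
      using X_eq[of t] by (intro nn_integral_cong_AE) auto
    also have "\<dots> = ennreal (expectation (\<lambda>\<omega>. \<Lambda> ?A \<omega> ^ n))"
      using n by (intro nn_integral_eq_integral basis_integrable_power trawl_at_fmeasurable AE_I2 zero_le_even_power)
    also have "\<dots> \<le> ennreal (C * ?K)"
      using C(2)[OF trawl_at_fmeasurable le] mult_left_mono[OF le C(1)] by (intro ennreal_leI) linarith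
    finally show "(\<integral>\<^sup>+\<omega>. ennreal (X t \<omega> ^ n) \<partial>M) \<le> ennreal (C * ?K)" .
  qed (rule mult_nonneg_nonneg[OF C(1) K])
qed

lemma nn_integral_time_bound:
  assumes h: "case_prod h \<in> borel_measurable (lborel \<Otimes>\<^sub>M M)" and t: "t \<ge> 0"
    and le: "\<And>u. (\<integral>\<^sup>+\<omega>. h u \<omega> \<partial>M) \<le> ennreal C"
  shows "(\<integral>\<^sup>+\<omega>. \<integral>\<^sup>+u. h u \<omega> * indicator {0..t} u \<partial>lborel \<partial>M) \<le> ennreal C * ennreal t"
proof -
  have h': "(\<lambda>p. h (fst p) (snd p)) \<in> borel_measurable (lborel \<Otimes>\<^sub>M M)"
    using h by (simp add: case_prod_beta')
  have "(\<integral>\<^sup>+\<omega>. \<integral>\<^sup>+u. h u \<omega> * indicator {0..t} u \<partial>lborel \<partial>M) =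
      (\<integral>\<^sup>+u. \<integral>\<^sup>+\<omega>. h u \<omega> * indicator {0..t} u \<partial>M \<partial>lborel)"
    by (rule LM.Fubini') (use h' in \<open>simp add: case_prod_beta'\<close>)
  also have "\<dots> = (\<integral>\<^sup>+u. (\<integral>\<^sup>+\<omega>. h u \<omega> \<partial>M) * indicator {0..t} u \<partial>lborel)"
    by (intro nn_integral_cong) (auto simp: indicator_def)
  also have "\<dots> \<le> (\<integral>\<^sup>+u. ennreal C * indicator {0..t} u \<partial>lborel)"
    by (intro nn_integral_mono mult_right_mono le) auto
  also have "\<dots> = ennreal C * ennreal t" using t by (simp add: nn_integral_cmult_indicator)
  finally show ?thesis .
qed

lemma X_path_integrable:
  assumes t: "t \<ge> 0"
  shows "AE \<omega> in M. set_integrable lborel {0..t} (\<lambda>u. X u \<omega>)"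
proof -
  obtain C where C: "C \<ge> 0" "\<And>t. (\<integral>\<^sup>+\<omega>. ennreal (X t \<omega> ^ 2) \<partial>M) \<le> ennreal C"
    using X_moment_bound[of 2] by auto
  have "(\<integral>\<^sup>+\<omega>. ennreal \<bar>X u \<omega>\<bar> \<partial>M) \<le> ennreal (1 + C)" for u
  proof -
    have "(\<integral>\<^sup>+\<omega>. ennreal \<bar>X u \<omega>\<bar> \<partial>M) \<le> (\<integral>\<^sup>+\<omega>. 1 + ennreal (X u \<omega> ^ 2) \<partial>M)"
    proof (intro nn_integral_mono)
      fix \<omega>
      have "\<bar>X u \<omega>\<bar> \<le> 1 + X u \<omega> ^ 2" using abs_power_le_sum[of 0 1 2 "X u \<omega>"] by simp
      then have "ennreal \<bar>X u \<omega>\<bar> \<le> ennreal (1 + X u \<omega> ^ 2)" by (rule ennreal_leI)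
      then show "ennreal \<bar>X u \<omega>\<bar> \<le> 1 + ennreal (X u \<omega> ^ 2)" by simp
    qed
    also have "\<dots> = 1 + (\<integral>\<^sup>+\<omega>. ennreal (X u \<omega> ^ 2) \<partial>M)"
      by (subst nn_integral_add) (auto simp: emeasure_space_1)
    also have "\<dots> \<le> 1 + ennreal C" using C(2) by (intro add_left_mono)
    also have "\<dots> = ennreal (1 + C)" using C(1) by simp
    finally show ?thesis .
  qed
  from nn_integral_time_bound[OF _ t this]
  have "(\<integral>\<^sup>+\<omega>. \<integral>\<^sup>+u. ennreal \<bar>X u \<omega>\<bar> * indicator {0..t} u \<partial>lborel \<partial>M) \<le> ennreal (1 + C) * ennreal t"
    by simp
  also have "\<dots> < \<infinity>" by (simp add: ennreal_mult_less_top)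
  finally have "AE \<omega> in M. (\<integral>\<^sup>+u. ennreal \<bar>X u \<omega>\<bar> * indicator {0..t} u \<partial>lborel) \<noteq> \<infinity>"
    by (intro nn_integral_PInf_AE) auto
  with AE_space show ?thesis
  proof eventually_elim
    case (elim \<omega>)
    have [measurable]: "(\<lambda>u. X u \<omega>) \<in> borel_measurable lborel"
      using elim(1) by (intro X_measurable) auto
    have "(\<integral>\<^sup>+u. ennreal (norm (indicator {0..t} u *\<^sub>R X u \<omega>)) \<partial>lborel) =
        (\<integral>\<^sup>+u. ennreal \<bar>X u \<omega>\<bar> * indicator {0..t} u \<partial>lborel)"
      by (intro nn_integral_cong) (auto simp: indicator_def)
    then show ?case
      using elim(2) unfolding set_integrable_def by (intro integrableI_bounded) (auto simp: less_top)
  qed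
qed

lemma integrated_measurable [measurable]: "integrated_process X t \<in> borel_measurable M"
proof -
  have "(\<lambda>(\<omega>, u). indicator {0..t} u *\<^sub>R X u \<omega>) \<in> borel_measurable (M \<Otimes>\<^sub>M lborel)"
    unfolding case_prod_beta' by measurable
  then have "(\<lambda>\<omega>. LINT u|lborel. indicator {0..t} u *\<^sub>R X u \<omega>) \<in> borel_measurable M"
    by (rule lborel.borel_measurable_lebesgue_integral)
  then show ?thesis by (simp add: integrated_process_def[abs_def] set_lebesgue_integral_def)
qed

text \<open>The \<open>N\<close> pieces are folded onto \<open>{0..d}\<close>, so that the power
  mean inequality is applied to the integral of a sum. Keeping the sum inside the power preserves
  the cancellation between the pieces; Tonelli's theorem then leaves a sum at fixed times.\<close>

lemma integrated_moment_le:
  assumes d: "d > 0" and N: "N \<ge> 1" and n: "even n" "n \<ge> 1" and C: "C \<ge> 0"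
    and le: "\<And>v. (\<integral>\<^sup>+\<omega>. ennreal ((\<Sum>j<N. \<Lambda> (trawl_at g (v + real j * d)) \<omega>) ^ n) \<partial>M) \<le> ennreal C"
  shows "(\<integral>\<^sup>+\<omega>. ennreal (integrated_process X (real N * d) \<omega> ^ n) \<partial>M) \<le> ennreal (d ^ n * C)"
proof -
  let ?f = "\<lambda>u \<omega>. \<Sum>j<N. X (u + real j * d) \<omega>"
  have meas: "(\<lambda>(u, \<omega>). ennreal (?f u \<omega> ^ n)) \<in> borel_measurable (lborel \<Otimes>\<^sub>M M)"
    unfolding case_prod_beta' by measurable
  have le': "(\<integral>\<^sup>+\<omega>. ennreal (?f v \<omega> ^ n) \<partial>M) \<le> ennreal C" for v
  proof -
    have "AE \<omega> in M. \<forall>j\<in>{..<N}. X (v + real j * d) \<omega> = \<Lambda> (trawl_at g (v + real j * d)) \<omega>"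
      by (rule AE_finite_allI) (use X_eq in auto)
    then have "(\<integral>\<^sup>+\<omega>. ennreal (?f v \<omega> ^ n) \<partial>M) =
        (\<integral>\<^sup>+\<omega>. ennreal ((\<Sum>j<N. \<Lambda> (trawl_at g (v + real j * d)) \<omega>) ^ n) \<partial>M)"
      by (intro nn_integral_cong_AE) (auto elim!: eventually_mono)
    then show ?thesis using le[of v] by simp
  qed
  have Nd: "real N * d \<ge> 0" using d by simp
  have path: "AE \<omega> in M. ennreal (integrated_process X (real N * d) \<omega> ^ n) \<le>
      ennreal (d ^ (n - 1)) * (\<integral>\<^sup>+u. ennreal (?f u \<omega> ^ n) * indicator {0..d} u \<partial>lborel)"
    using X_path_integrable[OF Nd]
  proof eventually_elim
    case (elim \<omega>)
    note split = set_integral_split_sum[OF less_imp_le[OF d] elim]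
    have int: "set_integrable lborel {0..d} (\<lambda>u. ?f u \<omega>)"
      using split(1) unfolding set_integrable_def scaleR_sum_right
      by (intro Bochner_Integration.integrable_sum) auto
    have "integrated_process X (real N * d) \<omega> = (LBINT u:{0..d}. ?f u \<omega>)"
      unfolding integrated_process_def split(2) using split(1)
      unfolding set_integrable_def set_lebesgue_integral_def scaleR_sum_right
      by (intro Bochner_Integration.integral_sum[symmetric]) auto
    then show ?case
      using set_integral_even_power_mean[OF d n int] by simp
  qed
  have "(\<integral>\<^sup>+\<omega>. ennreal (integrated_process X (real N * d) \<omega> ^ n) \<partial>M) \<le>
      (\<integral>\<^sup>+\<omega>. ennreal (d ^ (n - 1)) * (\<integral>\<^sup>+u. ennreal (?f u \<omega> ^ n) * indicator {0..d} u \<partial>lborel) \<partial>M)"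
    by (rule nn_integral_mono_AE[OF path])
  also have "\<dots> = ennreal (d ^ (n - 1)) * (\<integral>\<^sup>+\<omega>. (\<integral>\<^sup>+u. ennreal (?f u \<omega> ^ n) * indicator {0..d} u \<partial>lborel) \<partial>M)"
  proof (rule nn_integral_cmult)
    have "(\<lambda>(\<omega>, u). ennreal (?f u \<omega> ^ n) * indicator {0..d} u) \<in> borel_measurable (M \<Otimes>\<^sub>M lborel)"
      unfolding case_prod_beta' by measurable
    then show "(\<lambda>\<omega>. \<integral>\<^sup>+u. ennreal (?f u \<omega> ^ n) * indicator {0..d} u \<partial>lborel) \<in> borel_measurable M"
      by (rule lborel.borel_measurable_nn_integral)
  qed
  also have "\<dots> \<le> ennreal (d ^ (n - 1)) * (ennreal C * ennreal d)"
    using meas le' d by (intro mult_left_mono nn_integral_time_bound) auto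
  also have "\<dots> = ennreal (d ^ n * C)"
    using d C n by (cases n) (auto simp: mult_ac simp flip: ennreal_mult)
  finally show ?thesis .
qed

lemma integrated_even_moment_finite:
  assumes t: "t \<ge> 0" and n: "even n" "n \<ge> 1"
  shows "integrable M (\<lambda>\<omega>. integrated_process X t \<omega> ^ n)"
proof (cases "t = 0")
  case True
  have "integrated_process X 0 \<omega> = 0" for \<omega>
    by (simp only: integrated_process_def set_integral_singleton)
  then show ?thesis using True n by simp
next
  case False
  obtain C where C: "C \<ge> 0" "\<And>t. (\<integral>\<^sup>+\<omega>. ennreal (X t \<omega> ^ n) \<partial>M) \<le> ennreal C"
    using X_moment_bound[of n] n by auto
  have "(\<integral>\<^sup>+\<omega>. ennreal (integrated_process X (real 1 * t) \<omega> ^ n) \<partial>M) \<le> ennreal (t ^ n * C)"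
  proof (rule integrated_moment_le)
    fix v
    have "(\<integral>\<^sup>+\<omega>. ennreal (X v \<omega> ^ n) \<partial>M) = (\<integral>\<^sup>+\<omega>. ennreal (\<Lambda> (trawl_at g v) \<omega> ^ n) \<partial>M)"
      using X_eq[of v] by (intro nn_integral_cong_AE) auto
    then show "(\<integral>\<^sup>+\<omega>. ennreal ((\<Sum>j<1. \<Lambda> (trawl_at g (v + real j * t)) \<omega>) ^ n) \<partial>M) \<le> ennreal C"
      using C(2)[of v] by simp
  qed (use t False n C in auto)
  then show ?thesis
    using n by (intro integrableI_bounded) (auto simp: zero_le_even_power order_le_less_trans[OF _ ennreal_less_top])
qed

lemma integrated_moment_finite:
  assumes t: "t \<ge> 0" and p: "p \<ge> 0"
  shows "integrable M (\<lambda>\<omega>. \<bar>integrated_process X t \<omega>\<bar> powr p)"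
proof -
  obtain k :: nat where k: "p \<le> real k" using real_arch_simple by blast
  have le: "\<bar>x\<bar> powr p \<le> 1 + x ^ (2 * (k + 1))" for x :: real
    using p k by (intro abs_powr_le_even_power) auto
  show ?thesis
  proof (rule Bochner_Integration.integrable_bound)
    show "integrable M (\<lambda>\<omega>. 1 + integrated_process X t \<omega> ^ (2 * (k + 1)))"
      using integrated_even_moment_finite[OF t, of "2 * (k + 1)"] by simp
    show "AE \<omega> in M. norm (\<bar>integrated_process X t \<omega>\<bar> powr p) \<le> norm (1 + integrated_process X t \<omega> ^ (2 * (k + 1)))"
      by (intro AE_I2) (use le in \<open>auto intro: order_trans[OF le]\<close>)
  qed measurable
qed

text \<open>The tangent inequality at \<open>t \<Lambda> B\<close>, where \<open>B\<close> is contained in every trawl over \<open>[0, t]\<close>: the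
  linear term has mean zero because \<open>X u - \<Lambda> B\<close> is centred and independent of \<open>\<Lambda> B\<close>.\<close>

lemma integrated_moment_ge:
  assumes t: "t > 0" and q: "q \<ge> 1"
  shows "t powr q * expectation (\<lambda>\<omega>. \<bar>\<Lambda> (trawl_tail g t t) \<omega>\<bar> powr q)
    \<le> expectation (\<lambda>\<omega>. \<bar>integrated_process X t \<omega>\<bar> powr q)"
proof -
  define B where "B = trawl_tail g t t"
  have B: "B \<in> fmeasurable lborel" using t by (simp add: B_def trawl_tail_fmeasurable)
  define U where "U = \<Lambda> B"
  have [measurable]: "U \<in> borel_measurable M" using B by (simp add: U_def basis_measurable)
  \<comment> \<open>Up to the factor \<open>q\<close>, this is the derivative of
    \<open>\<bar>v\<bar> powr q\<close>, the slope in the tangent inequality.\<close>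
  define \<psi> where "\<psi> = (\<lambda>v::real. sgn v * \<bar>v\<bar> powr (q - 1))"
  have [measurable]: "\<psi> \<in> borel_measurable borel" unfolding \<psi>_def by measurable
  have abs\<psi>: "\<bar>\<psi> v\<bar> = \<bar>v\<bar> powr (q - 1)" for v by (simp add: \<psi>_def abs_mult sgn_if)
  have \<psi>2: "\<psi> v ^ 2 = \<bar>v\<bar> powr (2 * q - 2)" for v
  proof -
    have "\<psi> v ^ 2 = \<bar>\<psi> v\<bar> * \<bar>\<psi> v\<bar>" by (simp add: power2_eq_square)
    also have "\<dots> = \<bar>v\<bar> powr (2 * q - 2)" unfolding abs\<psi> by (simp flip: powr_add)
    finally show ?thesis .
  qed
  have i\<psi>: "integrable M (\<lambda>\<omega>. \<psi> (U \<omega>))"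
    using basis_integrable_abs_powr[OF B, of "q - 1"] q
    by (subst integrable_abs_iff[symmetric]) (simp_all add: abs\<psi> U_def[symmetric])
  have i\<psi>2: "integrable M (\<lambda>\<omega>. \<psi> (U \<omega>) ^ 2)"
    using basis_integrable_abs_powr[OF B, of "2 * q - 2"] q by (simp add: \<psi>2 U_def)
  define W where "W = (\<lambda>u. \<Lambda> (trawl_at g u - B))"
  have D: "trawl_at g u - B \<in> fmeasurable lborel" for u
    by (rule fmeasurable_Diff[OF trawl_at_fmeasurable fmeasurableD[OF B]])
  have sub: "B \<subseteq> trawl_at g u" if "u \<in> {0..t}" for u
  proof
    fix p assume "p \<in> B"
    then obtain \<xi> s where p: "p = (\<xi>, s)" "0 \<le> \<xi>" "\<xi> \<le> g (t - s)" "s \<le> 0"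
      by (auto simp: B_def trawl_tail_def)
    moreover have "g (t - s) \<le> g (u - s)" using p that by (intro g_antimono) auto
    ultimately show "p \<in> trawl_at g u" using that by (auto simp: trawl_at_eq)
  qed
  have dec: "AE \<omega> in M. X u \<omega> - U \<omega> = W u \<omega>"
    and ind: "indep_var borel U borel (W u)" if u: "u \<in> {0..t}" for u
  proof -
    \<comment> \<open>A disjoint family of two sets indexed by booleans, through which the basis
      splits \<open>X u\<close> into the independent variables \<open>U\<close> and
      \<open>W u\<close>.\<close>
    define P where "P = (\<lambda>b. if b then B else trawl_at g u - B)"
    have P: "\<And>b. b \<in> insert True {False} \<Longrightarrow> P b \<in> fmeasurable lborel" "disjoint_family_on P (insert True {False})"
      using B D by (auto simp: P_def disjoint_family_on_def)
    note fam = basis_finite_family[of "insert True {False}" P, OF _ P]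
    have "(\<Union>b\<in>insert True {False}. P b) = trawl_at g u" using sub[OF u] by (auto simp: P_def)
    then have "AE \<omega> in M. \<Lambda> (trawl_at g u) \<omega> = U \<omega> + W u \<omega>"
      using fam(2) by (simp add: P_def U_def W_def)
    with X_eq[of u] show "AE \<omega> in M. X u \<omega> - U \<omega> = W u \<omega>"
      by eventually_elim simp
    have "indep_vars (\<lambda>_. borel) (\<lambda>b. \<Lambda> (P b)) (insert True {False})" using fam(1) by simp
    then have "indep_var borel (\<Lambda> (P True)) borel (\<lambda>\<omega>. \<Sum>b\<in>{False}. \<Lambda> (P b) \<omega>)"
      by (intro indep_vars_sum) auto
    then show "indep_var borel U borel (W u)" by (simp add: P_def U_def W_def)
  qed
  have iW: "integrable M (W u)" "expectation (W u) = 0" for u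
    using basis_integrable_power[OF D[of u], of 1] basis_mean_zero[OF D[of u]] by (simp_all add: W_def)
  let ?K = "C\<^sub>g / (\<beta> - 1)"
  have K: "?K \<ge> 0" using Cg_nonneg \<beta> by simp
  obtain C2 where C2: "C2 \<ge> 0" "\<And>B. B \<in> fmeasurable lborel \<Longrightarrow> measure lborel B \<le> ?K \<Longrightarrow>
    expectation (\<lambda>\<omega>. \<Lambda> B \<omega> ^ 2) \<le> C2 * measure lborel B"
    using basis_moment_bound[of 2 ?K] K by auto
  have W2: "expectation (\<lambda>\<omega>. W u \<omega> ^ 2) \<le> C2 * ?K" for u
  proof -
    have "measure lborel (trawl_at g u - B) \<le> measure lborel (trawl_at g u)"
      by (intro measure_mono_fmeasurable trawl_at_fmeasurable fmeasurableD[OF D]) auto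
    also have "\<dots> \<le> ?K" using measure_trawl_tail[of 0 u] by (simp add: trawl_at_tail)
    finally have le: "measure lborel (trawl_at g u - B) \<le> ?K" .
    show ?thesis
      using C2(2)[OF D le] mult_left_mono[OF le C2(1)] unfolding W_def by linarith
  qed
  define H where "H = (\<lambda>u \<omega>. indicator {0..t} u * (\<psi> (U \<omega>) * (X u \<omega> - U \<omega>)))"
  have Hm: "(\<lambda>(u, \<omega>). H u \<omega>) \<in> borel_measurable (lborel \<Otimes>\<^sub>M M)"
    unfolding H_def case_prod_beta' by measurable
  \<comment> \<open>The bound of a product by the sum of two squares is uniform in \<open>u\<close>,
    so \<open>H\<close> is integrable on the product space. Fubini's theorem then transfers the zero
    mean from fixed times to the time integral.\<close>
  have Habs: "(\<integral>\<^sup>+\<omega>. ennreal (norm (H u \<omega>)) \<partial>M) \<le>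
      ennreal (expectation (\<lambda>\<omega>. \<psi> (U \<omega>) ^ 2) + C2 * ?K) * indicator {0..t} u" for u
  proof (cases "u \<in> {0..t}")
    case True
    have iW2: "integrable M (\<lambda>\<omega>. W u \<omega> ^ 2)" unfolding W_def by (rule basis_integrable_power[OF D])
    have "(\<integral>\<^sup>+\<omega>. ennreal (norm (H u \<omega>)) \<partial>M) \<le> (\<integral>\<^sup>+\<omega>. ennreal (\<psi> (U \<omega>) ^ 2 + W u \<omega> ^ 2) \<partial>M)"
    proof (intro nn_integral_mono_AE)
      show "AE \<omega> in M. ennreal (norm (H u \<omega>)) \<le> ennreal (\<psi> (U \<omega>) ^ 2 + W u \<omega> ^ 2)"
        using dec[OF True]
      proof eventually_elim
        case (elim \<omega>)
        have "\<bar>a * b\<bar> \<le> a ^ 2 + b ^ 2" for a b :: real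
        proof -
          have "2 * \<bar>a * b\<bar> \<le> a ^ 2 + b ^ 2"
            using sum_squares_bound[of "\<bar>a\<bar>" "\<bar>b\<bar>"] by (simp add: abs_mult mult.assoc)
          then show ?thesis by linarith
        qed
        then show ?case using True elim by (auto simp: H_def intro!: ennreal_leI simp del: ennreal_plus)
      qed
    qed
    also have "\<dots> = ennreal (expectation (\<lambda>\<omega>. \<psi> (U \<omega>) ^ 2 + W u \<omega> ^ 2))"
      using i\<psi>2 iW2 by (intro nn_integral_eq_integral) auto
    also have "\<dots> \<le> ennreal (expectation (\<lambda>\<omega>. \<psi> (U \<omega>) ^ 2) + C2 * ?K)"
      using i\<psi>2 iW2 W2[of u] by (intro ennreal_leI) simp
    finally show ?thesis using True by simp
  qed (simp add: H_def)
  have Hint: "integrable (lborel \<Otimes>\<^sub>M M) (\<lambda>(u, \<omega>). H u \<omega>)"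
  proof (rule integrableI_bounded[OF Hm])
    have "(\<integral>\<^sup>+p. ennreal (norm (case p of (u, \<omega>) \<Rightarrow> H u \<omega>)) \<partial>(lborel \<Otimes>\<^sub>M M)) =
        (\<integral>\<^sup>+u. \<integral>\<^sup>+\<omega>. ennreal (norm (H u \<omega>)) \<partial>M \<partial>lborel)"
      using Hm by (subst nn_integral_fst[symmetric]) auto
    also have "\<dots> \<le> (\<integral>\<^sup>+u. ennreal (expectation (\<lambda>\<omega>. \<psi> (U \<omega>) ^ 2) + C2 * ?K) * indicator {0..t} u \<partial>lborel)"
      by (rule nn_integral_mono[OF Habs])
    also have "\<dots> = ennreal (expectation (\<lambda>\<omega>. \<psi> (U \<omega>) ^ 2) + C2 * ?K) * ennreal t"
      using t by (simp add: nn_integral_cmult_indicator)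
    also have "\<dots> < \<infinity>" by (simp add: ennreal_mult_less_top)
    finally show "(\<integral>\<^sup>+p. ennreal (norm (case p of (u, \<omega>) \<Rightarrow> H u \<omega>)) \<partial>(lborel \<Otimes>\<^sub>M M)) < \<infinity>" .
  qed
  have H0: "(LINT \<omega>|M. H u \<omega>) = 0" for u
  proof (cases "u \<in> {0..t}")
    case True
    have m: "W u \<in> borel_measurable M" unfolding W_def by (rule basis_measurable[OF D])
    have "(LINT \<omega>|M. H u \<omega>) = (LINT \<omega>|M. \<psi> (U \<omega>) * W u \<omega>)"
      using dec[OF True] True m by (intro integral_cong_AE) (auto simp: H_def elim!: eventually_mono)
    also have "\<dots> = expectation (\<lambda>\<omega>. \<psi> (U \<omega>)) * expectation (W u)"
    proof (rule indep_var_lebesgue_integral[OF _ i\<psi> iW(1)])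
      show "indep_var borel (\<lambda>\<omega>. \<psi> (U \<omega>)) borel (W u)"
      proof -
        have "indep_var borel (\<psi> \<circ> U) borel ((\<lambda>x. x) \<circ> W u)"
          by (rule indep_var_compose[OF ind[OF True]]) auto
        then show ?thesis unfolding o_def .
      qed
    qed
    finally show ?thesis using iW(2) by simp
  qed (simp add: H_def)
  define J where "J = (\<lambda>\<omega>. \<psi> (U \<omega>) * (integrated_process X t \<omega> - t * U \<omega>))"
  have HJ: "AE \<omega> in M. (LBINT u. H u \<omega>) = J \<omega>"
    using X_path_integrable[OF less_imp_le[OF t]]
  proof eventually_elim
    case (elim \<omega>)
    have c: "set_integrable lborel {0..t} (\<lambda>u. U \<omega>)"
      by (intro borel_integrable_atLeastAtMost' continuous_on_const)
    have ci: "(LBINT u:{0..t}. U \<omega>) = t * U \<omega>"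
      using t by (simp add: set_lebesgue_integral_def)
    have "(LBINT u. H u \<omega>) = (LBINT u. \<psi> (U \<omega>) * (indicator {0..t} u * (X u \<omega> - U \<omega>)))"
      unfolding H_def by (simp only: mult.left_commute)
    also have "\<dots> = \<psi> (U \<omega>) * (LBINT u:{0..t}. X u \<omega> - U \<omega>)"
      by (simp add: set_lebesgue_integral_def)
    also have "\<dots> = J \<omega>"
      using elim c by (simp add: set_integral_diff ci J_def integrated_process_def)
    finally show ?case .
  qed
  have Jm: "J \<in> borel_measurable M" unfolding J_def by measurable
  have iH: "integrable M (\<lambda>\<omega>. LBINT u. H u \<omega>)" by (rule LM.integrable_snd[OF Hint])
  have Hm': "(\<lambda>\<omega>. LBINT u. H u \<omega>) \<in> borel_measurable M" using iH by simp
  have iJ: "integrable M J" using iH integrable_cong_AE[OF Hm' Jm HJ] by simp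
  have "expectation J = (LINT \<omega>|M. (LBINT u. H u \<omega>))" using integral_cong_AE[OF Hm' Jm HJ] by simp
  also have "\<dots> = (LBINT u. (LINT \<omega>|M. H u \<omega>))" by (rule LM.Fubini_integral[OF Hint])
  finally have EJ: "expectation J = 0" by (simp add: H0)
  have tangent: "t powr q * \<bar>U \<omega>\<bar> powr q + q * t powr (q - 1) * J \<omega> \<le> \<bar>integrated_process X t \<omega>\<bar> powr q" for \<omega>
    using abs_powr_tangent[OF q, of "t * U \<omega>" "integrated_process X t \<omega>"] t
    by (simp add: abs_mult powr_mult J_def \<psi>_def sgn_mult mult_ac)
  have iU: "integrable M (\<lambda>\<omega>. \<bar>U \<omega>\<bar> powr q)"
    unfolding U_def using q by (intro basis_integrable_abs_powr B) auto
  have "t powr q * expectation (\<lambda>\<omega>. \<bar>U \<omega>\<bar> powr q) = expectation (\<lambda>\<omega>. t powr q * \<bar>U \<omega>\<bar> powr q + q * t powr (q - 1) * J \<omega>)"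
    using iU iJ EJ by simp
  also have "\<dots> \<le> expectation (\<lambda>\<omega>. \<bar>integrated_process X t \<omega>\<bar> powr q)"
    using iU iJ t q by (intro integral_mono tangent integrated_moment_finite) auto
  finally show ?thesis by (simp add: U_def B_def)
qed

end

subsection \<open>Scaling\<close>

text \<open>Power bounds with arbitrarily small loss in the exponent determine the limit, since
  constants vanish after division by \<open>ln t\<close>. The lower bound also makes
  \<open>f t\<close> eventually positive, so that \<open>ln\<close> has its genuine meaning
  there.\<close>

lemma log_ratio_tendsto:
  fixes f :: "real \<Rightarrow> real"
  assumes e0: "\<epsilon>\<^sub>0 > 0"
    and upper: "\<And>\<epsilon>. 0 < \<epsilon> \<Longrightarrow> \<epsilon> < \<epsilon>\<^sub>0 \<Longrightarrow> \<exists>C>0. \<forall>\<^sub>F t in at_top. f t \<le> C * t powr (l + \<epsilon>)"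
    and lower: "\<And>\<epsilon>. 0 < \<epsilon> \<Longrightarrow> \<epsilon> < \<epsilon>\<^sub>0 \<Longrightarrow> \<exists>c>0. \<forall>\<^sub>F t in at_top. c * t powr (l - \<epsilon>) \<le> f t"
  shows "((\<lambda>t. ln (f t) / ln t) \<longlongrightarrow> l) at_top"
proof (rule tendstoI)
  fix e :: real assume e: "e > 0"
  define \<epsilon> where "\<epsilon> = min (e / 2) (\<epsilon>\<^sub>0 / 2)"
  have \<epsilon>: "0 < \<epsilon>" "\<epsilon> < \<epsilon>\<^sub>0" "\<epsilon> < e" using e e0 by (auto simp: \<epsilon>_def)
  obtain C where C: "C > 0" "\<forall>\<^sub>F t in at_top. f t \<le> C * t powr (l + \<epsilon>)" using upper \<epsilon> by blast
  obtain c where c: "c > 0" "\<forall>\<^sub>F t in at_top. c * t powr (l - \<epsilon>) \<le> f t" using lower \<epsilon> by blast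
  have small: "\<forall>\<^sub>F t in at_top. \<bar>ln b / ln t\<bar> < e - \<epsilon>" for b :: real
  proof -
    have "((\<lambda>t. ln b / ln t) \<longlongrightarrow> 0) at_top"
      by (intro tendsto_divide_0[OF tendsto_const] filterlim_at_top_imp_at_infinity ln_at_top)
    from tendstoD[OF this, of "e - \<epsilon>"] show ?thesis using \<epsilon> by (simp add: dist_real_def)
  qed
  show "\<forall>\<^sub>F t in at_top. dist (ln (f t) / ln t) l < e"
    using C(2) c(2) small[of C] small[of c] eventually_gt_at_top[of 1]
  proof eventually_elim
    case (elim t)
    have lt: "ln t > 0" using elim by simp
    have "0 < c * t powr (l - \<epsilon>)" using c elim by simp
    then have f0: "f t > 0" using elim by linarith
    have "ln (f t) \<le> ln (C * t powr (l + \<epsilon>))" using elim f0 by (intro ln_mono) auto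
    also have "\<dots> = ln C + (l + \<epsilon>) * ln t" using C elim by (simp add: ln_mult ln_powr)
    finally have "ln (f t) / ln t \<le> (ln C + (l + \<epsilon>) * ln t) / ln t" using lt by (intro divide_right_mono) auto
    then have 1: "ln (f t) / ln t \<le> ln C / ln t + (l + \<epsilon>)" using lt by (simp add: add_divide_distrib)
    have "ln c + (l - \<epsilon>) * ln t = ln (c * t powr (l - \<epsilon>))" using c elim by (simp add: ln_mult ln_powr)
    also have "\<dots> \<le> ln (f t)" using elim c by (intro ln_mono) auto
    finally have "(ln c + (l - \<epsilon>) * ln t) / ln t \<le> ln (f t) / ln t" using lt by (intro divide_right_mono) auto
    then have 2: "ln c / ln t + (l - \<epsilon>) \<le> ln (f t) / ln t" using lt by (simp add: add_divide_distrib)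
    have "ln C / ln t < e - \<epsilon>" "- (e - \<epsilon>) < ln c / ln t"
      using elim(3,4) by (simp_all only: abs_less_iff) linarith
    then show ?case
      using 1 2 unfolding dist_real_def abs_less_iff by (intro conjI) linarith+
  qed
qed

context integrated_trawl
begin

lemma integrated_even_moment_upper:
  assumes n: "even n" "n \<ge> 2" and \<gamma>: "\<gamma> < \<beta>" "\<gamma> \<le> real n"
    and n\<gamma>: "1 + max 0 (2 - \<gamma>) \<le> 2 * (real n - \<gamma> + 1) / real n"
  obtains C where "C \<ge> 0"
    "\<And>t. t \<ge> 1 \<Longrightarrow> expectation (\<lambda>\<omega>. integrated_process X t \<omega> ^ n) \<le> C * t powr (real n - \<gamma> + 1)"
proof -
  define e where "e = real n - \<gamma> + 1"
  have e: "e \<ge> 1" using \<gamma> by (simp add: e_def)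
  obtain C where C: "C \<ge> 0" "\<And>N d v. N \<ge> 1 \<Longrightarrow> 1 / 2 \<le> d \<Longrightarrow> d \<le> 1 \<Longrightarrow>
    (\<integral>\<^sup>+\<omega>. ennreal ((\<Sum>j<N. \<Lambda> (trawl_at g (v + real j * d)) \<omega>) ^ n) \<partial>M) \<le> ennreal (C * real N powr e)"
    using trawl_sum_moment_bound[OF n \<gamma> n\<gamma>] unfolding e_def by metis
  show ?thesis
  proof (rule that[of "C * 2 powr e"])
    fix t :: real assume t: "t \<ge> 1"
    \<comment> \<open>As \<open>t \<ge> 1\<close>, the ceiling is below
      \<open>t + 1 \<le> 2 * t\<close>. This gives both \<open>d \<ge> 1 / 2\<close> and the factor
      \<open>2 powr e\<close> of the constant.\<close>
    define N where "N = nat \<lceil>t\<rceil>"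
    have Nt: "t \<le> real N" "real N < t + 1" "N \<ge> 1" using t by (auto simp: N_def) linarith+
    define d where "d = t / real N"
    have d: "1 / 2 \<le> d" "d \<le> 1" "d > 0" using Nt t by (auto simp: d_def field_simps)
    have Nd: "real N * d = t" using Nt by (simp add: d_def)
    have "(\<integral>\<^sup>+\<omega>. ennreal (integrated_process X (real N * d) \<omega> ^ n) \<partial>M) \<le> ennreal (d ^ n * (C * real N powr e))"
      using n C d Nt by (intro integrated_moment_le) auto
    also have "d ^ n * (C * real N powr e) \<le> 1 * (C * (2 * t) powr e)"
      using d C e Nt t by (intro mult_mono mult_left_mono powr_mono2 power_le_one) auto
    also have "1 * (C * (2 * t) powr e) = C * 2 powr e * t powr e" using t by (simp add: powr_mult)
    finally have "(\<integral>\<^sup>+\<omega>. ennreal (integrated_process X t \<omega> ^ n) \<partial>M) \<le> ennreal (C * 2 powr e * t powr e)"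
      by (simp add: Nd ennreal_leI)
    moreover have "(\<integral>\<^sup>+\<omega>. ennreal (integrated_process X t \<omega> ^ n) \<partial>M) =
        ennreal (expectation (\<lambda>\<omega>. integrated_process X t \<omega> ^ n))"
      using t n by (intro nn_integral_eq_integral integrated_even_moment_finite AE_I2 zero_le_even_power) auto
    ultimately show "expectation (\<lambda>\<omega>. integrated_process X t \<omega> ^ n) \<le> C * 2 powr e * t powr (real n - \<gamma> + 1)"
      using C(1) by (simp add: e_def)
  qed (use C in simp)
qed

text \<open>Interpolation between the even exponents around \<open>q\<close>, split at the level
  \<open>T = t\<close>. The even exponents \<open>n\<close> give \<open>n - \<gamma> + 1\<close>,
  affine in \<open>n\<close> with slope one, so both terms become
  \<open>t powr (q - \<gamma> + 1)\<close> without loss.\<close>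

lemma integrated_moment_upper:
  assumes k: "k \<ge> 1" "real (2 * k) \<le> q" "q \<le> real (2 * k + 2)" and \<gamma>: "\<gamma> < \<beta>" "\<gamma> \<le> real (2 * k)"
    and n\<gamma>: "\<And>n. n \<ge> 2 * k \<Longrightarrow> 1 + max 0 (2 - \<gamma>) \<le> 2 * (real n - \<gamma> + 1) / real n"
  obtains C where "C > 0"
    "\<And>t. t \<ge> 1 \<Longrightarrow> expectation (\<lambda>\<omega>. \<bar>integrated_process X t \<omega>\<bar> powr q) \<le> C * t powr (q - \<gamma> + 1)"
proof -
  let ?n = "2 * k + 2"
  obtain C1 where C1: "C1 \<ge> 0" "\<And>t. t \<ge> 1 \<Longrightarrow> expectation (\<lambda>\<omega>. integrated_process X t \<omega> ^ (2 * k)) \<le> C1 * t powr (real (2 * k) - \<gamma> + 1)"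
    using integrated_even_moment_upper[of "2 * k" \<gamma>] k \<gamma> n\<gamma>[of "2 * k"] by auto
  obtain C2 where C2: "C2 \<ge> 0" "\<And>t. t \<ge> 1 \<Longrightarrow> expectation (\<lambda>\<omega>. integrated_process X t \<omega> ^ ?n) \<le> C2 * t powr (real ?n - \<gamma> + 1)"
    using integrated_even_moment_upper[of ?n \<gamma>] k \<gamma> n\<gamma>[of ?n] by auto
  show ?thesis
  proof (rule that[of "C1 + C2 + 1"])
    fix t :: real assume t: "t \<ge> 1"
    let ?Y = "integrated_process X t"
    have int: "integrable M (\<lambda>\<omega>. ?Y \<omega> ^ (2 * k))" "integrable M (\<lambda>\<omega>. ?Y \<omega> ^ ?n)"
      using t k by (intro integrated_even_moment_finite; simp)+
    have iq: "integrable M (\<lambda>\<omega>. \<bar>?Y \<omega>\<bar> powr q)"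
      using t k by (intro integrated_moment_finite) auto
    have "expectation (\<lambda>\<omega>. \<bar>?Y \<omega>\<bar> powr q) \<le>
      expectation (\<lambda>\<omega>. t powr (q - real (2 * k)) * ?Y \<omega> ^ (2 * k) + t powr (q - real ?n) * ?Y \<omega> ^ ?n)"
    proof (rule integral_mono[OF iq])
      show "integrable M (\<lambda>\<omega>. t powr (q - real (2 * k)) * ?Y \<omega> ^ (2 * k) + t powr (q - real ?n) * ?Y \<omega> ^ ?n)"
        using int by (intro Bochner_Integration.integrable_add integrable_mult_right)
    qed (rule abs_powr_interpolation, use t k in auto)
    also have "\<dots> = t powr (q - real (2 * k)) * expectation (\<lambda>\<omega>. ?Y \<omega> ^ (2 * k)) + t powr (q - real ?n) * expectation (\<lambda>\<omega>. ?Y \<omega> ^ ?n)"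
      using int by (subst Bochner_Integration.integral_add) auto
    also have "\<dots> \<le> t powr (q - real (2 * k)) * (C1 * t powr (real (2 * k) - \<gamma> + 1)) + t powr (q - real ?n) * (C2 * t powr (real ?n - \<gamma> + 1))"
      using C1 C2 t by (intro add_mono mult_left_mono) auto
    also have "\<dots> = (C1 + C2) * t powr (q - \<gamma> + 1)"
    proof -
      have "t powr (q - a) * (c * t powr (a - \<gamma> + 1)) = c * t powr (q - \<gamma> + 1)" for a c
      proof -
        have "t powr (q - a) * (c * t powr (a - \<gamma> + 1)) = c * (t powr (q - a) * t powr (a - \<gamma> + 1))" by simp
        also have "\<dots> = c * t powr (q - \<gamma> + 1)" unfolding powr_add[symmetric] by (simp add: algebra_simps)
        finally show ?thesis .
      qed
      then show ?thesis by (simp only: distrib_right)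
    qed
    also have "\<dots> \<le> (C1 + C2 + 1) * t powr (q - \<gamma> + 1)" by (intro mult_right_mono) auto
    finally show "expectation (\<lambda>\<omega>. \<bar>?Y \<omega>\<bar> powr q) \<le> (C1 + C2 + 1) * t powr (q - \<gamma> + 1)" .
  qed (use C1 C2 in simp)
qed

text \<open>The common part \<open>B\<close> of the trawls contains the rectangle of height
  \<open>g (2 * t)\<close> over birth times from \<open>- t\<close> to 0, hence has measure at least
  \<open>t * g (2 * t)\<close>. It also shrinks to measure 0 as \<open>t\<close> grows, so the
  small-time moment bound applies to it.\<close>

lemma integrated_moment_lower:
  assumes \<mu>: "law 1 \<mu>" "\<not> gaussian_law \<mu>" and q: "q \<ge> 1"
    and c: "c > 0" "\<And>x. T \<le> x \<Longrightarrow> c * x powr \<sigma> \<le> g x"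
  shows "\<exists>c'>0. \<forall>\<^sub>F t in at_top. c' * t powr (q + 1 + \<sigma>) \<le> expectation (\<lambda>\<omega>. \<bar>integrated_process X t \<omega>\<bar> powr q)"
proof -
  obtain b \<delta> where b: "b > 0" "\<delta> > 0" "\<And>a M. 0 < a \<Longrightarrow> a < \<delta> \<Longrightarrow> law a M \<Longrightarrow> integrable M (\<lambda>x. \<bar>x\<bar> powr q) \<Longrightarrow>
      b * a \<le> (LINT x|M. \<bar>x\<bar> powr q)"
    using absolute_moment_lower_bound[OF \<mu> F', of q] q by auto
  have "((\<lambda>t. C\<^sub>g / (\<beta> - 1) * (1 + t) powr (1 - \<beta>)) \<longlongrightarrow> C\<^sub>g / (\<beta> - 1) * 0) at_top"
    using \<beta> by (intro tendsto_mult tendsto_const tendsto_neg_powr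
      filterlim_tendsto_add_at_top[OF tendsto_const filterlim_ident]) auto
  then have small: "\<forall>\<^sub>F t in at_top. C\<^sub>g / (\<beta> - 1) * (1 + t) powr (1 - \<beta>) < \<delta>"
    using b(2) by (intro order_tendstoD) auto
  define c' where "c' = b * c * 2 powr \<sigma>"
  have "\<forall>\<^sub>F t in at_top. c' * t powr (q + 1 + \<sigma>) \<le> expectation (\<lambda>\<omega>. \<bar>integrated_process X t \<omega>\<bar> powr q)"
    using small eventually_ge_at_top[of "max 1 T"]
  proof eventually_elim
    case (elim t)
    then have t: "t \<ge> 1" "t \<ge> T" by auto
    define B where "B = trawl_tail g t t"
    have B: "B \<in> fmeasurable lborel" using t by (simp add: B_def trawl_tail_fmeasurable)
    have g2: "c * (2 * t) powr \<sigma> \<le> g (2 * t)" using t by (intro c) auto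
    have g2pos: "g (2 * t) > 0" using g2 c t by (smt (verit) mult_pos_pos powr_gt_zero)
    have "t * g (2 * t) = measure lborel ({0..g (2 * t)} \<times> {- t..0})"
      using rectangle_measure(2)[of "- t" 0 "g (2 * t)"] t g2pos by (simp add: mult.commute)
    also have "\<dots> \<le> measure lborel B"
    proof (rule measure_mono_fmeasurable)
      show "{0..g (2 * t)} \<times> {- t..0} \<subseteq> B"
      proof safe
        fix \<xi> s :: real assume "\<xi> \<in> {0..g (2 * t)}" "s \<in> {- t..0}"
        moreover from this have "g (2 * t) \<le> g (t - s)" using t by (intro g_antimono) auto
        ultimately show "(\<xi>, s) \<in> B" by (auto simp: B_def trawl_tail_def)
      qed
      show "{0..g (2 * t)} \<times> {- t..0} \<in> sets lborel"
        using rectangle_measure(1)[of "- t" 0 "g (2 * t)"] t g2pos by (intro fmeasurableD) auto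
    qed (rule B)
    finally have mB: "t * g (2 * t) \<le> measure lborel B" .
    have mB0: "0 < measure lborel B" using mB g2pos t by (smt (verit) mult_pos_pos)
    have mB\<delta>: "measure lborel B < \<delta>"
      using measure_trawl_tail[of t t] t elim by (simp add: B_def)
    have "b * measure lborel B \<le> expectation (\<lambda>\<omega>. \<bar>\<Lambda> B \<omega>\<bar> powr q)"
    proof -
      have "integrable (distr M borel (\<Lambda> B)) (\<lambda>x. \<bar>x\<bar> powr q)"
        using basis_integrable_abs_powr[OF B, of q] q basis_measurable[OF B]
        by (subst integrable_distr_eq) auto
      from b(3)[OF mB0 mB\<delta> law_basis[OF B] this] show ?thesis
        by (subst (asm) basis_expectation[OF B]) auto
    qed
    moreover have "b * (t * (c * (2 * t) powr \<sigma>)) \<le> b * measure lborel B"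
      using b t mB by (intro mult_left_mono order_trans[OF mult_left_mono[OF g2] mB]) auto
    ultimately have "t powr q * (b * (t * (c * (2 * t) powr \<sigma>))) \<le> t powr q * expectation (\<lambda>\<omega>. \<bar>\<Lambda> B \<omega>\<bar> powr q)"
      by (intro mult_left_mono) auto
    also have "\<dots> \<le> expectation (\<lambda>\<omega>. \<bar>integrated_process X t \<omega>\<bar> powr q)"
      unfolding B_def using t q by (intro integrated_moment_ge) auto
    also have "t powr q * (b * (t * (c * (2 * t) powr \<sigma>))) = c' * t powr (q + 1 + \<sigma>)"
      using t by (simp add: c'_def powr_add powr_mult)
    finally show ?case .
  qed
  moreover have "c' > 0" using b c by (simp add: c'_def)
  ultimately show ?thesis by blast
qed

end

section \<open>Choice of the exponents and conclusion\<close>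

lemma q_star: "even (q_star \<alpha>)" "2 * \<alpha> < real (q_star \<alpha>)"
proof -
  have "\<exists>n. even n \<and> 2 * \<alpha> < real n"
  proof
    show "even (2 * (nat \<lceil>\<alpha>\<rceil> + 1)) \<and> 2 * \<alpha> < real (2 * (nat \<lceil>\<alpha>\<rceil> + 1))" by auto linarith
  qed
  from LeastI_ex[OF this] show "even (q_star \<alpha>)" "2 * \<alpha> < real (q_star \<alpha>)"
    by (auto simp: q_star_def)
qed

text \<open>With \<open>\<gamma> = \<alpha> + 1 - \<epsilon>\<close>, this compares the exponents of the variance and of the \<open>n\<close>-th moment
  of the integrated process; it is where \<open>q > 2 \<alpha>\<close> enters.\<close>

lemma moment_exponent_condition:
  assumes "2 * \<alpha> < real n" "n \<ge> 2" "0 < \<epsilon>" "\<epsilon> \<le> \<alpha>" "\<gamma> = \<alpha> + 1 - \<epsilon>"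
  shows "1 + max 0 (2 - \<gamma>) \<le> 2 * (real n - \<gamma> + 1) / real n" "\<gamma> \<le> real n"
proof -
  \<comment> \<open>This is the comparison for \<open>\<gamma> < 2\<close>, where the variance bound
    has order \<open>N powr (3 - \<gamma>)\<close>; it rests on \<open>n \<ge> 2\<close>. For
    \<open>\<gamma> \<ge> 2\<close> the variance bound is linear and the comparison reads
    \<open>n \<ge> 2 * (\<alpha> - \<epsilon>)\<close>.\<close>
  have "(real n - 2) * (\<epsilon> - \<alpha>) \<le> 0" using assms by (intro mult_nonneg_nonpos) auto
  then have "real n * (2 - \<alpha> + \<epsilon>) \<le> 2 * (real n - \<alpha> + \<epsilon>)" by (simp add: algebra_simps)
  moreover have eq: "2 - \<gamma> = 1 - \<alpha> + \<epsilon>" "real n - \<gamma> + 1 = real n - \<alpha> + \<epsilon>"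
    using assms(5) by simp_all
  ultimately have "(1 + max 0 (2 - \<gamma>)) * real n \<le> 2 * (real n - \<gamma> + 1)"
    unfolding eq using assms(1,3) by (simp add: max_def algebra_simps)
  then show "1 + max 0 (2 - \<gamma>) \<le> 2 * (real n - \<gamma> + 1) / real n"
    using assms by (simp add: pos_le_divide_eq)
  have "2 \<le> real n" using assms by simp
  then show "\<gamma> \<le> real n" using assms by linarith
qed

theorem theorem3p1:
  fixes M :: "'a measure" and N :: "'b measure"
    and \<Lambda> :: "(real \<times> real) set \<Rightarrow> 'a \<Rightarrow> real"
    and L :: "real \<Rightarrow> 'b \<Rightarrow> real"
    and \<kappa>\<^sub>L :: "real \<Rightarrow> complex"
    and X :: "real \<Rightarrow> 'a \<Rightarrow> real"
    and g :: "real \<Rightarrow> real" and \<alpha> :: real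
  assumes "homogeneous_levy_basis M \<kappa>\<^sub>L \<Lambda>"
    and "levy_seed N \<kappa>\<^sub>L L"
    and "trawl_process M \<Lambda> g X"
    and "zero_mean M X"
    and "\<not> gaussian_law (distr N borel (L 1))"
    and "real_analytic_near_0 \<kappa>\<^sub>L"
    and "continuously_differentiable_nonneg g"
    and "strict_antimono_on {0..} g"
    and "\<alpha> > 0"
    and "regularly_varying (- \<alpha> - 1) g"
  shows "(\<forall>q\<ge>real (q_star \<alpha>).
            scaling_function_defined M (integrated_process X) q \<and>
            scaling_function M (integrated_process X) q = q - \<alpha>) \<and>
         (\<forall>p r. real (q_star \<alpha>) \<le> p \<and> p < r \<longrightarrow>
            scaling_function M (integrated_process X) p / p
              < scaling_function M (integrated_process X) r / r) \<and>
         intermittent M (integrated_process X)"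
proof -
  note \<alpha> = \<open>\<alpha> > 0\<close>
  obtain r F where r: "r > 0" and F: "F holomorphic_on ball 0 r" "\<And>x. \<bar>x\<bar> < r \<Longrightarrow> \<kappa>\<^sub>L x = F (of_real x)"
    using \<open>real_analytic_near_0 \<kappa>\<^sub>L\<close> by (auto simp: real_analytic_near_0_def)
  have \<kappa>0: "\<kappa>\<^sub>L 0 = 0"
    using \<open>homogeneous_levy_basis M \<kappa>\<^sub>L \<Lambda>\<close> by (auto simp: homogeneous_levy_basis_def has_cumulant_function_def)
  interpret analytic_levy_basis \<kappa>\<^sub>L F r M \<Lambda>
    by unfold_locales (use r F \<kappa>0 assms(1) in auto)
  have seed: "law 1 (distr N borel (L 1))"
  proof -
    interpret N: prob_space N using assms(2) by (simp add: levy_seed_def levy_process_def)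
    have "L 1 \<in> borel_measurable N" using assms(2) by (simp add: levy_seed_def levy_process_def)
    then show ?thesis
      using assms(2) by (auto simp: law_def levy_seed_def has_cumulant_function_def intro: N.real_distribution_distr)
  qed
  have g_cont: "continuous_on {0..} g"
    using assms(7) unfolding continuously_differentiable_nonneg_def
    by (auto simp: continuous_on_eq_continuous_within intro: DERIV_continuous)
  have g_strict: "g y < g x" if "0 \<le> x" "x < y" for x y
    using assms(8) that by (auto simp: monotone_on_def)
  have g_mono: "antimono_on {0..} g"
    using g_strict by (auto simp: monotone_on_def le_less)
  have g_nonneg: "0 \<le> g x" if "0 \<le> x" for x
    using assms(3) that by (auto simp: trawl_process_def trawl_function_def)
  have g_pos: "0 < g x" if "0 \<le> x" for x
    using g_strict[of x "x + 1"] g_nonneg[of "x + 1"] that by simp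
  have power_bound: "\<exists>C\<^sub>g. integrated_trawl \<kappa>\<^sub>L F r M \<Lambda> g C\<^sub>g (\<alpha> + 1 - \<epsilon>) X" if \<epsilon>: "0 < \<epsilon>" "\<epsilon> < \<alpha>" for \<epsilon>
  proof -
    obtain C where C: "C > 0" "\<And>x. 0 \<le> x \<Longrightarrow> g x \<le> C * (1 + x) powr (- (\<alpha> + 1 - \<epsilon>))"
      using regularly_varying_upper_bound[OF assms(10) g_pos g_mono, of "- (\<alpha> + 1 - \<epsilon>)"] \<epsilon> by auto
    interpret power_trawl g C "\<alpha> + 1 - \<epsilon>"
      by unfold_locales (use g_cont g_mono g_nonneg C \<epsilon> in auto)
    let ?A = "trawl_at g 0"
    \<comment> \<open>A rectangle inside the trawl shows that its measure is positive. The mean of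
      \<open>X 0\<close> is \<open>deriv F 0\<close> times this measure, up to a factor of modulus
      one, so it vanishes only if the derivative does.\<close>
    have "1 * g 1 = measure lborel ({0..g 1} \<times> {- 1..0::real})"
      using rectangle_measure(2)[of "- 1" 0 "g 1"] g_pos[of 1] by simp
    also have "\<dots> \<le> measure lborel ?A"
    proof (rule measure_mono_fmeasurable)
      show "{0..g 1} \<times> {- 1..0} \<subseteq> ?A"
      proof safe
        fix \<xi> s :: real assume "\<xi> \<in> {0..g 1}" "s \<in> {- 1..0}"
        moreover from this have "g 1 \<le> g (- s)" by (intro g_antimono) auto
        ultimately show "(\<xi>, s) \<in> ?A" by (auto simp: trawl_at_eq)
      qed
      show "{0..g 1} \<times> {- 1..0::real} \<in> sets lborel"
        using rectangle_measure(1)[of "- 1" 0 "g 1"] g_pos[of 1] by (intro fmeasurableD) auto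
    qed (rule trawl_at_fmeasurable)
    finally have pos: "measure lborel ?A > 0" using g_pos[of 1] by simp
    have X0: "AE \<omega> in M. X 0 \<omega> = \<Lambda> ?A \<omega>" "integrable M (X 0)" "(LINT \<omega>|M. X 0 \<omega>) = 0"
      using assms(3,4) by (auto simp: trawl_process_def zero_mean_def)
    have "expectation (\<Lambda> ?A) = expectation (X 0)"
      using X0 basis_measurable[OF trawl_at_fmeasurable] by (intro integral_cong_AE) auto
    then have "deriv F 0 = 0"
      using basis_mean[OF trawl_at_fmeasurable, of 0] X0 pos by simp
    then have "integrated_trawl \<kappa>\<^sub>L F r M \<Lambda> g C (\<alpha> + 1 - \<epsilon>) X"
      using assms(3) by unfold_locales (auto simp: trawl_process_def)
    then show ?thesis by blast
  qed
  have integ: "integrable M (\<lambda>\<omega>. \<bar>integrated_process X t \<omega>\<bar> powr p)" if t: "t \<ge> 0" "p \<ge> 0" for t p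
  proof -
    obtain C\<^sub>g where "integrated_trawl \<kappa>\<^sub>L F r M \<Lambda> g C\<^sub>g (\<alpha> + 1 - \<alpha> / 2) X" using power_bound[of "\<alpha> / 2"] \<alpha> by auto
    then interpret integrated_trawl \<kappa>\<^sub>L F r M \<Lambda> g C\<^sub>g "\<alpha> + 1 - \<alpha> / 2" X .
    show ?thesis using t by (rule integrated_moment_finite)
  qed
  have q2: "q_star \<alpha> \<ge> 2" using q_star[of \<alpha>] \<alpha> by (auto elim!: evenE)
  have lim: "(scaling_ratio M (integrated_process X) q \<longlongrightarrow> q - \<alpha>) at_top" if q: "q \<ge> real (q_star \<alpha>)" for q
    unfolding scaling_ratio_def[abs_def]
  proof (rule log_ratio_tendsto[OF \<alpha>])
    fix \<epsilon> :: real assume \<epsilon>: "0 < \<epsilon>" "\<epsilon> < \<alpha>"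
    obtain C\<^sub>g where "integrated_trawl \<kappa>\<^sub>L F r M \<Lambda> g C\<^sub>g (\<alpha> + 1 - \<epsilon> / 2) X" using power_bound[of "\<epsilon> / 2"] \<epsilon> by auto
    then interpret integrated_trawl \<kappa>\<^sub>L F r M \<Lambda> g C\<^sub>g "\<alpha> + 1 - \<epsilon> / 2" X .
    \<comment> \<open>The loss is \<open>\<epsilon>\<close> here but \<open>\<epsilon> / 2\<close>
      in the decay of \<open>g\<close>, which provides the gap required by
      \<open>weighted_atoms\<close>.\<close>
    define \<gamma> where "\<gamma> = \<alpha> + 1 - \<epsilon>"
    \<comment> \<open>\<open>2 * k\<close> is the largest even integer up to \<open>q\<close>. Since
      \<open>q_star \<alpha>\<close> is itself even, it is at most \<open>2 * k\<close>, so both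
      even exponents around \<open>q\<close> exceed \<open>2 * \<alpha>\<close>.\<close>
    define k where "k = nat \<lfloor>q / 2\<rfloor>"
    obtain k0 where k0: "q_star \<alpha> = 2 * k0" using q_star(1)[of \<alpha>] by (auto elim!: evenE)
    have "real k0 \<le> q / 2" using q k0 by simp
    then have kk: "k0 \<le> k" by (simp add: k_def le_nat_floor)
    have k: "k \<ge> 1" "real (2 * k) \<le> q" "q \<le> real (2 * k + 2)"
    proof -
      show "k \<ge> 1" using kk k0 q2 by simp
      have "real k = real_of_int \<lfloor>q / 2\<rfloor>" using q by (simp add: k_def)
      then show "real (2 * k) \<le> q" "q \<le> real (2 * k + 2)" by linarith+
    qed
    have cond: "1 + max 0 (2 - \<gamma>) \<le> 2 * (real n - \<gamma> + 1) / real n" "\<gamma> \<le> real n" if "n \<ge> 2 * k" for n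
    proof -
      have "q_star \<alpha> \<le> n" using that kk k0 by simp
      then have "2 * \<alpha> < real n" "n \<ge> 2" using q_star(2)[of \<alpha>] q2 by linarith+
      then show "1 + max 0 (2 - \<gamma>) \<le> 2 * (real n - \<gamma> + 1) / real n" "\<gamma> \<le> real n"
        using moment_exponent_condition[of \<alpha> n \<epsilon> \<gamma>] \<epsilon> by (auto simp: \<gamma>_def)
    qed
    have \<gamma>\<beta>: "\<gamma> < \<alpha> + 1 - \<epsilon> / 2" using \<epsilon> by (simp add: \<gamma>_def)
    obtain C where C: "C > 0" "\<And>t. t \<ge> 1 \<Longrightarrow> expectation (\<lambda>\<omega>. \<bar>integrated_process X t \<omega>\<bar> powr q) \<le> C * t powr (q - \<gamma> + 1)"
      using integrated_moment_upper[OF k \<gamma>\<beta> cond(2)[OF order_refl] cond(1)] by blast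
    show "\<exists>C>0. \<forall>\<^sub>F t in at_top. expectation (\<lambda>\<omega>. \<bar>integrated_process X t \<omega>\<bar> powr q) \<le> C * t powr (q - \<alpha> + \<epsilon>)"
    proof (intro exI[of _ C] conjI C(1))
      show "\<forall>\<^sub>F t in at_top. expectation (\<lambda>\<omega>. \<bar>integrated_process X t \<omega>\<bar> powr q) \<le> C * t powr (q - \<alpha> + \<epsilon>)"
        using eventually_ge_at_top[of 1]
      proof eventually_elim
        case (elim t)
        have "q - \<gamma> + 1 = q - \<alpha> + \<epsilon>" by (simp add: \<gamma>_def)
        then show ?case using C(2)[OF elim] by (simp only:)
      qed
    qed
    have "- \<alpha> - 1 - \<epsilon> < - \<alpha> - 1" using \<epsilon> by simp
    from regularly_varying_lower_bound[OF assms(10) g_pos g_mono this]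
    obtain c T where c: "c > 0" "\<And>x. T \<le> x \<Longrightarrow> c * x powr (- \<alpha> - 1 - \<epsilon>) \<le> g x" by blast
    have eq: "q + 1 + (- \<alpha> - 1 - \<epsilon>) = q - \<alpha> - \<epsilon>" by simp
    show "\<exists>c>0. \<forall>\<^sub>F t in at_top. c * t powr (q - \<alpha> - \<epsilon>) \<le> expectation (\<lambda>\<omega>. \<bar>integrated_process X t \<omega>\<bar> powr q)"
      using integrated_moment_lower[OF seed assms(5) _ c, of q] q q2 unfolding eq by auto
  qed
  have domain: "scaling_function_defined M (integrated_process X) q"
    and limit_value: "scaling_function M (integrated_process X) q = q - \<alpha>" if q: "q \<ge> real (q_star \<alpha>)" for q
  proof -
    have q0: "q > 0" using q q2 by simp
    \<comment> \<open>All moments are finite; the one of order \<open>q + 1\<close> witnesses that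
      \<open>q\<close> lies strictly below the supremum.\<close>
    have "ereal q < ereal (q + 1)" by simp
    also have "\<dots> \<le> moment_range M (integrated_process X)"
      unfolding moment_range_def using q0 integ by (intro Sup_upper imageI) auto
    finally show "scaling_function_defined M (integrated_process X) q"
      using lim[OF q] q0 by (auto simp: scaling_function_defined_def)
    show "scaling_function M (integrated_process X) q = q - \<alpha>"
      unfolding scaling_function_def using lim[OF q] by (intro tendsto_Lim) auto
  qed
  have mono: "scaling_function M (integrated_process X) p / p < scaling_function M (integrated_process X) r / r"
    if "real (q_star \<alpha>) \<le> p" "p < r" for p r
  proof -
    have "0 < p" using that q2 by simp
    \<comment> \<open>On this range the ratio of the scaling function to its argument is
      \<open>1 - \<alpha> / p\<close>, strictly increasing in \<open>p\<close>.\<close>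
    then have "\<alpha> / r < \<alpha> / p" using that \<alpha> by (intro divide_strict_left_mono) auto
    then show ?thesis
      using that \<open>0 < p\<close> by (simp add: limit_value diff_divide_distrib)
  qed
  have "intermittent M (integrated_process X)"
    unfolding intermittent_def
    by (intro exI[of _ "real (q_star \<alpha>)"] exI[of _ "real (q_star \<alpha>) + 1"] conjI domain mono) auto
  then show ?thesis using domain limit_value mono by blast
qed

end
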